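(* Let $H$ be a quasi-bialgebra, $A$ a left $H$-module algebra, $B$ a right $H$-module algebra and $\mathbb A$ an $H$-bicomodule algebra. Consider the right $H$-comodule algebra $A\blacktriangleright\!\!<\mathbb A$ with structure $$\rho(a\blacktriangleright\!\!<u)=(\theta^1\cdot a\blacktriangleright\!\!<\theta^2u_{\langle0\rangle})\otimes\theta^3u_{\langle1\rangle},\qquad\Phi_\rho=(1_A\blacktriangleright\!\!<\tilde X^1_\rho)\otimes\tilde X^2_\rho\otimes\tilde X^3_\rho,$$ and the left $H$-comodule algebra $\mathbb A>\!\!\blacktriangleleft B$ with structure $$\lambda(u>\!\!\blacktriangleleft b)=u_{[-1]}\theta^1\otimes(u_{[0]}\theta^2>\!\!\blacktriangleleft b\cdot\theta^3),\qquad\Phi_\lambda=\tilde X^1_\lambda\otimes\tilde X^2_\lambda\otimes(\tilde X^3_\lambda>\!\!\blacktriangleleft1_B).$$ Then the trivial identifications give algebra isomorphisms $$A\blacktriangleright\!\!<\mathbb A>\!\!\blacktriangleleft B\equiv(A\blacktriangleright\!\!<\mathbb A)>\!\!\blacktriangleleft B,\qquad A\blacktriangleright\!\!<\mathbb A>\!\!\blacktriangleleft B\equiv A\blacktriangleright\!\!<(\mathbb A>\!\!\blacktriangleleft B).$$ In particular (taking $\mathbb A=H$), $A\#H\#B\equiv(A\#H)>\!\!\blacktriangleleft B$ and $A\#H\#B\equiv A\blacktriangleright\!\!<(H\#B)$.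
   Context: All algebras and spaces are over a field $k$, $\otimes=\otimes_k$; summation is understood. A quasi-bialgebra $(H,\Delta,\varepsilon,\Phi)$: a unital associative algebra $H$, algebra maps $\Delta:H\to H\otimes H$ ($\Delta(h)=h_1\otimes h_2$), $\varepsilon:H\to k$, and an invertible $\Phi=X^1\otimes X^2\otimes X^3\in H^{\otimes3}$, $\Phi^{-1}=x^1\otimes x^2\otimes x^3$, with $(id\otimes\Delta)(\Delta(h))=\Phi(\Delta\otimes id)(\Delta(h))\Phi^{-1}$, $(id\otimes\varepsilon)\Delta=id=(\varepsilon\otimes id)\Delta$, $(1\otimes\Phi)(id\otimes\Delta\otimes id)(\Phi)(\Phi\otimes1)=(id\otimes id\otimes\Delta)(\Phi)(\Delta\otimes id\otimes id)(\Phi)$, $(id\otimes\varepsilon\otimes id)(\Phi)=1\otimes1$. A left $H$-module algebra: a left $H$-module $A$ with bilinear multiplication and two-sided unit $1_A$ with $(aa')a''=(X^1\cdot a)[(X^2\cdot a')(X^3\cdot a'')]$, $h\cdot(aa')=(h_1\cdot a)(h_2\cdot a')$, $h\cdot1_A=\varepsilon(h)1_A$. A right $H$-module algebra: a right $H$-module $B$ with bilinear multiplication and two-sided unit $1_B$ with $(bb')b''=(b\cdot x^1)[(b'\cdot x^2)(b''\cdot x^3)]$, $(bb')\cdot h=(b\cdot h_1)(b'\cdot h_2)$, $1_B\cdot h=\varepsilon(h)1_B$. A right $H$-comodule algebra: a unital associative algebra $\mathfrak A$, an algebra map $\rho:\mathfrak A\to\mathfrak A\otimes H$, $\rho(a)=a_{\langle0\rangle}\otimes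 a_{\langle1\rangle}$, and an invertible $\Phi_\rho=\tilde X^1_\rho\otimes\tilde X^2_\rho\otimes\tilde X^3_\rho\in\mathfrak A\otimes H\otimes H$, $\Phi_\rho^{-1}=\tilde x^1_\rho\otimes\tilde x^2_\rho\otimes\tilde x^3_\rho$, with $\Phi_\rho(\rho\otimes id)(\rho(a))=(id\otimes\Delta)(\rho(a))\Phi_\rho$, $(1\otimes\Phi)(id\otimes\Delta\otimes id)(\Phi_\rho)(\Phi_\rho\otimes1)=(id\otimes id\otimes\Delta)(\Phi_\rho)(\rho\otimes id\otimes id)(\Phi_\rho)$, $(id\otimes\varepsilon)\rho=id$, $(id\otimes\varepsilon\otimes id)(\Phi_\rho)=(id\otimes id\otimes\varepsilon)(\Phi_\rho)=1\otimes1$. A left $H$-comodule algebra: a unital associative algebra $\mathfrak B$, an algebra map $\lambda:\mathfrak B\to H\otimes\mathfrak B$, $\lambda(b)=b_{[-1]}\otimes b_{[0]}$, and an invertible $\Phi_\lambda=\tilde X^1_\lambda\otimes\tilde X^2_\lambda\otimes\tilde X^3_\lambda\in H\otimes H\otimes\mathfrak B$, $\Phi_\lambda^{-1}=\tilde x^1_\lambda\otimes\tilde x^2_\lambda\otimes\tilde x^3_\lambda$, with $(id\otimes\lambda)(\lambda(b))\Phi_\lambda=\Phi_\lambda(\Delta\otimes id)(\lambda(b))$, $(1\otimes\Phi_\lambda)(id\otimes\Delta\otimes id)(\Phi_\lambda)(\Phi\otimes1)=(id\otimes id\otimes\lambda)(\Phi_\lambda)(\Delta\otimes id\otimes id)(\Phi_\lambda)$,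 $(\varepsilon\otimes id)\lambda=id$, $(id\otimes\varepsilon\otimes id)(\Phi_\lambda)=(\varepsilon\otimes id\otimes id)(\Phi_\lambda)=1\otimes1$. An $H$-bicomodule algebra $(\mathbb A,\lambda,\rho,\Phi_\lambda,\Phi_\rho,\Phi_{\lambda,\rho})$: $(\mathbb A,\lambda,\Phi_\lambda)$ is a left and $(\mathbb A,\rho,\Phi_\rho)$ a right $H$-comodule algebra, and $\Phi_{\lambda,\rho}\in H\otimes\mathbb A\otimes H$ is invertible, $\Phi_{\lambda,\rho}^{-1}=\theta^1\otimes\theta^2\otimes\theta^3$, with $\Phi_{\lambda,\rho}(\lambda\otimes id)(\rho(u))=(id\otimes\rho)(\lambda(u))\Phi_{\lambda,\rho}$, $(1\otimes\Phi_{\lambda,\rho})(id\otimes\lambda\otimes id)(\Phi_{\lambda,\rho})(\Phi_\lambda\otimes1)=(id\otimes id\otimes\rho)(\Phi_\lambda)(\Delta\otimes id\otimes id)(\Phi_{\lambda,\rho})$, $(1\otimes\Phi_\rho)(id\otimes\rho\otimes id)(\Phi_{\lambda,\rho})(\Phi_{\lambda,\rho}\otimes1)=(id\otimes id\otimes\Delta)(\Phi_{\lambda,\rho})(\lambda\otimes id\otimes id)(\Phi_\rho)$. $H$ itself is an $H$-bicomodule algebra with $\lambda=\rho=\Delta$, $\Phi_\lambda=\Phi_\rho=\Phi_{\lambda,\rho}=\Phi$. Algebras (all associative and unital): generalized smash product $A\blacktriangleright\!\!<\mathfrak B$ ($\mathfrak B$ a left $H$-comodule algebra): $A\otimes\mathfrak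 B$ with $(a\blacktriangleright\!\!<b)(a'\blacktriangleright\!\!<b')=(\tilde x^1_\lambda\cdot a)(\tilde x^2_\lambda b_{[-1]}\cdot a')\blacktriangleright\!\!<\tilde x^3_\lambda b_{[0]}b'$; $\mathfrak A>\!\!\blacktriangleleft B$ ($\mathfrak A$ a right $H$-comodule algebra): $\mathfrak A\otimes B$ with $(a>\!\!\blacktriangleleft b)(a'>\!\!\blacktriangleleft b')=aa'_{\langle0\rangle}\tilde x^1_\rho>\!\!\blacktriangleleft(b\cdot a'_{\langle1\rangle}\tilde x^2_\rho)(b'\cdot\tilde x^3_\rho)$; two-sided generalized smash product $A\blacktriangleright\!\!<\mathbb A>\!\!\blacktriangleleft B$: $A\otimes\mathbb A\otimes B$ with $(a\blacktriangleright\!\!<u>\!\!\blacktriangleleft b)(a'\blacktriangleright\!\!<u'>\!\!\blacktriangleleft b')=(\tilde x^1_\lambda\cdot a)(\tilde x^2_\lambda u_{[-1]}\theta^1\cdot a')\blacktriangleright\!\!<\tilde x^3_\lambda u_{[0]}\theta^2u'_{\langle0\rangle}\tilde x^1_\rho>\!\!\blacktriangleleft(b\cdot\theta^3u'_{\langle1\rangle}\tilde x^2_\rho)(b'\cdot\tilde x^3_\rho)$. For $\mathbb A=H$ these are denoted $A\#H$, $H\#B$, $A\#H\#B$. *)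

theory Defs
  imports "HOL-Algebra.QuotRing" "HOL-Algebra.Module"
begin

text \<open>
  A vector space over \<open>K\<close> is a record of type \<open>('k, 'a) module\<close>. The fields \<open>mult\<close> and \<open>one\<close> of this
  record are used for the multiplication and the unit of an algebra, and are left unspecified for
  bare vector spaces.
\<close>

section \<open>Tensor products of vector spaces\<close>

context
  fixes K :: "'k ring"
begin

definition free_space :: "'s set \<Rightarrow> ('k, 's \<Rightarrow> 'k) module" where
  "free_space S =
    \<lparr>carrier = {f. (\<forall>x\<in>S. f x \<in> carrier K) \<and> (\<forall>x. x \<notin> S \<longrightarrow> f x = \<zero>\<^bsub>K\<^esub>) \<and> finite {x. f x \<noteq> \<zero>\<^bsub>K\<^esub>}},
     mult = undefined, one = undefined,
     zero = (\<lambda>x. \<zero>\<^bsub>K\<^esub>), add = (\<lambda>f g x. f x \<oplus>\<^bsub>K\<^esub> g x),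
     smult = (\<lambda>c f x. c \<otimes>\<^bsub>K\<^esub> f x)\<rparr>"

definition free_gen :: "'s \<Rightarrow> 's \<Rightarrow> 'k" where
  "free_gen s = (\<lambda>x. if x = s then \<one>\<^bsub>K\<^esub> else \<zero>\<^bsub>K\<^esub>)"

definition bilinear_relations ::
  "('k, 'a) module \<Rightarrow> ('k, 'b) module \<Rightarrow> ('a \<times> 'b \<Rightarrow> 'k) set" where
  "bilinear_relations V W = (let F = free_space (carrier V \<times> carrier W) in
      {free_gen (v \<oplus>\<^bsub>V\<^esub> v', w) \<ominus>\<^bsub>F\<^esub> (free_gen (v, w) \<oplus>\<^bsub>F\<^esub> free_gen (v', w)) | v v' w.
         v \<in> carrier V \<and> v' \<in> carrier V \<and> w \<in> carrier W}
    \<union> {free_gen (v, w \<oplus>\<^bsub>W\<^esub> w') \<ominus>\<^bsub>F\<^esub> (free_gen (v, w) \<oplus>\<^bsub>F\<^esub> free_gen (v, w')) | v w w'.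
         v \<in> carrier V \<and> w \<in> carrier W \<and> w' \<in> carrier W}
    \<union> {free_gen (c \<odot>\<^bsub>V\<^esub> v, w) \<ominus>\<^bsub>F\<^esub> (c \<odot>\<^bsub>F\<^esub> free_gen (v, w)) | c v w.
         c \<in> carrier K \<and> v \<in> carrier V \<and> w \<in> carrier W}
    \<union> {free_gen (v, c \<odot>\<^bsub>W\<^esub> w) \<ominus>\<^bsub>F\<^esub> (c \<odot>\<^bsub>F\<^esub> free_gen (v, w)) | c v w.
         c \<in> carrier K \<and> v \<in> carrier V \<and> w \<in> carrier W})"

definition tensor_null ::
  "('k, 'a) module \<Rightarrow> ('k, 'b) module \<Rightarrow> ('a \<times> 'b \<Rightarrow> 'k) set" where
  "tensor_null V W =
    \<Inter>{N. submodule N K (free_space (carrier V \<times> carrier W)) \<and> bilinear_relations V W \<subseteq> N}"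

end

type_synonym ('k, 'a, 'b) tensor = "('a \<times> 'b \<Rightarrow> 'k) set"
type_synonym ('k, 'a, 'b, 'c) tensor3 = "('k, 'a, ('k, 'b, 'c) tensor) tensor"
type_synonym ('k, 'a, 'b, 'c, 'd) tensor4 = "('k, 'a, ('k, 'b, 'c, 'd) tensor3) tensor"

text \<open>Iterated tensor products are nested to the right.\<close>

context
  fixes K :: "'k ring"
begin

definition tens ::
  "('k, 'a) module \<Rightarrow> ('k, 'b) module \<Rightarrow> 'a \<Rightarrow> 'b \<Rightarrow> ('k, 'a, 'b) tensor" where
  "tens V W v w =
    tensor_null K V W +>\<^bsub>free_space K (carrier V \<times> carrier W)\<^esub> free_gen K (v, w)"

definition tensor_space ::
  "('k, 'a) module \<Rightarrow> ('k, 'b) module \<Rightarrow> ('k, ('k, 'a, 'b) tensor) module" where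
  "tensor_space V W = (let F = free_space K (carrier V \<times> carrier W); N = tensor_null K V W in
    \<lparr>carrier = a_rcosets\<^bsub>F\<^esub> N,
     mult = undefined, one = undefined,
     zero = N, add = (\<lambda>s t. s <+>\<^bsub>F\<^esub> t),
     smult = (\<lambda>c t. \<Union>x\<in>t. N +>\<^bsub>F\<^esub> (c \<odot>\<^bsub>F\<^esub> x))\<rparr>)"

text \<open>
  Sweedler-type summation: for a tensor \<open>t = \<Sum>\<^sub>i v\<^sub>i \<otimes> w\<^sub>i\<close> and a bilinear map \<open>f\<close> with values in \<open>M\<close>,
  \<open>sw M t f = \<Sum>\<^sub>i f v\<^sub>i w\<^sub>i\<close>, i.e. the value at \<open>t\<close> of the linear map induced by \<open>f\<close>. The result does not
  depend on the representative \<open>x\<close> of \<open>t\<close> when \<open>f\<close> is bilinear, which is the only case used.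
\<close>

definition sw ::
  "('k, 'c) module \<Rightarrow> ('k, 'a, 'b) tensor \<Rightarrow> ('a \<Rightarrow> 'b \<Rightarrow> 'c) \<Rightarrow> 'c" where
  "sw M t f = (let x = (SOME x. x \<in> t) in
    \<Oplus>\<^bsub>M\<^esub>p\<in>{p. x p \<noteq> \<zero>\<^bsub>K\<^esub>}. x p \<odot>\<^bsub>M\<^esub> f (fst p) (snd p))"

definition sw3 ::
  "('k, 'd) module \<Rightarrow> ('k, 'a, 'b, 'c) tensor3 \<Rightarrow> ('a \<Rightarrow> 'b \<Rightarrow> 'c \<Rightarrow> 'd) \<Rightarrow> 'd" where
  "sw3 M t f = sw M t (\<lambda>x s. sw M s (\<lambda>y z. f x y z))"

definition tensor ::
  "('k, 'a) module \<Rightarrow> ('k, 'b) module \<Rightarrow> ('k, ('k, 'a, 'b) tensor) module" where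
  "tensor A B = (let T = tensor_space A B in T
    \<lparr>mult := (\<lambda>s t. sw T s (\<lambda>a b. sw T t (\<lambda>a' b'. tens A B (a \<otimes>\<^bsub>A\<^esub> a') (b \<otimes>\<^bsub>B\<^esub> b')))),
     one := tens A B \<one>\<^bsub>A\<^esub> \<one>\<^bsub>B\<^esub>\<rparr>)"

definition tensor3 ::
  "('k, 'a) module \<Rightarrow> ('k, 'b) module \<Rightarrow> ('k, 'c) module \<Rightarrow> ('k, ('k, 'a, 'b, 'c) tensor3) module"
  where "tensor3 A B C = tensor A (tensor B C)"

definition tens3 ::
  "('k, 'a) module \<Rightarrow> ('k, 'b) module \<Rightarrow> ('k, 'c) module \<Rightarrow> 'a \<Rightarrow> 'b \<Rightarrow> 'c
    \<Rightarrow> ('k, 'a, 'b, 'c) tensor3"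
  where "tens3 A B C a b c = tens A (tensor B C) a (tens B C b c)"

definition tensor4 ::
  "('k, 'a) module \<Rightarrow> ('k, 'b) module \<Rightarrow> ('k, 'c) module \<Rightarrow> ('k, 'd) module
    \<Rightarrow> ('k, ('k, 'a, 'b, 'c, 'd) tensor4) module"
  where "tensor4 A B C D = tensor A (tensor3 B C D)"

definition tens4 ::
  "('k, 'a) module \<Rightarrow> ('k, 'b) module \<Rightarrow> ('k, 'c) module \<Rightarrow> ('k, 'd) module
    \<Rightarrow> 'a \<Rightarrow> 'b \<Rightarrow> 'c \<Rightarrow> 'd \<Rightarrow> ('k, 'a, 'b, 'c, 'd) tensor4"
  where "tens4 A B C D a b c d = tens A (tensor3 B C D) a (tens3 B C D b c d)"

text \<open>
  The maps \<open>f \<otimes> id\<close> and \<open>id \<otimes> f\<close> into a threefold tensor product, and \<open>f \<otimes> id \<otimes> id\<close>, \<open>id \<otimes> f \<otimes> id\<close> and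
  \<open>id \<otimes> id \<otimes> f\<close> into a fourfold one, where \<open>f\<close> takes values in a twofold tensor product. The algebra
  arguments are the tensor factors of the target.
\<close>

definition map2_1 where
  "map2_1 A B C f t = sw (tensor3 A B C) t
    (\<lambda>x y. sw (tensor3 A B C) (f x) (\<lambda>x\<^sub>1 x\<^sub>2. tens3 A B C x\<^sub>1 x\<^sub>2 y))"

definition map2_2 where
  "map2_2 A B C f t = sw (tensor3 A B C) t
    (\<lambda>x y. sw (tensor3 A B C) (f y) (\<lambda>y\<^sub>1 y\<^sub>2. tens3 A B C x y\<^sub>1 y\<^sub>2))"

definition map3_1 where
  "map3_1 A B C D f t = sw3 (tensor4 A B C D) t
    (\<lambda>x y z. sw (tensor4 A B C D) (f x) (\<lambda>x\<^sub>1 x\<^sub>2. tens4 A B C D x\<^sub>1 x\<^sub>2 y z))"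

definition map3_2 where
  "map3_2 A B C D f t = sw3 (tensor4 A B C D) t
    (\<lambda>x y z. sw (tensor4 A B C D) (f y) (\<lambda>y\<^sub>1 y\<^sub>2. tens4 A B C D x y\<^sub>1 y\<^sub>2 z))"

definition map3_3 where
  "map3_3 A B C D f t = sw3 (tensor4 A B C D) t
    (\<lambda>x y z. sw (tensor4 A B C D) (f z) (\<lambda>z\<^sub>1 z\<^sub>2. tens4 A B C D x y z\<^sub>1 z\<^sub>2))"

text \<open>\<open>1 \<otimes> t\<close> and \<open>t \<otimes> 1\<close> in a fourfold tensor product, for \<open>t\<close> in a threefold one.\<close>

definition unit_left where
  "unit_left A B C D t = tens A (tensor3 B C D) \<one>\<^bsub>A\<^esub> t"

definition unit_right where
  "unit_right A B C D t = sw3 (tensor4 A B C D) t (\<lambda>x y z. tens4 A B C D x y z \<one>\<^bsub>D\<^esub>)"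

text \<open>The identification of \<open>A \<otimes> (B \<otimes> C)\<close> with \<open>(A \<otimes> B) \<otimes> C\<close>.\<close>

definition tensor_assoc ::
  "('k, 'a) module \<Rightarrow> ('k, 'b) module \<Rightarrow> ('k, 'c) module
    \<Rightarrow> ('k, 'a, 'b, 'c) tensor3 \<Rightarrow> ('k, ('k, 'a, 'b) tensor, 'c) tensor" where
  "tensor_assoc A B C t = sw3 (tensor_space (tensor_space A B) C) t
    (\<lambda>a b c. tens (tensor_space A B) C (tens A B a b) c)"

end

section \<open>Algebras\<close>

text \<open>Vector spaces with a bilinear, not necessarily associative, multiplication and a unit.\<close>

locale nonassoc_algebra = field K + module K A
  for K :: "'k ring" and A :: "('k, 'a) module" +
  assumes A_mult_closed: "\<lbrakk>x \<in> carrier A; y \<in> carrier A\<rbrakk> \<Longrightarrow> x \<otimes>\<^bsub>A\<^esub> y \<in> carrier A"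
    and A_one_closed: "\<one>\<^bsub>A\<^esub> \<in> carrier A"
    and A_l_one: "x \<in> carrier A \<Longrightarrow> \<one>\<^bsub>A\<^esub> \<otimes>\<^bsub>A\<^esub> x = x"
    and A_r_one: "x \<in> carrier A \<Longrightarrow> x \<otimes>\<^bsub>A\<^esub> \<one>\<^bsub>A\<^esub> = x"
    and A_l_distr: "\<lbrakk>x \<in> carrier A; y \<in> carrier A; z \<in> carrier A\<rbrakk>
      \<Longrightarrow> (x \<oplus>\<^bsub>A\<^esub> y) \<otimes>\<^bsub>A\<^esub> z = x \<otimes>\<^bsub>A\<^esub> z \<oplus>\<^bsub>A\<^esub> y \<otimes>\<^bsub>A\<^esub> z"
    and A_r_distr: "\<lbrakk>x \<in> carrier A; y \<in> carrier A; z \<in> carrier A\<rbrakk>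
      \<Longrightarrow> z \<otimes>\<^bsub>A\<^esub> (x \<oplus>\<^bsub>A\<^esub> y) = z \<otimes>\<^bsub>A\<^esub> x \<oplus>\<^bsub>A\<^esub> z \<otimes>\<^bsub>A\<^esub> y"
    and A_smult_l: "\<lbrakk>c \<in> carrier K; x \<in> carrier A; y \<in> carrier A\<rbrakk>
      \<Longrightarrow> (c \<odot>\<^bsub>A\<^esub> x) \<otimes>\<^bsub>A\<^esub> y = c \<odot>\<^bsub>A\<^esub> (x \<otimes>\<^bsub>A\<^esub> y)"
    and A_smult_r: "\<lbrakk>c \<in> carrier K; x \<in> carrier A; y \<in> carrier A\<rbrakk>
      \<Longrightarrow> x \<otimes>\<^bsub>A\<^esub> (c \<odot>\<^bsub>A\<^esub> y) = c \<odot>\<^bsub>A\<^esub> (x \<otimes>\<^bsub>A\<^esub> y)"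

text \<open>
  Associative unital algebras; \<^locale>\<open>algebra\<close> is not applicable because it requires commutativity.
\<close>

locale k_algebra = nonassoc_algebra K A
  for K :: "'k ring" and A :: "('k, 'a) module" +
  assumes A_assoc: "\<lbrakk>x \<in> carrier A; y \<in> carrier A; z \<in> carrier A\<rbrakk>
      \<Longrightarrow> (x \<otimes>\<^bsub>A\<^esub> y) \<otimes>\<^bsub>A\<^esub> z = x \<otimes>\<^bsub>A\<^esub> (y \<otimes>\<^bsub>A\<^esub> z)"

definition ground_algebra :: "'k ring \<Rightarrow> ('k, 'k) module" where
  "ground_algebra K = \<lparr>carrier = carrier K, mult = mult K, one = one K,
     zero = zero K, add = add K, smult = mult K\<rparr>"

definition alg_hom ::
  "'k ring \<Rightarrow> ('k, 'a) module \<Rightarrow> ('k, 'b) module \<Rightarrow> ('a \<Rightarrow> 'b) \<Rightarrow> bool" where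
  "alg_hom K A B f \<longleftrightarrow> f \<in> ring_hom A B \<and>
    (\<forall>c\<in>carrier K. \<forall>x\<in>carrier A. f (c \<odot>\<^bsub>A\<^esub> x) = c \<odot>\<^bsub>B\<^esub> f x)"

definition alg_iso ::
  "'k ring \<Rightarrow> ('k, 'a) module \<Rightarrow> ('k, 'b) module \<Rightarrow> ('a \<Rightarrow> 'b) \<Rightarrow> bool" where
  "alg_iso K A B f \<longleftrightarrow> k_algebra K A \<and> k_algebra K B \<and>
    alg_hom K A B f \<and> bij_betw f (carrier A) (carrier B)"

section \<open>Quasi-bialgebras and their (co)module algebras\<close>

locale quasi_bialgebra = k_algebra K H
  for K :: "'k ring" and H :: "('k, 'h) module"
    and \<Delta> :: "'h \<Rightarrow> ('k, 'h, 'h) tensor" and \<epsilon> :: "'h \<Rightarrow> 'k"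
    and \<Phi> :: "('k, 'h, 'h, 'h) tensor3" +
  assumes comult_hom: "alg_hom K H (tensor K H H) \<Delta>"
    and counit_hom: "alg_hom K H (ground_algebra K) \<epsilon>"
    and reassoc_unit: "\<Phi> \<in> Units (tensor3 K H H H)"
    and quasi_coassoc: "h \<in> carrier H \<Longrightarrow>
      map2_2 K H H H \<Delta> (\<Delta> h) =
        \<Phi> \<otimes>\<^bsub>tensor3 K H H H\<^esub> map2_1 K H H H \<Delta> (\<Delta> h) \<otimes>\<^bsub>tensor3 K H H H\<^esub> inv\<^bsub>tensor3 K H H H\<^esub> \<Phi>"
    and counit_right: "h \<in> carrier H \<Longrightarrow> sw K H (\<Delta> h) (\<lambda>h\<^sub>1 h\<^sub>2. \<epsilon> h\<^sub>2 \<odot>\<^bsub>H\<^esub> h\<^sub>1) = h"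
    and counit_left: "h \<in> carrier H \<Longrightarrow> sw K H (\<Delta> h) (\<lambda>h\<^sub>1 h\<^sub>2. \<epsilon> h\<^sub>1 \<odot>\<^bsub>H\<^esub> h\<^sub>2) = h"
    and pentagon:
      "unit_left K H H H H \<Phi> \<otimes>\<^bsub>tensor4 K H H H H\<^esub> map3_2 K H H H H \<Delta> \<Phi>
          \<otimes>\<^bsub>tensor4 K H H H H\<^esub> unit_right K H H H H \<Phi>
        = map3_3 K H H H H \<Delta> \<Phi> \<otimes>\<^bsub>tensor4 K H H H H\<^esub> map3_1 K H H H H \<Delta> \<Phi>"
    and reassoc_counit:
      "sw3 K (tensor K H H) \<Phi> (\<lambda>x y z. \<epsilon> y \<odot>\<^bsub>tensor K H H\<^esub> tens K H H x z) = \<one>\<^bsub>tensor K H H\<^esub>"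

locale left_module_algebra = quasi_bialgebra K H \<Delta> \<epsilon> \<Phi> + A: nonassoc_algebra K A
  for K :: "'k ring" and H :: "('k, 'h) module" and \<Delta> \<epsilon> \<Phi>
    and A :: "('k, 'a) module" and act :: "'h \<Rightarrow> 'a \<Rightarrow> 'a" +
  assumes act_closed: "\<lbrakk>h \<in> carrier H; a \<in> carrier A\<rbrakk> \<Longrightarrow> act h a \<in> carrier A"
    and act_add_l: "\<lbrakk>h \<in> carrier H; h' \<in> carrier H; a \<in> carrier A\<rbrakk>
      \<Longrightarrow> act (h \<oplus>\<^bsub>H\<^esub> h') a = act h a \<oplus>\<^bsub>A\<^esub> act h' a"
    and act_add_r: "\<lbrakk>h \<in> carrier H; a \<in> carrier A; a' \<in> carrier A\<rbrakk>
      \<Longrightarrow> act h (a \<oplus>\<^bsub>A\<^esub> a') = act h a \<oplus>\<^bsub>A\<^esub> act h a'"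
    and act_smult_l: "\<lbrakk>c \<in> carrier K; h \<in> carrier H; a \<in> carrier A\<rbrakk>
      \<Longrightarrow> act (c \<odot>\<^bsub>H\<^esub> h) a = c \<odot>\<^bsub>A\<^esub> act h a"
    and act_smult_r: "\<lbrakk>c \<in> carrier K; h \<in> carrier H; a \<in> carrier A\<rbrakk>
      \<Longrightarrow> act h (c \<odot>\<^bsub>A\<^esub> a) = c \<odot>\<^bsub>A\<^esub> act h a"
    and act_one: "a \<in> carrier A \<Longrightarrow> act \<one>\<^bsub>H\<^esub> a = a"
    and act_mult: "\<lbrakk>h \<in> carrier H; h' \<in> carrier H; a \<in> carrier A\<rbrakk>
      \<Longrightarrow> act (h \<otimes>\<^bsub>H\<^esub> h') a = act h (act h' a)"
    and quasi_assoc: "\<lbrakk>a \<in> carrier A; a' \<in> carrier A; a'' \<in> carrier A\<rbrakk>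
      \<Longrightarrow> (a \<otimes>\<^bsub>A\<^esub> a') \<otimes>\<^bsub>A\<^esub> a''
        = sw3 K A \<Phi> (\<lambda>x y z. act x a \<otimes>\<^bsub>A\<^esub> (act y a' \<otimes>\<^bsub>A\<^esub> act z a''))"
    and act_prod: "\<lbrakk>h \<in> carrier H; a \<in> carrier A; a' \<in> carrier A\<rbrakk>
      \<Longrightarrow> act h (a \<otimes>\<^bsub>A\<^esub> a') = sw K A (\<Delta> h) (\<lambda>h\<^sub>1 h\<^sub>2. act h\<^sub>1 a \<otimes>\<^bsub>A\<^esub> act h\<^sub>2 a')"
    and act_unit: "h \<in> carrier H \<Longrightarrow> act h \<one>\<^bsub>A\<^esub> = \<epsilon> h \<odot>\<^bsub>A\<^esub> \<one>\<^bsub>A\<^esub>"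

locale right_module_algebra = quasi_bialgebra K H \<Delta> \<epsilon> \<Phi> + B: nonassoc_algebra K B
  for K :: "'k ring" and H :: "('k, 'h) module" and \<Delta> \<epsilon> \<Phi>
    and B :: "('k, 'b) module" and act :: "'b \<Rightarrow> 'h \<Rightarrow> 'b" +
  assumes act_closed: "\<lbrakk>b \<in> carrier B; h \<in> carrier H\<rbrakk> \<Longrightarrow> act b h \<in> carrier B"
    and act_add_l: "\<lbrakk>b \<in> carrier B; b' \<in> carrier B; h \<in> carrier H\<rbrakk>
      \<Longrightarrow> act (b \<oplus>\<^bsub>B\<^esub> b') h = act b h \<oplus>\<^bsub>B\<^esub> act b' h"
    and act_add_r: "\<lbrakk>b \<in> carrier B; h \<in> carrier H; h' \<in> carrier H\<rbrakk>
      \<Longrightarrow> act b (h \<oplus>\<^bsub>H\<^esub> h') = act b h \<oplus>\<^bsub>B\<^esub> act b h'"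
    and act_smult_l: "\<lbrakk>c \<in> carrier K; b \<in> carrier B; h \<in> carrier H\<rbrakk>
      \<Longrightarrow> act (c \<odot>\<^bsub>B\<^esub> b) h = c \<odot>\<^bsub>B\<^esub> act b h"
    and act_smult_r: "\<lbrakk>c \<in> carrier K; b \<in> carrier B; h \<in> carrier H\<rbrakk>
      \<Longrightarrow> act b (c \<odot>\<^bsub>H\<^esub> h) = c \<odot>\<^bsub>B\<^esub> act b h"
    and act_one: "b \<in> carrier B \<Longrightarrow> act b \<one>\<^bsub>H\<^esub> = b"
    and act_mult: "\<lbrakk>b \<in> carrier B; h \<in> carrier H; h' \<in> carrier H\<rbrakk>
      \<Longrightarrow> act b (h \<otimes>\<^bsub>H\<^esub> h') = act (act b h) h'"
    and quasi_assoc: "\<lbrakk>b \<in> carrier B; b' \<in> carrier B; b'' \<in> carrier B\<rbrakk>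
      \<Longrightarrow> (b \<otimes>\<^bsub>B\<^esub> b') \<otimes>\<^bsub>B\<^esub> b''
        = sw3 K B (inv\<^bsub>tensor3 K H H H\<^esub> \<Phi>) (\<lambda>x y z. act b x \<otimes>\<^bsub>B\<^esub> (act b' y \<otimes>\<^bsub>B\<^esub> act b'' z))"
    and act_prod: "\<lbrakk>b \<in> carrier B; b' \<in> carrier B; h \<in> carrier H\<rbrakk>
      \<Longrightarrow> act (b \<otimes>\<^bsub>B\<^esub> b') h = sw K B (\<Delta> h) (\<lambda>h\<^sub>1 h\<^sub>2. act b h\<^sub>1 \<otimes>\<^bsub>B\<^esub> act b' h\<^sub>2)"
    and act_unit: "h \<in> carrier H \<Longrightarrow> act \<one>\<^bsub>B\<^esub> h = \<epsilon> h \<odot>\<^bsub>B\<^esub> \<one>\<^bsub>B\<^esub>"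

locale right_comodule_algebra = quasi_bialgebra K H \<Delta> \<epsilon> \<Phi> + U: k_algebra K U
  for K :: "'k ring" and H :: "('k, 'h) module" and \<Delta> \<epsilon> \<Phi>
    and U :: "('k, 'u) module" and \<rho> :: "'u \<Rightarrow> ('k, 'u, 'h) tensor"
    and \<Phi>\<rho> :: "('k, 'u, 'h, 'h) tensor3" +
  assumes rho_hom: "alg_hom K U (tensor K U H) \<rho>"
    and Phi_rho_unit: "\<Phi>\<rho> \<in> Units (tensor3 K U H H)"
    and rho_quasi_coassoc: "u \<in> carrier U \<Longrightarrow>
      \<Phi>\<rho> \<otimes>\<^bsub>tensor3 K U H H\<^esub> map2_1 K U H H \<rho> (\<rho> u)
        = map2_2 K U H H \<Delta> (\<rho> u) \<otimes>\<^bsub>tensor3 K U H H\<^esub> \<Phi>\<rho>"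
    and rho_pentagon:
      "unit_left K U H H H \<Phi> \<otimes>\<^bsub>tensor4 K U H H H\<^esub> map3_2 K U H H H \<Delta> \<Phi>\<rho>
          \<otimes>\<^bsub>tensor4 K U H H H\<^esub> unit_right K U H H H \<Phi>\<rho>
        = map3_3 K U H H H \<Delta> \<Phi>\<rho> \<otimes>\<^bsub>tensor4 K U H H H\<^esub> map3_1 K U H H H \<rho> \<Phi>\<rho>"
    and rho_counit: "u \<in> carrier U \<Longrightarrow> sw K U (\<rho> u) (\<lambda>u\<^sub>0 u\<^sub>1. \<epsilon> u\<^sub>1 \<odot>\<^bsub>U\<^esub> u\<^sub>0) = u"
    and Phi_rho_counit_2:
      "sw3 K (tensor K U H) \<Phi>\<rho> (\<lambda>x y z. \<epsilon> y \<odot>\<^bsub>tensor K U H\<^esub> tens K U H x z) = \<one>\<^bsub>tensor K U H\<^esub>"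
    and Phi_rho_counit_3:
      "sw3 K (tensor K U H) \<Phi>\<rho> (\<lambda>x y z. \<epsilon> z \<odot>\<^bsub>tensor K U H\<^esub> tens K U H x y) = \<one>\<^bsub>tensor K U H\<^esub>"

locale left_comodule_algebra = quasi_bialgebra K H \<Delta> \<epsilon> \<Phi> + U: k_algebra K U
  for K :: "'k ring" and H :: "('k, 'h) module" and \<Delta> \<epsilon> \<Phi>
    and U :: "('k, 'u) module" and lam :: "'u \<Rightarrow> ('k, 'h, 'u) tensor"
    and \<Phi>lam :: "('k, 'h, 'h, 'u) tensor3" +
  assumes lam_hom: "alg_hom K U (tensor K H U) lam"
    and Phi_lam_unit: "\<Phi>lam \<in> Units (tensor3 K H H U)"
    and lam_quasi_coassoc: "u \<in> carrier U \<Longrightarrow>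
      map2_2 K H H U lam (lam u) \<otimes>\<^bsub>tensor3 K H H U\<^esub> \<Phi>lam
        = \<Phi>lam \<otimes>\<^bsub>tensor3 K H H U\<^esub> map2_1 K H H U \<Delta> (lam u)"
    and lam_pentagon:
      "unit_left K H H H U \<Phi>lam \<otimes>\<^bsub>tensor4 K H H H U\<^esub> map3_2 K H H H U \<Delta> \<Phi>lam
          \<otimes>\<^bsub>tensor4 K H H H U\<^esub> unit_right K H H H U \<Phi>
        = map3_3 K H H H U lam \<Phi>lam \<otimes>\<^bsub>tensor4 K H H H U\<^esub> map3_1 K H H H U \<Delta> \<Phi>lam"
    and lam_counit: "u \<in> carrier U \<Longrightarrow> sw K U (lam u) (\<lambda>u\<^sub>1 u\<^sub>0. \<epsilon> u\<^sub>1 \<odot>\<^bsub>U\<^esub> u\<^sub>0) = u"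
    and Phi_lam_counit_2:
      "sw3 K (tensor K H U) \<Phi>lam (\<lambda>x y z. \<epsilon> y \<odot>\<^bsub>tensor K H U\<^esub> tens K H U x z) = \<one>\<^bsub>tensor K H U\<^esub>"
    and Phi_lam_counit_1:
      "sw3 K (tensor K H U) \<Phi>lam (\<lambda>x y z. \<epsilon> x \<odot>\<^bsub>tensor K H U\<^esub> tens K H U y z) = \<one>\<^bsub>tensor K H U\<^esub>"

locale bicomodule_algebra =
  left_comodule_algebra K H \<Delta> \<epsilon> \<Phi> U lam \<Phi>lam + right_comodule_algebra K H \<Delta> \<epsilon> \<Phi> U \<rho> \<Phi>\<rho>
  for K :: "'k ring" and H :: "('k, 'h) module" and \<Delta> \<epsilon> \<Phi>
    and U :: "('k, 'u) module" and lam \<rho> \<Phi>lam \<Phi>\<rho>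
    and \<Phi>lr :: "('k, 'h, 'u, 'h) tensor3" +
  assumes Phi_lr_unit: "\<Phi>lr \<in> Units (tensor3 K H U H)"
    and lam_rho_commute: "u \<in> carrier U \<Longrightarrow>
      \<Phi>lr \<otimes>\<^bsub>tensor3 K H U H\<^esub> map2_1 K H U H lam (\<rho> u)
        = map2_2 K H U H \<rho> (lam u) \<otimes>\<^bsub>tensor3 K H U H\<^esub> \<Phi>lr"
    and Phi_lr_pentagon_lam:
      "unit_left K H H U H \<Phi>lr \<otimes>\<^bsub>tensor4 K H H U H\<^esub> map3_2 K H H U H lam \<Phi>lr
          \<otimes>\<^bsub>tensor4 K H H U H\<^esub> unit_right K H H U H \<Phi>lam
        = map3_3 K H H U H \<rho> \<Phi>lam \<otimes>\<^bsub>tensor4 K H H U H\<^esub> map3_1 K H H U H \<Delta> \<Phi>lr"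
    and Phi_lr_pentagon_rho:
      "unit_left K H U H H \<Phi>\<rho> \<otimes>\<^bsub>tensor4 K H U H H\<^esub> map3_2 K H U H H \<rho> \<Phi>lr
          \<otimes>\<^bsub>tensor4 K H U H H\<^esub> unit_right K H U H H \<Phi>lr
        = map3_3 K H U H H \<Delta> \<Phi>lr \<otimes>\<^bsub>tensor4 K H U H H\<^esub> map3_1 K H U H H lam \<Phi>\<rho>"

section \<open>Generalized smash products\<close>

context
  fixes K :: "'k ring" and H :: "('k, 'h) module"
begin

text \<open>
  For a left \<open>H\<close>-module algebra \<open>A\<close> and a left \<open>H\<close>-comodule algebra \<open>U\<close>: on \<open>A \<otimes> U\<close>,
  \<open>(a \<otimes> u)(a' \<otimes> u') = (x\<^sup>1\<cdot>a)(x\<^sup>2 u\<^sub>[\<^sub>-\<^sub>1\<^sub>]\<cdot>a') \<otimes> x\<^sup>3 u\<^sub>[\<^sub>0\<^sub>] u'\<close> with \<open>x\<close> the inverse of \<open>\<Phi>lam\<close>.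
\<close>

definition left_smash ::
  "('k, 'a) module \<Rightarrow> ('h \<Rightarrow> 'a \<Rightarrow> 'a)
    \<Rightarrow> ('k, 'u) module \<Rightarrow> ('u \<Rightarrow> ('k, 'h, 'u) tensor) \<Rightarrow> ('k, 'h, 'h, 'u) tensor3
    \<Rightarrow> ('k, ('k, 'a, 'u) tensor) module" where
  "left_smash A act U lam \<Phi>lam = (let T = tensor_space K A U in T
    \<lparr>mult := (\<lambda>s t.
       sw K T s (\<lambda>a u. sw K T t (\<lambda>a' u'.
       sw3 K T (inv\<^bsub>tensor3 K H H U\<^esub> \<Phi>lam) (\<lambda>x\<^sub>1 x\<^sub>2 x\<^sub>3. sw K T (lam u) (\<lambda>u\<^sub>1 u\<^sub>0.
         tens K A U (act x\<^sub>1 a \<otimes>\<^bsub>A\<^esub> act (x\<^sub>2 \<otimes>\<^bsub>H\<^esub> u\<^sub>1) a') (x\<^sub>3 \<otimes>\<^bsub>U\<^esub> u\<^sub>0 \<otimes>\<^bsub>U\<^esub> u')))))),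
     one := tens K A U \<one>\<^bsub>A\<^esub> \<one>\<^bsub>U\<^esub>\<rparr>)"

text \<open>
  For a right \<open>H\<close>-comodule algebra \<open>U\<close> and a right \<open>H\<close>-module algebra \<open>B\<close>: on \<open>U \<otimes> B\<close>,
  \<open>(u \<otimes> b)(u' \<otimes> b') = u u'\<^sub>0 x\<^sup>1 \<otimes> (b\<cdot>u'\<^sub>1 x\<^sup>2)(b'\<cdot>x\<^sup>3)\<close> with \<open>x\<close> the inverse of \<open>\<Phi>\<rho>\<close>.
\<close>

definition right_smash ::
  "('k, 'u) module \<Rightarrow> ('u \<Rightarrow> ('k, 'u, 'h) tensor) \<Rightarrow> ('k, 'u, 'h, 'h) tensor3
    \<Rightarrow> ('k, 'b) module \<Rightarrow> ('b \<Rightarrow> 'h \<Rightarrow> 'b)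
    \<Rightarrow> ('k, ('k, 'u, 'b) tensor) module" where
  "right_smash U \<rho> \<Phi>\<rho> B act = (let T = tensor_space K U B in T
    \<lparr>mult := (\<lambda>s t.
       sw K T s (\<lambda>u b. sw K T t (\<lambda>u' b'.
       sw K T (\<rho> u') (\<lambda>u'\<^sub>0 u'\<^sub>1. sw3 K T (inv\<^bsub>tensor3 K U H H\<^esub> \<Phi>\<rho>) (\<lambda>x\<^sub>1 x\<^sub>2 x\<^sub>3.
         tens K U B (u \<otimes>\<^bsub>U\<^esub> u'\<^sub>0 \<otimes>\<^bsub>U\<^esub> x\<^sub>1) (act b (u'\<^sub>1 \<otimes>\<^bsub>H\<^esub> x\<^sub>2) \<otimes>\<^bsub>B\<^esub> act b' x\<^sub>3)))))),
     one := tens K U B \<one>\<^bsub>U\<^esub> \<one>\<^bsub>B\<^esub>\<rparr>)"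

definition two_sided_smash ::
  "('k, 'a) module \<Rightarrow> ('h \<Rightarrow> 'a \<Rightarrow> 'a)
    \<Rightarrow> ('k, 'u) module \<Rightarrow> ('u \<Rightarrow> ('k, 'h, 'u) tensor) \<Rightarrow> ('u \<Rightarrow> ('k, 'u, 'h) tensor)
    \<Rightarrow> ('k, 'h, 'h, 'u) tensor3 \<Rightarrow> ('k, 'u, 'h, 'h) tensor3 \<Rightarrow> ('k, 'h, 'u, 'h) tensor3
    \<Rightarrow> ('k, 'b) module \<Rightarrow> ('b \<Rightarrow> 'h \<Rightarrow> 'b)
    \<Rightarrow> ('k, ('k, 'a, 'u, 'b) tensor3) module" where
  "two_sided_smash A act\<^sub>A U lam \<rho> \<Phi>lam \<Phi>\<rho> \<Phi>lr B act\<^sub>B =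
   (let T = tensor_space K A (tensor_space K U B) in T
    \<lparr>mult := (\<lambda>s t.
       sw3 K T s (\<lambda>a u b. sw3 K T t (\<lambda>a' u' b'.
       sw3 K T (inv\<^bsub>tensor3 K H H U\<^esub> \<Phi>lam) (\<lambda>x\<^sub>1 x\<^sub>2 x\<^sub>3. sw K T (lam u) (\<lambda>u\<^sub>1 u\<^sub>0.
       sw3 K T (inv\<^bsub>tensor3 K H U H\<^esub> \<Phi>lr) (\<lambda>\<theta>\<^sub>1 \<theta>\<^sub>2 \<theta>\<^sub>3. sw K T (\<rho> u') (\<lambda>u'\<^sub>0 u'\<^sub>1.
       sw3 K T (inv\<^bsub>tensor3 K U H H\<^esub> \<Phi>\<rho>) (\<lambda>y\<^sub>1 y\<^sub>2 y\<^sub>3.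
         tens K A (tensor_space K U B)
           (act\<^sub>A x\<^sub>1 a \<otimes>\<^bsub>A\<^esub> act\<^sub>A (x\<^sub>2 \<otimes>\<^bsub>H\<^esub> u\<^sub>1 \<otimes>\<^bsub>H\<^esub> \<theta>\<^sub>1) a')
           (tens K U B
             (x\<^sub>3 \<otimes>\<^bsub>U\<^esub> u\<^sub>0 \<otimes>\<^bsub>U\<^esub> \<theta>\<^sub>2 \<otimes>\<^bsub>U\<^esub> u'\<^sub>0 \<otimes>\<^bsub>U\<^esub> y\<^sub>1)
             (act\<^sub>B b (\<theta>\<^sub>3 \<otimes>\<^bsub>H\<^esub> u'\<^sub>1 \<otimes>\<^bsub>H\<^esub> y\<^sub>2) \<otimes>\<^bsub>B\<^esub> act\<^sub>B b' y\<^sub>3)))))))))),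
     one := tens K A (tensor_space K U B) \<one>\<^bsub>A\<^esub> (tens K U B \<one>\<^bsub>U\<^esub> \<one>\<^bsub>B\<^esub>)\<rparr>)"

text \<open>
  The right \<open>H\<close>-comodule algebra structure on \<^const>\<open>left_smash\<close> of a bicomodule algebra:
  \<open>\<rho>(a \<otimes> u) = (\<theta>\<^sup>1\<cdot>a \<otimes> \<theta>\<^sup>2 u\<^sub>0) \<otimes> \<theta>\<^sup>3 u\<^sub>1\<close> with \<open>\<theta>\<close> the inverse of \<open>\<Phi>lr\<close>.
\<close>

definition left_smash_coact ::
  "('k, 'a) module \<Rightarrow> ('h \<Rightarrow> 'a \<Rightarrow> 'a)
    \<Rightarrow> ('k, 'u) module \<Rightarrow> ('u \<Rightarrow> ('k, 'h, 'u) tensor) \<Rightarrow> ('u \<Rightarrow> ('k, 'u, 'h) tensor)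
    \<Rightarrow> ('k, 'h, 'h, 'u) tensor3 \<Rightarrow> ('k, 'h, 'u, 'h) tensor3
    \<Rightarrow> ('k, 'a, 'u) tensor \<Rightarrow> ('k, ('k, 'a, 'u) tensor, 'h) tensor" where
  "left_smash_coact A act U lam \<rho> \<Phi>lam \<Phi>lr t =
   (let S = left_smash A act U lam \<Phi>lam; T = tensor K S H in
     sw K T t (\<lambda>a u. sw3 K T (inv\<^bsub>tensor3 K H U H\<^esub> \<Phi>lr) (\<lambda>\<theta>\<^sub>1 \<theta>\<^sub>2 \<theta>\<^sub>3. sw K T (\<rho> u) (\<lambda>u\<^sub>0 u\<^sub>1.
       tens K S H (tens K A U (act \<theta>\<^sub>1 a) (\<theta>\<^sub>2 \<otimes>\<^bsub>U\<^esub> u\<^sub>0)) (\<theta>\<^sub>3 \<otimes>\<^bsub>H\<^esub> u\<^sub>1)))))"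

definition left_smash_reassoc ::
  "('k, 'a) module \<Rightarrow> ('h \<Rightarrow> 'a \<Rightarrow> 'a)
    \<Rightarrow> ('k, 'u) module \<Rightarrow> ('u \<Rightarrow> ('k, 'h, 'u) tensor)
    \<Rightarrow> ('k, 'h, 'h, 'u) tensor3 \<Rightarrow> ('k, 'u, 'h, 'h) tensor3
    \<Rightarrow> ('k, ('k, 'a, 'u) tensor, 'h, 'h) tensor3" where
  "left_smash_reassoc A act U lam \<Phi>lam \<Phi>\<rho> =
   (let S = left_smash A act U lam \<Phi>lam in
     sw3 K (tensor3 K S H H) \<Phi>\<rho> (\<lambda>x\<^sub>1 x\<^sub>2 x\<^sub>3. tens3 K S H H (tens K A U \<one>\<^bsub>A\<^esub> x\<^sub>1) x\<^sub>2 x\<^sub>3))"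

text \<open>
  The left \<open>H\<close>-comodule algebra structure on \<^const>\<open>right_smash\<close> of a bicomodule algebra:
  \<open>\<lambda>(u \<otimes> b) = u\<^sub>[\<^sub>-\<^sub>1\<^sub>] \<theta>\<^sup>1 \<otimes> (u\<^sub>[\<^sub>0\<^sub>] \<theta>\<^sup>2 \<otimes> b\<cdot>\<theta>\<^sup>3)\<close>.
\<close>

definition right_smash_coact ::
  "('k, 'u) module \<Rightarrow> ('u \<Rightarrow> ('k, 'h, 'u) tensor) \<Rightarrow> ('u \<Rightarrow> ('k, 'u, 'h) tensor)
    \<Rightarrow> ('k, 'u, 'h, 'h) tensor3 \<Rightarrow> ('k, 'h, 'u, 'h) tensor3
    \<Rightarrow> ('k, 'b) module \<Rightarrow> ('b \<Rightarrow> 'h \<Rightarrow> 'b)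
    \<Rightarrow> ('k, 'u, 'b) tensor \<Rightarrow> ('k, 'h, ('k, 'u, 'b) tensor) tensor" where
  "right_smash_coact U lam \<rho> \<Phi>\<rho> \<Phi>lr B act t =
   (let S = right_smash U \<rho> \<Phi>\<rho> B act; T = tensor K H S in
     sw K T t (\<lambda>u b. sw K T (lam u) (\<lambda>u\<^sub>1 u\<^sub>0. sw3 K T (inv\<^bsub>tensor3 K H U H\<^esub> \<Phi>lr) (\<lambda>\<theta>\<^sub>1 \<theta>\<^sub>2 \<theta>\<^sub>3.
       tens K H S (u\<^sub>1 \<otimes>\<^bsub>H\<^esub> \<theta>\<^sub>1) (tens K U B (u\<^sub>0 \<otimes>\<^bsub>U\<^esub> \<theta>\<^sub>2) (act b \<theta>\<^sub>3))))))"

definition right_smash_reassoc ::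
  "('k, 'u) module \<Rightarrow> ('u \<Rightarrow> ('k, 'u, 'h) tensor)
    \<Rightarrow> ('k, 'h, 'h, 'u) tensor3 \<Rightarrow> ('k, 'u, 'h, 'h) tensor3
    \<Rightarrow> ('k, 'b) module \<Rightarrow> ('b \<Rightarrow> 'h \<Rightarrow> 'b)
    \<Rightarrow> ('k, 'h, 'h, ('k, 'u, 'b) tensor) tensor3" where
  "right_smash_reassoc U \<rho> \<Phi>lam \<Phi>\<rho> B act =
   (let S = right_smash U \<rho> \<Phi>\<rho> B act in
     sw3 K (tensor3 K H H S) \<Phi>lam (\<lambda>x\<^sub>1 x\<^sub>2 x\<^sub>3. tens3 K H H S x\<^sub>1 x\<^sub>2 (tens K U B x\<^sub>3 \<one>\<^bsub>B\<^esub>)))"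

text \<open>
  \<open>(A \<otimes> U) \<otimes> B\<close> and \<open>A \<otimes> (U \<otimes> B)\<close> as iterated smash products, for a bicomodule algebra \<open>U\<close>.
\<close>

definition left_then_right_smash ::
  "('k, 'a) module \<Rightarrow> ('h \<Rightarrow> 'a \<Rightarrow> 'a)
    \<Rightarrow> ('k, 'u) module \<Rightarrow> ('u \<Rightarrow> ('k, 'h, 'u) tensor) \<Rightarrow> ('u \<Rightarrow> ('k, 'u, 'h) tensor)
    \<Rightarrow> ('k, 'h, 'h, 'u) tensor3 \<Rightarrow> ('k, 'u, 'h, 'h) tensor3 \<Rightarrow> ('k, 'h, 'u, 'h) tensor3
    \<Rightarrow> ('k, 'b) module \<Rightarrow> ('b \<Rightarrow> 'h \<Rightarrow> 'b)
    \<Rightarrow> ('k, ('k, ('k, 'a, 'u) tensor, 'b) tensor) module" where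
  "left_then_right_smash A act\<^sub>A U lam \<rho> \<Phi>lam \<Phi>\<rho> \<Phi>lr B act\<^sub>B =
    right_smash (left_smash A act\<^sub>A U lam \<Phi>lam)
      (left_smash_coact A act\<^sub>A U lam \<rho> \<Phi>lam \<Phi>lr) (left_smash_reassoc A act\<^sub>A U lam \<Phi>lam \<Phi>\<rho>) B act\<^sub>B"

definition right_then_left_smash ::
  "('k, 'a) module \<Rightarrow> ('h \<Rightarrow> 'a \<Rightarrow> 'a)
    \<Rightarrow> ('k, 'u) module \<Rightarrow> ('u \<Rightarrow> ('k, 'h, 'u) tensor) \<Rightarrow> ('u \<Rightarrow> ('k, 'u, 'h) tensor)
    \<Rightarrow> ('k, 'h, 'h, 'u) tensor3 \<Rightarrow> ('k, 'u, 'h, 'h) tensor3 \<Rightarrow> ('k, 'h, 'u, 'h) tensor3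
    \<Rightarrow> ('k, 'b) module \<Rightarrow> ('b \<Rightarrow> 'h \<Rightarrow> 'b)
    \<Rightarrow> ('k, ('k, 'a, ('k, 'u, 'b) tensor) tensor) module" where
  "right_then_left_smash A act\<^sub>A U lam \<rho> \<Phi>lam \<Phi>\<rho> \<Phi>lr B act\<^sub>B =
    left_smash A act\<^sub>A (right_smash U \<rho> \<Phi>\<rho> B act\<^sub>B)
      (right_smash_coact U lam \<rho> \<Phi>\<rho> \<Phi>lr B act\<^sub>B) (right_smash_reassoc U \<rho> \<Phi>lam \<Phi>\<rho> B act\<^sub>B)"

end

end

theory Submission
  imports Defs
begin

text \<open>Expressions in Sweedler notation are linear in every tensor that is summed over. Hence, to prove an identity
  between two of them, one may replace each tensor by a pure one, and then only the axioms of the algebras and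
  of the actions remain. Applied to the two ways of bracketing a product in a smash product, this exhibits both
  as the values of one and the same linear map on two elements of a fourfold tensor algebra, built from
  \<open>\<Phi>\<close>, the inverse reassociator and one coaction; these elements agree by the pentagon identity and the
  quasi-coassociativity of the coaction. The multiplicativity and the quasi-coassociativity of the coactions on
  the smash products follow in the same way from the two pentagons for \<open>\<Phi>lr\<close> and the commutation of \<open>lam\<close>
  with \<open>\<rho>\<close>. The pentagons for the new reassociators are images of the old ones under the algebra maps
  \<open>u \<mapsto> 1 \<otimes> u\<close> and \<open>u \<mapsto> u \<otimes> 1\<close>. Finally the products of the iterated smash products, evaluated on
  pure tensors, are those of the two-sided one.

  The normalisations \<open>(\<epsilon> \<otimes> id \<otimes> id) \<Phi>lr = 1\<close> and \<open>(id \<otimes> id \<otimes> \<epsilon>) \<Phi>lr = 1\<close> are not axioms: they are obtained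
  by applying \<open>\<epsilon>\<close> to an inner slot of the pentagons and cancelling \<open>\<Phi>lr\<close>.\<close>

section \<open>Tensor products of vector spaces\<close>

text \<open>The obstacle is that \<open>sw\<close> evaluates its body at a representative picked by
  choice, so a rewrite step around its binder is sound only when the body is bilinear on the
  carriers. The rules are therefore shaped so that the simplifier can discharge linearity and
  membership by itself.

  The normalisations of \<Phi>lr serve two purposes: the counit laws of the new coactions, and the
  fact that on 1 # u and u # 1 these coactions reduce to \<rho> and lam, because \<theta> then acts
  on a unit and survives only through \<epsilon>.

  The left and the right half are written out in parallel: A is quasi-associative through \<Phi> and
  B through its inverse, and tensors nest to the right, so different rearrangements of the pentagons
  and different embeddings occur.

  Associativity of the two-sided product is not computed. It is inherited from the product bracketed
  to the right, which has the same underlying space and the same multiplication.\<close>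

locale ground_field = field K for K :: "'k ring" (structure)
begin

abbreviation tensor_space_of (infixr "\<boxtimes>" 75) where "V \<boxtimes> W \<equiv> tensor_space K V W"
abbreviation tensor_algebra_of (infixr "\<star>" 75) where "A \<star> B \<equiv> tensor K A B"

lemma free_space_carrier:
  "x \<in> carrier (free_space K S) \<longleftrightarrow>
    (\<forall>s. x s \<in> carrier K) \<and> (\<forall>s. s \<notin> S \<longrightarrow> x s = \<zero>) \<and> finite {s. x s \<noteq> \<zero>}"
  by (auto simp: free_space_def)

lemma free_space_val: "x \<in> carrier (free_space K S) \<Longrightarrow> x s \<in> carrier K"
  and free_space_out: "x \<in> carrier (free_space K S) \<Longrightarrow> s \<notin> S \<Longrightarrow> x s = \<zero>"
  and free_space_finite: "x \<in> carrier (free_space K S) \<Longrightarrow> finite {s. x s \<noteq> \<zero>}"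
  by (simp_all add: free_space_carrier)

lemma free_space_sel [simp]:
  "zero (free_space K S) = (\<lambda>s. \<zero>)"
  "add (free_space K S) = (\<lambda>f g x. f x \<oplus> g x)"
  "smult (free_space K S) = (\<lambda>c f x. c \<otimes> f x)"
  by (simp_all add: free_space_def)

lemma free_space_add_closed:
  assumes "x \<in> carrier (free_space K S)" "y \<in> carrier (free_space K S)"
  shows "(\<lambda>s. x s \<oplus> y s) \<in> carrier (free_space K S)"
proof -
  have "{s. x s \<oplus> y s \<noteq> \<zero>} \<subseteq> {s. x s \<noteq> \<zero>} \<union> {s. y s \<noteq> \<zero>}"
    using assms by (auto simp: free_space_carrier)
  then have "finite {s. x s \<oplus> y s \<noteq> \<zero>}"
    using assms by (auto simp: free_space_carrier intro: finite_subset)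
  then show ?thesis
    using assms by (auto simp: free_space_carrier)
qed

lemma free_space_smult_closed:
  assumes "c \<in> carrier K" "x \<in> carrier (free_space K S)"
  shows "(\<lambda>s. c \<otimes> x s) \<in> carrier (free_space K S)"
proof -
  have "{s. c \<otimes> x s \<noteq> \<zero>} \<subseteq> {s. x s \<noteq> \<zero>}"
    using assms by (auto simp: free_space_carrier)
  then have "finite {s. c \<otimes> x s \<noteq> \<zero>}"
    using assms by (auto simp: free_space_carrier intro: finite_subset)
  then show ?thesis
    using assms by (auto simp: free_space_carrier)
qed

lemma free_space_module: "module K (free_space K S)"
proof (rule moduleI)
  show "abelian_group (free_space K S)"
  proof (rule abelian_groupI)
    fix x assume x: "x \<in> carrier (free_space K S)"
    \<comment> \<open>The negative is taken as the multiple by -1, so that its closure is the scalar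
      case.\<close>
    have "(\<lambda>s. \<ominus> \<one> \<otimes> x s) \<in> carrier (free_space K S)"
      using x by (intro free_space_smult_closed) auto
    moreover have "(\<ominus> \<one> \<otimes> x s) \<oplus> x s = \<zero>" for s
      using x by (simp add: free_space_carrier l_minus l_neg)
    ultimately show "\<exists>y\<in>carrier (free_space K S). y \<oplus>\<^bsub>free_space K S\<^esub> x = \<zero>\<^bsub>free_space K S\<^esub>"
      by (intro bexI[of _ "\<lambda>s. \<ominus> \<one> \<otimes> x s"]) simp_all
  qed (simp_all add: free_space_add_closed, auto simp: free_space_carrier a_ac)
qed (simp_all add: free_space_smult_closed is_cring,
    auto simp: free_space_carrier l_distr r_distr m_assoc)

lemma free_gen_closed: "s \<in> S \<Longrightarrow> free_gen K s \<in> carrier (free_space K S)"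
proof -
  assume "s \<in> S"
  moreover have "{x. free_gen K s x \<noteq> \<zero>} \<subseteq> {s}"
    by (auto simp: free_gen_def)
  then have "finite {x. free_gen K s x \<noteq> \<zero>}"
    by (rule finite_subset) simp
  ultimately show ?thesis
    by (auto simp: free_space_carrier free_gen_def)
qed

end

text \<open>Values outside \<open>carrier V\<close> are left free, so that a lambda term built from
  operations that behave only on carriers qualifies as it stands. This predicate is the side
  condition of most simp rules below.\<close>

definition lin :: "'k ring \<Rightarrow> ('k, 'a) module \<Rightarrow> ('k, 'b) module \<Rightarrow> ('a \<Rightarrow> 'b) \<Rightarrow> bool" where
  "lin K V M f \<longleftrightarrow> (\<forall>x\<in>carrier V. f x \<in> carrier M)
    \<and> (\<forall>x\<in>carrier V. \<forall>y\<in>carrier V. f (x \<oplus>\<^bsub>V\<^esub> y) = f x \<oplus>\<^bsub>M\<^esub> f y)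
    \<and> (\<forall>c\<in>carrier K. \<forall>x\<in>carrier V. f (c \<odot>\<^bsub>V\<^esub> x) = c \<odot>\<^bsub>M\<^esub> f x)"

lemma linI:
  assumes "\<And>x. x \<in> carrier V \<Longrightarrow> f x \<in> carrier M"
    and "\<And>x y. x \<in> carrier V \<Longrightarrow> y \<in> carrier V \<Longrightarrow> f (x \<oplus>\<^bsub>V\<^esub> y) = f x \<oplus>\<^bsub>M\<^esub> f y"
    and "\<And>c x. c \<in> carrier K \<Longrightarrow> x \<in> carrier V \<Longrightarrow> f (c \<odot>\<^bsub>V\<^esub> x) = c \<odot>\<^bsub>M\<^esub> f x"
  shows "lin K V M f"
  using assms by (simp add: lin_def)

lemma lin_closed: "lin K V M f \<Longrightarrow> x \<in> carrier V \<Longrightarrow> f x \<in> carrier M"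
  and lin_add: "lin K V M f \<Longrightarrow> x \<in> carrier V \<Longrightarrow> y \<in> carrier V \<Longrightarrow> f (x \<oplus>\<^bsub>V\<^esub> y) = f x \<oplus>\<^bsub>M\<^esub> f y"
  and lin_smult: "lin K V M f \<Longrightarrow> c \<in> carrier K \<Longrightarrow> x \<in> carrier V
    \<Longrightarrow> f (c \<odot>\<^bsub>V\<^esub> x) = c \<odot>\<^bsub>M\<^esub> f x"
  by (simp_all add: lin_def)

lemma lin_zero:
  assumes "module K V" "module K M" "lin K V M f"
  shows "f \<zero>\<^bsub>V\<^esub> = \<zero>\<^bsub>M\<^esub>"
proof -
  interpret V: module K V by fact
  interpret M: module K M by fact
  have "f (\<zero>\<^bsub>K\<^esub> \<odot>\<^bsub>V\<^esub> \<zero>\<^bsub>V\<^esub>) = \<zero>\<^bsub>K\<^esub> \<odot>\<^bsub>M\<^esub> f \<zero>\<^bsub>V\<^esub>"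
    using assms(3) by (intro lin_smult) auto
  then show ?thesis
    using lin_closed[OF assms(3)] by simp
qed

lemma lin_cong:
  assumes "module K V" "\<And>x. x \<in> carrier V \<Longrightarrow> f x = g x" "lin K V M g"
  shows "lin K V M f"
proof -
  interpret V: module K V by fact
  show ?thesis using assms by (auto simp: lin_def)
qed

lemma lin_finsum:
  assumes "module K V" "module K M" "lin K V M f"
    and "\<And>i. i \<in> S \<Longrightarrow> g i \<in> carrier V"
  shows "f (\<Oplus>\<^bsub>V\<^esub>i\<in>S. g i) = (\<Oplus>\<^bsub>M\<^esub>i\<in>S. f (g i))"
proof -
  interpret V: module K V by fact
  interpret M: module K M by fact
  note [simp] = lin_closed[OF assms(3)] lin_add[OF assms(3)] lin_zero[OF assms(1-3)]
  show ?thesis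
    using assms(4)
    by (induction S rule: infinite_finite_induct) (auto simp: Pi_iff)
qed

section \<open>The tensor product as a quotient of the free space, and its universal
  property\<close>

locale tensor_pair = ground_field K + V: module K V + W: module K W
  for K :: "'k ring" (structure) and V :: "('k, 'a) module" and W :: "('k, 'b) module"
begin

abbreviation F where "F \<equiv> free_space K (carrier V \<times> carrier W)"
abbreviation N where "N \<equiv> tensor_null K V W"

sublocale F: module K F by (rule free_space_module)

lemma bilinear_relations_closed: "bilinear_relations K V W \<subseteq> carrier F"
proof -
  have gen: "free_gen K (v, w) \<in> carrier F" if "v \<in> carrier V" "w \<in> carrier W" for v w
    using that by (intro free_gen_closed) simp
  have add: "x \<oplus>\<^bsub>F\<^esub> y \<in> carrier F" if "x \<in> carrier F" "y \<in> carrier F" for x y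
    using that by (rule F.a_closed)
  have smult: "c \<odot>\<^bsub>F\<^esub> x \<in> carrier F" if "c \<in> carrier K" "x \<in> carrier F" for c x
    using that by (rule F.smult_closed)
  have minus: "x \<ominus>\<^bsub>F\<^esub> y \<in> carrier F" if "x \<in> carrier F" "y \<in> carrier F" for x y
    using that by (rule F.minus_closed)
  show ?thesis
    unfolding bilinear_relations_def Let_def
    by (auto simp del: free_space_sel intro!: gen add smult minus)
qed

lemma tensor_null_submodule: "submodule N K F"
proof (rule F.submoduleI)
  \<comment> \<open>The family that is intersected is not empty, so the intersection stays inside
    \<open>F\<close>.\<close>
  have ex: "submodule (carrier F) K F \<and> bilinear_relations K V W \<subseteq> carrier F"
    using F.carrier_is_submodule bilinear_relations_closed by simp
  show "N \<subseteq> carrier F"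
    unfolding tensor_null_def using ex by blast
  show "\<zero>\<^bsub>F\<^esub> \<in> N"
    unfolding tensor_null_def
  proof (rule InterI, elim CollectE conjE)
    fix X assume "submodule X K F"
    then show "\<zero>\<^bsub>F\<^esub> \<in> X"
      using subgroup.one_closed[of X "add_monoid F"] by (simp add: submodule_def)
  qed
  show "\<ominus>\<^bsub>F\<^esub> a \<in> N" if "a \<in> N" for a
    using that F.submoduleE(3) unfolding tensor_null_def by blast
  show "a \<oplus>\<^bsub>F\<^esub> b \<in> N" if "a \<in> N" "b \<in> N" for a b
    using that F.submoduleE(5) unfolding tensor_null_def by blast
  show "c \<odot>\<^bsub>F\<^esub> a \<in> N" if "c \<in> carrier K" "a \<in> N" for a c
    using that F.submoduleE(4) unfolding tensor_null_def by blast
qed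

lemma bilinear_relations_null: "bilinear_relations K V W \<subseteq> N"
  unfolding tensor_null_def by blast

sublocale N: abelian_subgroup N F
  using tensor_null_submodule
  by (intro abelian_subgroupI3 additive_subgroup.intro) (auto simp: submodule_def F.abelian_group_axioms)

abbreviation cl where "cl x \<equiv> N +>\<^bsub>F\<^esub> x"

lemma cl_eq_iff:
  assumes "x \<in> carrier F" "y \<in> carrier F"
  shows "cl x = cl y \<longleftrightarrow> x \<ominus>\<^bsub>F\<^esub> y \<in> N"
proof -
  have "x \<ominus>\<^bsub>F\<^esub> y \<in> N \<longleftrightarrow> x \<in> cl y"
    using assms N.a_rcos_module[of y x] by (simp only: F.minus_eq)
  also have "\<dots> \<longleftrightarrow> cl x = cl y"
    using assms N.a_repr_independence'[of x y] N.a_rcos_self[of x] by auto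
  finally show ?thesis by simp
qed

lemma tensor_space_carrier: "carrier (V \<boxtimes> W) = cl ` carrier F"
  by (auto simp: tensor_space_def Let_def A_RCOSETS_def')

lemma tensor_space_zero: "\<zero>\<^bsub>V \<boxtimes> W\<^esub> = cl \<zero>\<^bsub>F\<^esub>"
proof -
  have "cl \<zero>\<^bsub>F\<^esub> = N"
    by (rule F.a_coset_add_zero[OF N.a_subset])
  then show ?thesis
    by (simp add: tensor_space_def Let_def del: free_space_sel)
qed

lemma tensor_space_add:
  assumes "x \<in> carrier F" "y \<in> carrier F"
  shows "cl x \<oplus>\<^bsub>V \<boxtimes> W\<^esub> cl y = cl (x \<oplus>\<^bsub>F\<^esub> y)"
  using N.a_rcos_sum[OF assms] by (simp add: tensor_space_def Let_def del: free_space_sel)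

text \<open>The record takes a union over all representatives of a coset. As \<open>N\<close> is
  stable under scalars, all cosets in this union coincide, and the union is a single coset.\<close>

lemma tensor_space_smult:
  assumes c: "c \<in> carrier K" and x: "x \<in> carrier F"
  shows "c \<odot>\<^bsub>V \<boxtimes> W\<^esub> cl x = cl (c \<odot>\<^bsub>F\<^esub> x)"
proof -
  have "cl (c \<odot>\<^bsub>F\<^esub> y) = cl (c \<odot>\<^bsub>F\<^esub> x)" if y: "y \<in> cl x" for y
  proof -
    have yF: "y \<in> carrier F"
      using y x N.a_rcosets_carrier[of "cl x"] F.a_rcosetsI N.a_subset by blast
    then have "y \<ominus>\<^bsub>F\<^esub> x \<in> N"
      using x y N.a_rcos_module[of x y] by (simp only: F.minus_eq)
    then have "c \<odot>\<^bsub>F\<^esub> (y \<ominus>\<^bsub>F\<^esub> x) \<in> N"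
      by (rule submodule.smult_closed[OF tensor_null_submodule c])
    moreover have "c \<odot>\<^bsub>F\<^esub> (y \<ominus>\<^bsub>F\<^esub> x) = c \<odot>\<^bsub>F\<^esub> y \<ominus>\<^bsub>F\<^esub> c \<odot>\<^bsub>F\<^esub> x"
      using c x yF
      by (simp only: F.minus_eq F.smult_r_distr F.smult_r_minus F.a_inv_closed)
    ultimately show ?thesis
      using c x yF by (simp only: cl_eq_iff F.smult_closed)
  qed
  moreover have "x \<in> cl x"
    using x by (rule N.a_rcos_self)
  ultimately have "(\<Union>y\<in>cl x. cl (c \<odot>\<^bsub>F\<^esub> y)) = cl (c \<odot>\<^bsub>F\<^esub> x)"
    by blast
  then show ?thesis
    by (simp add: tensor_space_def Let_def del: free_space_sel)
qed

lemma tensor_space_module: "module K (V \<boxtimes> W)"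
proof (rule moduleI)
  show "abelian_group (V \<boxtimes> W)"
  proof (rule abelian_groupI)
    fix t assume "t \<in> carrier (V \<boxtimes> W)"
    then obtain x where x: "t = cl x" "x \<in> carrier F"
      by (auto simp: tensor_space_carrier)
    then show "\<exists>s\<in>carrier (V \<boxtimes> W).
        s \<oplus>\<^bsub>V \<boxtimes> W\<^esub> t = \<zero>\<^bsub>V \<boxtimes> W\<^esub>"
      using F.l_neg[of x] F.a_inv_closed[of x]
      by (intro bexI[of _ "cl (\<ominus>\<^bsub>F\<^esub> x)"])
        (simp_all add: tensor_space_carrier tensor_space_add tensor_space_zero del: free_space_sel)
  qed (auto simp: tensor_space_carrier tensor_space_add tensor_space_zero F.a_assoc F.a_comm
      F.zero_closed F.a_closed F.l_zero F.r_zero simp del: free_space_sel, simp_all only: F.a_ac F.a_closed)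
qed (auto simp: tensor_space_carrier tensor_space_add tensor_space_smult is_cring
    F.smult_l_distr F.smult_r_distr F.smult_assoc1 simp del: free_space_sel)

lemma gen_closed [simp]: "v \<in> carrier V \<Longrightarrow> w \<in> carrier W \<Longrightarrow> free_gen K (v, w) \<in> carrier F"
  by (intro free_gen_closed) simp

lemma tens_closed: "v \<in> carrier V \<Longrightarrow> w \<in> carrier W \<Longrightarrow> tens K V W v w \<in> carrier (V \<boxtimes> W)"
  by (auto simp: tensor_space_carrier tens_def)

lemma tens_add_l:
  assumes "v \<in> carrier V" "v' \<in> carrier V" "w \<in> carrier W"
  shows "tens K V W (v \<oplus>\<^bsub>V\<^esub> v') w = tens K V W v w \<oplus>\<^bsub>V \<boxtimes> W\<^esub> tens K V W v' w"
proof -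
  have "free_gen K (v \<oplus>\<^bsub>V\<^esub> v', w) \<ominus>\<^bsub>F\<^esub> (free_gen K (v, w) \<oplus>\<^bsub>F\<^esub> free_gen K (v', w))
      \<in> bilinear_relations K V W"
    unfolding bilinear_relations_def Let_def using assms by blast
  then show ?thesis
    using assms bilinear_relations_null
    by (simp add: tens_def tensor_space_add cl_eq_iff subset_iff del: free_space_sel)
qed

lemma tens_add_r:
  assumes "v \<in> carrier V" "w \<in> carrier W" "w' \<in> carrier W"
  shows "tens K V W v (w \<oplus>\<^bsub>W\<^esub> w') = tens K V W v w \<oplus>\<^bsub>V \<boxtimes> W\<^esub> tens K V W v w'"
proof -
  have "free_gen K (v, w \<oplus>\<^bsub>W\<^esub> w') \<ominus>\<^bsub>F\<^esub> (free_gen K (v, w) \<oplus>\<^bsub>F\<^esub> free_gen K (v, w'))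
      \<in> bilinear_relations K V W"
    unfolding bilinear_relations_def Let_def using assms by blast
  then show ?thesis
    using assms bilinear_relations_null
    by (simp add: tens_def tensor_space_add cl_eq_iff subset_iff del: free_space_sel)
qed

lemma tens_smult_l:
  assumes "c \<in> carrier K" "v \<in> carrier V" "w \<in> carrier W"
  shows "tens K V W (c \<odot>\<^bsub>V\<^esub> v) w = c \<odot>\<^bsub>V \<boxtimes> W\<^esub> tens K V W v w"
proof -
  have "free_gen K (c \<odot>\<^bsub>V\<^esub> v, w) \<ominus>\<^bsub>F\<^esub> (c \<odot>\<^bsub>F\<^esub> free_gen K (v, w)) \<in> bilinear_relations K V W"
    unfolding bilinear_relations_def Let_def using assms by blast
  then show ?thesis
    using assms bilinear_relations_null
    by (simp add: tens_def tensor_space_smult cl_eq_iff subset_iff del: free_space_sel)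
qed

lemma tens_smult_r:
  assumes "c \<in> carrier K" "v \<in> carrier V" "w \<in> carrier W"
  shows "tens K V W v (c \<odot>\<^bsub>W\<^esub> w) = c \<odot>\<^bsub>V \<boxtimes> W\<^esub> tens K V W v w"
proof -
  have "free_gen K (v, c \<odot>\<^bsub>W\<^esub> w) \<ominus>\<^bsub>F\<^esub> (c \<odot>\<^bsub>F\<^esub> free_gen K (v, w)) \<in> bilinear_relations K V W"
    unfolding bilinear_relations_def Let_def using assms by blast
  then show ?thesis
    using assms bilinear_relations_null
    by (simp add: tens_def tensor_space_smult cl_eq_iff subset_iff del: free_space_sel)
qed

text \<open>The induction runs over a finite set containing the support, not over the support
  itself. A point of that set outside of the two carriers carries the coefficient zero and changes
  nothing.\<close>

lemma free_space_induct [consumes 1, case_names zero add]: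
  assumes "x \<in> carrier F"
    and "P \<zero>\<^bsub>F\<^esub>"
    and "\<And>x c v w. x \<in> carrier F \<Longrightarrow> P x \<Longrightarrow> c \<in> carrier K \<Longrightarrow> v \<in> carrier V \<Longrightarrow> w \<in> carrier W
      \<Longrightarrow> P (x \<oplus>\<^bsub>F\<^esub> c \<odot>\<^bsub>F\<^esub> free_gen K (v, w))"
  shows "P x"
proof -
  have "finite {s. x s \<noteq> \<zero>}"
    using assms(1) by (simp add: free_space_carrier)
  then obtain S where "finite S" "{s. x s \<noteq> \<zero>} \<subseteq> S"
    by blast
  then show ?thesis
    using assms(1)
  proof (induction S arbitrary: x rule: finite_induct)
    case empty
    then have "x = \<zero>\<^bsub>F\<^esub>" by auto
    then show ?case using assms(2) by simp
  next
    case (insert s S)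
    define y where "y = (\<lambda>r. if r = s then \<zero> else x r)"
    have "{r. y r \<noteq> \<zero>} \<subseteq> {r. x r \<noteq> \<zero>}"
      by (auto simp: y_def)
    then have y: "y \<in> carrier F"
      using insert.prems by (auto simp: free_space_carrier y_def intro: finite_subset)
    have "P y"
      using insert.prems y by (intro insert.IH) (auto simp: y_def)
    show ?case
    proof (cases "s \<in> carrier V \<times> carrier W")
      case True
      then obtain v w where s: "s = (v, w)" "v \<in> carrier V" "w \<in> carrier W" by auto
      have xs: "x s \<in> carrier K"
        using insert.prems(2) by (rule free_space_val)
      have "x = y \<oplus>\<^bsub>F\<^esub> x s \<odot>\<^bsub>F\<^esub> free_gen K (v, w)"
        using insert.prems(2) free_space_val[OF insert.prems(2)]
            by (simp add: fun_eq_iff y_def s free_gen_def)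
      then show ?thesis
        using assms(3)[OF y \<open>P y\<close> xs s(2,3)] by simp
    next
      case False
      then have "x = y"
        using insert.prems(2) free_space_out[OF insert.prems(2) False] by (simp add: fun_eq_iff y_def)
      then show ?thesis using \<open>P y\<close> by simp
    qed
  qed
qed

text \<open>The step needs no coefficient, since c \<odot> (v \<otimes> w) = (c \<odot> v) \<otimes>
  w.\<close>

lemma tensor_induct [consumes 1, case_names zero add]:
  assumes "t \<in> carrier (V \<boxtimes> W)"
    and "P \<zero>\<^bsub>V \<boxtimes> W\<^esub>"
    and "\<And>s v w. s \<in> carrier (V \<boxtimes> W) \<Longrightarrow> P s \<Longrightarrow> v \<in> carrier V \<Longrightarrow> w \<in> carrier W
      \<Longrightarrow> P (s \<oplus>\<^bsub>V \<boxtimes> W\<^esub> tens K V W v w)"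
  shows "P t"
proof -
  obtain x where x: "x \<in> carrier F" "t = cl x"
    using assms(1) by (auto simp: tensor_space_carrier)
  have "P (cl x)"
    using x(1)
  proof (induction x rule: free_space_induct)
    case zero
    then show ?case using assms(2) by (simp only: tensor_space_zero)
  next
    case (add x c v w)
    have "cl (x \<oplus>\<^bsub>F\<^esub> c \<odot>\<^bsub>F\<^esub> free_gen K (v, w))
        = cl x \<oplus>\<^bsub>V \<boxtimes> W\<^esub> c \<odot>\<^bsub>V \<boxtimes> W\<^esub> tens K V W v w"
      using add by (simp add: tensor_space_add tensor_space_smult tens_def del: free_space_sel)
    also have "\<dots> = cl x \<oplus>\<^bsub>V \<boxtimes> W\<^esub> tens K V W (c \<odot>\<^bsub>V\<^esub> v) w"
      using add by (simp add: tens_smult_l del: free_space_sel)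
    finally show ?case
      using add assms(3)[of "cl x" "c \<odot>\<^bsub>V\<^esub> v" w] by (simp add: tensor_space_carrier)
  qed
  then show ?thesis using x(2) by simp
qed

text \<open>This is the sum that \<open>sw\<close> forms at its chosen representative, now as a
  function of the representative: the linear extension of f from the generators to the free
  space.\<close>

definition lift where
  "lift M f x = (\<Oplus>\<^bsub>M\<^esub>p\<in>{p. x p \<noteq> \<zero>}. x p \<odot>\<^bsub>M\<^esub> f (fst p) (snd p))"

lemma support_closed: "x \<in> carrier F \<Longrightarrow> x p \<noteq> \<zero> \<Longrightarrow> fst p \<in> carrier V \<and> snd p \<in> carrier W"
  using free_space_out[of x "carrier V \<times> carrier W" p] by (auto simp: mem_Times_iff)

context
  fixes M :: "('k, 'm) module" and f
  assumes M: "module K M" and f_closed: "\<And>v w. v \<in> carrier V \<Longrightarrow> w \<in> carrier W \<Longrightarrow> f v w \<in> carrier M"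
begin

interpretation M: module K M by (rule M)

text \<open>Enlarging the index set adds only zero summands. This allows the sums for x, y and x +
  y, whose supports differ, to be compared over one set.\<close>

lemma lift_superset:
  assumes "x \<in> carrier F" "finite S" "{p. x p \<noteq> \<zero>} \<subseteq> S" "S \<subseteq> carrier V \<times> carrier W"
  shows "lift M f x = (\<Oplus>\<^bsub>M\<^esub>p\<in>S. x p \<odot>\<^bsub>M\<^esub> f (fst p) (snd p))"
  unfolding lift_def
proof (rule M.add.finprod_mono_neutral_cong_left)
  show "(\<lambda>p. x p \<odot>\<^bsub>M\<^esub> f (fst p) (snd p)) \<in> S \<rightarrow> carrier M"
    using assms by (auto simp: Pi_iff free_space_carrier intro!: M.smult_closed f_closed)
qed (use assms in \<open>auto simp: f_closed\<close>)

lemma lift_closed: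
  assumes x: "x \<in> carrier F"
  shows "lift M f x \<in> carrier M"
  unfolding lift_def
proof (rule M.finsum_closed, rule Pi_I)
  fix p assume "p \<in> {p. x p \<noteq> \<zero>}"
  then have "f (fst p) (snd p) \<in> carrier M"
    using support_closed[OF x] by (intro f_closed) auto
  then show "x p \<odot>\<^bsub>M\<^esub> f (fst p) (snd p) \<in> carrier M"
    using x by (simp add: free_space_val)
qed

lemma lift_lin: "lin K F M (lift M f)"
proof (rule linI)
  fix x y assume x: "x \<in> carrier F" and y: "y \<in> carrier F"
  let ?S = "{p. x p \<noteq> \<zero>} \<union> {p. y p \<noteq> \<zero>}"
  have S: "finite ?S" "?S \<subseteq> carrier V \<times> carrier W"
    using x y by (auto simp: free_space_carrier mem_Times_iff)
  have xy: "x \<oplus>\<^bsub>F\<^esub> y \<in> carrier F" "{p. (x \<oplus>\<^bsub>F\<^esub> y) p \<noteq> \<zero>} \<subseteq> ?S"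
    using F.a_closed[OF x y] by (auto simp: free_space_carrier)
  have cl: "p \<in> ?S \<Longrightarrow> f (fst p) (snd p) \<in> carrier M" for p
    using S by (intro f_closed) (auto simp: mem_Times_iff)
  have "lift M f (x \<oplus>\<^bsub>F\<^esub> y)
      = (\<Oplus>\<^bsub>M\<^esub>p\<in>?S. x p \<odot>\<^bsub>M\<^esub> f (fst p) (snd p) \<oplus>\<^bsub>M\<^esub> y p \<odot>\<^bsub>M\<^esub> f (fst p) (snd p))"
    using x y cl unfolding lift_superset[OF xy(1) S(1) xy(2) S(2)]
    by (intro M.add.finprod_cong) (auto simp: free_space_carrier M.smult_l_distr simp_implies_def)
  also have "\<dots> = lift M f x \<oplus>\<^bsub>M\<^esub> lift M f y"
    unfolding lift_superset[OF x S(1) Un_upper1 S(2)] lift_superset[OF y S(1) Un_upper2 S(2)]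
    using x y cl by (intro M.add.finprod_multf) (auto simp: Pi_iff free_space_carrier)
  finally show "lift M f (x \<oplus>\<^bsub>F\<^esub> y) = lift M f x \<oplus>\<^bsub>M\<^esub> lift M f y" .
next
  fix c x assume c: "c \<in> carrier K" and x: "x \<in> carrier F"
  let ?S = "{p. x p \<noteq> \<zero>}"
  have S: "finite ?S" "?S \<subseteq> carrier V \<times> carrier W"
    using x by (auto simp: free_space_carrier mem_Times_iff)
  have cx: "c \<odot>\<^bsub>F\<^esub> x \<in> carrier F" "{p. (c \<odot>\<^bsub>F\<^esub> x) p \<noteq> \<zero>} \<subseteq> ?S"
    using F.smult_closed[OF c x] c x by (auto simp: free_space_carrier)
  have cl: "p \<in> ?S \<Longrightarrow> f (fst p) (snd p) \<in> carrier M" for p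
    using S by (intro f_closed) (auto simp: mem_Times_iff)
  have "lift M f (c \<odot>\<^bsub>F\<^esub> x) = (\<Oplus>\<^bsub>M\<^esub>p\<in>?S. c \<odot>\<^bsub>M\<^esub> (x p \<odot>\<^bsub>M\<^esub> f (fst p) (snd p)))"
    using c x cl unfolding lift_superset[OF cx(1) S(1) cx(2) S(2)]
    by (intro M.add.finprod_cong) (auto simp: free_space_carrier M.smult_assoc1 simp_implies_def)
  also have "\<dots> = c \<odot>\<^bsub>M\<^esub> lift M f x"
    unfolding lift_superset[OF x S(1) subset_refl S(2)]
    using c x cl S by (intro M.finsum_smult_ldistr[symmetric]) (auto simp: Pi_iff free_space_carrier)
  finally show "lift M f (c \<odot>\<^bsub>F\<^esub> x) = c \<odot>\<^bsub>M\<^esub> lift M f x" .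
qed (rule lift_closed)

lemma lift_gen:
  assumes "v \<in> carrier V" "w \<in> carrier W"
  shows "lift M f (free_gen K (v, w)) = f v w"
proof -
  have "{p. free_gen K (v, w) p \<noteq> \<zero>} = {(v, w)}"
    by (auto simp: free_gen_def)
  then show ?thesis
    using assms by (simp add: lift_def free_gen_def f_closed)
qed

context
  assumes f_lin_l: "\<And>w. w \<in> carrier W \<Longrightarrow> lin K V M (\<lambda>v. f v w)"
    and f_lin_r: "\<And>v. v \<in> carrier V \<Longrightarrow> lin K W M (f v)"
begin

text \<open>The kernel of the linear extension is a submodule that contains the bilinear relations,
  and \<open>N\<close> is the smallest such submodule.\<close>

lemma lift_null:
  assumes "x \<in> N"
  shows "lift M f x = \<zero>\<^bsub>M\<^esub>"
proof -
  note add = lin_add[OF lift_lin] and smult = lin_smult[OF lift_lin] and gen = lift_gen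
  \<comment> \<open>Every relation is a difference of two elements with the same image, so this one
    fact disposes of all four kinds of relations.\<close>
  have minus: "lift M f (x \<ominus>\<^bsub>F\<^esub> y) = \<zero>\<^bsub>M\<^esub>"
    if "x \<in> carrier F" "y \<in> carrier F" "lift M f x = lift M f y" for x y
  proof -
    have "x \<ominus>\<^bsub>F\<^esub> y = x \<oplus>\<^bsub>F\<^esub> (\<ominus> \<one>) \<odot>\<^bsub>F\<^esub> y"
      using that F.smult_l_minus[of \<one> y] F.smult_one[of y]
      by (simp only: F.minus_eq one_closed)
    then have "lift M f (x \<ominus>\<^bsub>F\<^esub> y) = lift M f (x \<oplus>\<^bsub>F\<^esub> (\<ominus> \<one>) \<odot>\<^bsub>F\<^esub> y)"
      by (rule arg_cong)
    also have "\<dots> = lift M f y \<oplus>\<^bsub>M\<^esub> (\<ominus> \<one>) \<odot>\<^bsub>M\<^esub> lift M f y"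
      using that by (simp only: add smult F.smult_closed a_inv_closed one_closed)
    also have "\<dots> = \<zero>\<^bsub>M\<^esub>"
      using that lift_closed[of y] by (simp add: M.smult_l_minus M.r_neg)
    finally show ?thesis .
  qed
  let ?N = "{x \<in> carrier F. lift M f x = \<zero>\<^bsub>M\<^esub>}"
  have "submodule ?N K F"
  proof (rule F.submoduleI)
    fix a assume a: "a \<in> ?N"
    have "\<zero>\<^bsub>F\<^esub> \<ominus>\<^bsub>F\<^esub> a = \<ominus>\<^bsub>F\<^esub> a"
      using a by (simp only: mem_Collect_eq F.minus_eq F.l_zero F.a_inv_closed)
    then show "\<ominus>\<^bsub>F\<^esub> a \<in> ?N"
      using a minus[of "\<zero>\<^bsub>F\<^esub>" a] lin_zero[OF F.module_axioms M lift_lin]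
      by (simp del: free_space_sel)
  qed (use lin_zero[OF F.module_axioms M lift_lin] in \<open>auto simp: add smult simp del: free_space_sel\<close>)
  moreover have "bilinear_relations K V W \<subseteq> ?N"
  proof
    fix r assume r: "r \<in> bilinear_relations K V W"
    then have "r \<in> carrier F" using bilinear_relations_closed by blast
    moreover have "lift M f r = \<zero>\<^bsub>M\<^esub>"
      using r unfolding bilinear_relations_def Let_def
      by (elim UnE CollectE exE conjE)
        (auto simp del: free_space_sel simp: add smult gen lin_add[OF f_lin_l] lin_add[OF f_lin_r]
          lin_smult[OF f_lin_l] lin_smult[OF f_lin_r] intro!: minus)
    ultimately show "r \<in> ?N" by simp
  qed
  ultimately have "N \<subseteq> ?N"
    unfolding tensor_null_def by blast
  then show ?thesis using assms by blast
qed

text \<open>The representative picked by \<open>SOME\<close> differs from x by an element of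
  \<open>N\<close>, where the linear extension vanishes.\<close>

lemma sw_cl:
  assumes "x \<in> carrier F"
  shows "sw K M (cl x) f = lift M f x"
proof -
  define y where "y = (SOME y. y \<in> cl x)"
  have "y \<in> cl x"
    unfolding y_def using N.a_rcos_self[OF assms] by (rule someI[where P="\<lambda>y. y \<in> cl x"])
  moreover have "cl x \<subseteq> carrier F"
    using assms N.a_rcosets_carrier[of "cl x"] F.a_rcosetsI[OF N.a_subset] by blast
  ultimately have yF: "y \<in> carrier F" and yx: "y \<ominus>\<^bsub>F\<^esub> x \<in> N"
    using assms N.a_rcos_module[of x y] by (auto simp only: F.minus_eq)
  have "y = (y \<ominus>\<^bsub>F\<^esub> x) \<oplus>\<^bsub>F\<^esub> x"
    using assms yF F.a_inv_closed[of x] F.l_neg[of x] F.a_assoc[of y "\<ominus>\<^bsub>F\<^esub> x" x] F.r_zero[of y]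
    by (simp only: F.minus_eq)
  then have "lift M f y = lift M f ((y \<ominus>\<^bsub>F\<^esub> x) \<oplus>\<^bsub>F\<^esub> x)"
    by (rule arg_cong)
  also have "\<dots> = lift M f (y \<ominus>\<^bsub>F\<^esub> x) \<oplus>\<^bsub>M\<^esub> lift M f x"
    using assms yF by (intro lin_add[OF lift_lin] F.minus_closed)
  also have "\<dots> = lift M f x"
    using lift_null[OF yx] lift_closed[OF assms] by simp
  finally show ?thesis
    by (simp add: sw_def Let_def y_def lift_def)
qed

lemma sw_lin: "lin K (V \<boxtimes> W) M (\<lambda>t. sw K M t f)"
  using lin_add[OF lift_lin] lin_smult[OF lift_lin] F.a_closed F.smult_closed
  by (intro linI) (auto simp: tensor_space_carrier sw_cl lift_closed tensor_space_add tensor_space_smult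
      simp del: free_space_sel)

lemma sw_tens: "v \<in> carrier V \<Longrightarrow> w \<in> carrier W \<Longrightarrow> sw K M (tens K V W v w) f = f v w"
  by (simp add: tens_def sw_cl lift_gen)

end
end
end

text \<open>\<open>tensor K V W\<close> and \<open>tensor_space K V W\<close> are different records; \<open>space\<close> forgets the multiplication, and the
  simplifier rewrites the algebra to the vector space wherever only the latter matters.\<close>

definition space :: "('k, 'a) module \<Rightarrow> ('k, 'a) module" where
  "space M = \<lparr>carrier = carrier M, mult = undefined, one = undefined, zero = zero M, add = add M,
     smult = smult M\<rparr>"

lemma space_eq_iff:
  "space M = space M' \<longleftrightarrow> carrier M = carrier M' \<and> zero M = zero M' \<and> add M = add M' \<and> smult M = smult M'"
  by (auto simp: space_def)

lemma space_tensor_space [simp]: "space (tensor_space K V W) = tensor_space K V W"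
  by (simp add: space_def tensor_space_def Let_def)

lemma space_tensor [simp]: "space (tensor K V W) = tensor_space K V W"
  by (simp add: space_def tensor_def tensor_space_def Let_def)

lemma space_update [simp]: "space (M\<lparr>mult := x\<rparr>) = space M" "space (M\<lparr>one := y\<rparr>) = space M"
  by (simp_all add: space_def)

lemma space_sel [simp]:
  "add (space M) = add M" "smult (space M) = smult M"
  by (simp_all add: space_def)

lemma finsum_space: "space M = space M' \<Longrightarrow> finsum M f S = finsum M' f S"
  by (simp add: finsum_def finprod_def space_eq_iff)

lemma bilinear_relations_space:
  "space V = space V' \<Longrightarrow> space W = space W' \<Longrightarrow> bilinear_relations K V W = bilinear_relations K V' W'"
  by (simp add: bilinear_relations_def space_eq_iff)

lemma tensor_null_space:
  "space V = space V' \<Longrightarrow> space W = space W' \<Longrightarrow> tensor_null K V W = tensor_null K V' W'"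
  unfolding tensor_null_def by (simp add: bilinear_relations_space[of V V' W W'] space_eq_iff)

lemma tens_space: "space V = space V' \<Longrightarrow> space W = space W' \<Longrightarrow> tens K V W = tens K V' W'"
  unfolding tens_def using tensor_null_space[of V V' W W' K] by (simp add: space_eq_iff fun_eq_iff)

lemma tensor_space_space:
  "space V = space V' \<Longrightarrow> space W = space W' \<Longrightarrow> tensor_space K V W = tensor_space K V' W'"
  unfolding tensor_space_def using tensor_null_space[of V V' W W' K] by (simp add: space_eq_iff)

lemma sw_space: "space M = space M' \<Longrightarrow> sw K M t f = sw K M' t f"
  unfolding sw_def Let_def by (simp add: finsum_space[of M M'] space_eq_iff)

lemma module_space:
  assumes "space M = space M'" shows "module K M \<longleftrightarrow> module K M'"
proof -
  have "add_monoid M = add_monoid M'"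
    using assms by (simp add: space_eq_iff)
  then show ?thesis
    using assms
    by (simp add: module_def module_axioms_def abelian_group_def abelian_monoid_def
        abelian_group_axioms_def comm_group_def space_eq_iff)
qed

section \<open>Sweedler sums as linear maps\<close>

text \<open>\<open>sm K V W M\<close> is \<open>sw K M\<close> annotated with the tensor factors \<open>V\<close>, \<open>W\<close> of its argument, and cut off
  outside of the carriers. The cut-off makes the congruence rule below unconditional, so that the simplifier
  knows the membership of all summation variables.\<close>

definition sm ::
  "'k ring \<Rightarrow> ('k, 'a) module \<Rightarrow> ('k, 'b) module \<Rightarrow> ('k, 'c) module
    \<Rightarrow> ('k, 'a, 'b) tensor \<Rightarrow> ('a \<Rightarrow> 'b \<Rightarrow> 'c) \<Rightarrow> 'c" where
  "sm K V W M t f =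
    (if t \<in> carrier (tensor_space K V W)
     then sw K M t (\<lambda>a b. if a \<in> carrier V \<and> b \<in> carrier W then f a b else \<zero>\<^bsub>M\<^esub>) else \<zero>\<^bsub>M\<^esub>)"

lemma sm_cong [cong]:
  assumes "V = V'" "W = W'" "M = M'" "t = t'"
    and "\<And>a b. a \<in> carrier V' \<Longrightarrow> b \<in> carrier W' \<Longrightarrow> f a b = g a b"
  shows "sm K V W M t f = sm K V' W' M' t' g"
proof -
  have "(\<lambda>a b. if a \<in> carrier V' \<and> b \<in> carrier W' then f a b else \<zero>\<^bsub>M'\<^esub>)
      = (\<lambda>a b. if a \<in> carrier V' \<and> b \<in> carrier W' then g a b else \<zero>\<^bsub>M'\<^esub>)"
    using assms(5) by (auto simp: fun_eq_iff)
  then show ?thesis by (simp add: sm_def assms(1-4))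
qed

lemma sm_space:
  assumes "space V = space V'" "space W = space W'" "space M = space M'"
  shows "sm K V W M t f = sm K V' W' M' t f"
proof -
  have eqs: "carrier V = carrier V'" "carrier W = carrier W'" "zero M = zero M'"
    using assms by (simp_all add: space_eq_iff)
  show ?thesis
    unfolding sm_def tensor_space_space[OF assms(1,2)] sw_space[OF assms(3)] eqs by (rule refl)
qed

lemma lin_space:
  "space V = space V' \<Longrightarrow> space M = space M' \<Longrightarrow> lin K V M f \<longleftrightarrow> lin K V' M' f"
  by (simp add: lin_def space_eq_iff)

text \<open>These are the operations that see a record only through its underlying vector space.
  Instantiated with a tensor algebra or a smash product, they become the simp rules that rewrite
  such a record to the bare tensor space.\<close>

lemma space_rules:
  assumes "space S = space T"
  shows "carrier S = carrier T" "zero S = zero T" "add S = add T" "smult S = smult T"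
    "tens K S A = tens K T A" "tens K B S = tens K B T"
    "tensor_space K S C = tensor_space K T C" "tensor_space K D S = tensor_space K D T"
    "sw K S a f = sw K T a f"
    "sm K S E F b g = sm K T E F b g" "sm K G S I c h = sm K G T I c h"
    "sm K J L S d i = sm K J L T d i"
    "lin K S M j \<longleftrightarrow> lin K T M j" "lin K N S k \<longleftrightarrow> lin K N T k"
    "module K S \<longleftrightarrow> module K T"
  using assms
  by (simp_all add: space_eq_iff tens_space[OF assms] tens_space[OF refl assms] tensor_space_space[OF assms]
      tensor_space_space[OF refl assms] sw_space[OF assms] sm_space[OF assms] sm_space[OF refl assms]
      sm_space[OF refl refl assms] lin_space[OF assms] lin_space[OF refl assms] module_space[OF assms])

lemma space_tensor_eq: "space (tensor K X Y) = space (tensor_space K X Y)"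
  by simp

lemmas tensor_to_space [simp] = space_rules[OF space_tensor_eq]

context ground_field
begin

lemma tensor_pairI: "module K V \<Longrightarrow> module K W \<Longrightarrow> tensor_pair K V W"
  by (simp add: tensor_pair_def ground_field_axioms)

lemma tensor_module [simp]: "module K V \<Longrightarrow> module K W \<Longrightarrow> module K (V \<boxtimes> W)"
  by (rule tensor_pair.tensor_space_module[OF tensor_pairI])

lemma tens_in [simp]:
  "module K V \<Longrightarrow> module K W \<Longrightarrow> v \<in> carrier V \<Longrightarrow> w \<in> carrier W
    \<Longrightarrow> tens K V W v w \<in> carrier (V \<boxtimes> W)"
  by (rule tensor_pair.tens_closed[OF tensor_pairI])

lemma tensor_rep:
  assumes "module K V" "module K W" "t \<in> carrier (V \<boxtimes> W)"
  shows "(SOME x. x \<in> t) \<in> carrier (free_space K (carrier V \<times> carrier W))"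
proof -
  interpret tensor_pair K V W by (rule tensor_pairI) fact+
  obtain y where y: "y \<in> carrier F" "t = cl y"
    using assms(3) by (auto simp: tensor_space_carrier)
  have "(SOME x. x \<in> t) \<in> t"
    unfolding y(2) using N.a_rcos_self[OF y(1)] by (rule someI[where P="\<lambda>x. x \<in> cl y"])
  then show ?thesis
    using y N.a_rcosets_carrier[of "cl y"] F.a_rcosetsI[OF N.a_subset] by blast
qed

text \<open>A representative is supported on pairs from the two carriers, so the cut-off in the body
  affects no summand.\<close>

lemma sm_eq_sw:
  assumes "module K V" "module K W" "t \<in> carrier (V \<boxtimes> W)" "module K M"
    and f: "\<And>a b. a \<in> carrier V \<Longrightarrow> b \<in> carrier W \<Longrightarrow> f a b \<in> carrier M"
  shows "sm K V W M t f = sw K M t f"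
proof -
  interpret tensor_pair K V W by (rule tensor_pairI) fact+
  interpret M: module K M by fact
  show ?thesis
    using assms(3) support_closed[OF tensor_rep[OF assms(1-3)]] f free_space_val[OF tensor_rep[OF assms(1-3)]]
    unfolding sm_def sw_def Let_def
    by (auto intro!: M.add.finprod_cong simp: simp_implies_def)
qed

text \<open>The bodies f and g are kept apart so that the rule can be applied again below the
  binder: a nest of \<open>sw\<close> is turned into a nest of \<open>sm\<close> from the outside
  inwards, and each level supplies the memberships for the next.\<close>

lemma sw_eq_sm:
  assumes "module K V" "module K W" "t \<in> carrier (V \<boxtimes> W)" "module K M"
    and "\<And>a b. a \<in> carrier V \<Longrightarrow> b \<in> carrier W \<Longrightarrow> f a b = g a b"
    and "\<And>a b. a \<in> carrier V \<Longrightarrow> b \<in> carrier W \<Longrightarrow> g a b \<in> carrier M"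
  shows "sw K M t f = sm K V W M t g"
  using assms by (subst sm_eq_sw[OF assms(1-4), of f, symmetric]) auto

lemma sm_closed [simp]:
  assumes "module K V" "module K W" "module K M"
    and f: "\<And>a b. a \<in> carrier V \<Longrightarrow> b \<in> carrier W \<Longrightarrow> f a b \<in> carrier M"
  shows "sm K V W M t f \<in> carrier M"
proof -
  interpret tensor_pair K V W by (rule tensor_pairI) fact+
  interpret M: module K M by fact
  show ?thesis
  proof (cases "t \<in> carrier (V \<boxtimes> W)")
    case True
    have "sm K V W M t f = lift M f (SOME x. x \<in> t)"
      using sm_eq_sw[OF assms(1,2) True assms(3), of f] f by (simp add: sw_def lift_def Let_def)
    also have "\<dots> \<in> carrier M"
      by (rule lift_closed[OF assms(3) _ tensor_rep[OF assms(1,2) True]]) (rule f)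
    finally show ?thesis .
  qed (simp add: sm_def)
qed

lemma support_val:
  assumes "module K V" "module K W" "t \<in> carrier (V \<boxtimes> W)" "module K M"
    and f: "\<And>a b. a \<in> carrier V \<Longrightarrow> b \<in> carrier W \<Longrightarrow> f a b \<in> carrier M"
    and p: "(SOME x. x \<in> t) p \<noteq> \<zero>"
  shows "(SOME x. x \<in> t) p \<odot>\<^bsub>M\<^esub> f (fst p) (snd p) \<in> carrier M" "f (fst p) (snd p) \<in> carrier M"
    "(SOME x. x \<in> t) p \<in> carrier K"
proof -
  interpret tensor_pair K V W by (rule tensor_pairI) fact+
  interpret M: module K M by fact
  show 1: "f (fst p) (snd p) \<in> carrier M"
    using support_closed[OF tensor_rep[OF assms(1-3)] p] by (auto intro: f)
  show 2: "(SOME x. x \<in> t) p \<in> carrier K"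
    by (rule free_space_val[OF tensor_rep[OF assms(1-3)]])
  show "(SOME x. x \<in> t) p \<odot>\<^bsub>M\<^esub> f (fst p) (snd p) \<in> carrier M"
    using 1 2 by simp
qed

text \<open>Both sides are the same finite combination taken at the same representative of t, and
  linearity of g carries it inside.\<close>

lemma sm_apply:
  assumes "module K V" "module K W" "module K M" "module K M'" "lin K M M' g"
    and f: "\<And>a b. a \<in> carrier V \<Longrightarrow> b \<in> carrier W \<Longrightarrow> f a b \<in> carrier M"
  shows "g (sm K V W M t f) = sm K V W M' t (\<lambda>a b. g (f a b))"
proof -
  interpret M: module K M by fact
  interpret M': module K M' by fact
  have gf: "g (f a b) \<in> carrier M'" if "a \<in> carrier V" "b \<in> carrier W" for a b
    using that assms(5) f by (auto intro: lin_closed)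
  show ?thesis
  proof (cases "t \<in> carrier (V \<boxtimes> W)")
    case True
    define x where "x = (SOME x. x \<in> t)"
    have val: "x p \<odot>\<^bsub>M\<^esub> f (fst p) (snd p) \<in> carrier M" "f (fst p) (snd p) \<in> carrier M"
      "x p \<in> carrier K" if "x p \<noteq> \<zero>" for p
      using support_val[where f=f and p=p, OF assms(1,2) True assms(3)] f that
      unfolding x_def by blast+
    have "g (sm K V W M t f) = g (\<Oplus>\<^bsub>M\<^esub>p\<in>{p. x p \<noteq> \<zero>}. x p \<odot>\<^bsub>M\<^esub> f (fst p) (snd p))"
      using sm_eq_sw[OF assms(1,2) True assms(3), of f] f by (simp add: sw_def x_def Let_def)
    also have "\<dots> = (\<Oplus>\<^bsub>M'\<^esub>p\<in>{p. x p \<noteq> \<zero>}. g (x p \<odot>\<^bsub>M\<^esub> f (fst p) (snd p)))"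
      using val by (intro lin_finsum[OF assms(3-5)]) auto
    also have "\<dots> = (\<Oplus>\<^bsub>M'\<^esub>p\<in>{p. x p \<noteq> \<zero>}. x p \<odot>\<^bsub>M'\<^esub> g (f (fst p) (snd p)))"
      using val lin_closed[OF assms(5)]
      by (intro M'.add.finprod_cong) (auto simp: simp_implies_def lin_smult[OF assms(5)])
    also have "\<dots> = sm K V W M' t (\<lambda>a b. g (f a b))"
      using sm_eq_sw[OF assms(1,2) True assms(4), of "\<lambda>a b. g (f a b)"] gf
      by (simp add: sw_def x_def Let_def)
    finally show ?thesis .
  qed (use lin_zero[OF assms(3-5)] in \<open>simp add: sm_def\<close>)
qed

text \<open>The representative of t stays fixed while x varies, so the sum is one finite combination
  of maps that are linear in x.\<close>

lemma lin_sm_body [simp]: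
  assumes "module K V" "module K W" "module K M" "module K X"
    and f: "\<And>a b. a \<in> carrier V \<Longrightarrow> b \<in> carrier W \<Longrightarrow> lin K X M (\<lambda>x. f x a b)"
  shows "lin K X M (\<lambda>x. sm K V W M t (f x))"
proof -
  interpret M: module K M by fact
  interpret X: module K X by fact
  interpret tensor_pair K V W by (rule tensor_pairI) fact+
  show ?thesis
  proof (cases "t \<in> carrier (V \<boxtimes> W)")
    case True
    define r where "r = (SOME x. x \<in> t)"
    have fc: "a \<in> carrier V \<Longrightarrow> b \<in> carrier W \<Longrightarrow> x \<in> carrier X \<Longrightarrow> f x a b \<in> carrier M" for x a b
      using lin_closed[OF f] by blast
    have val: "r p \<odot>\<^bsub>M\<^esub> f x (fst p) (snd p) \<in> carrier M" "f x (fst p) (snd p) \<in> carrier M"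
      "r p \<in> carrier K" if "x \<in> carrier X" "r p \<noteq> \<zero>" for x p
      using support_val[where f="f x" and p=p, OF assms(1,2) True assms(3)] fc that
      unfolding r_def by blast+
    have eq: "sm K V W M t (f x) = (\<Oplus>\<^bsub>M\<^esub>p\<in>{p. r p \<noteq> \<zero>}. r p \<odot>\<^bsub>M\<^esub> f x (fst p) (snd p))"
      if "x \<in> carrier X" for x
      using sm_eq_sw[OF assms(1,2) True assms(3), of "f x"] fc that
      by (simp add: sw_def r_def Let_def)
    have fin: "finite {p. r p \<noteq> \<zero>}"
      unfolding r_def using tensor_rep[OF assms(1,2) True] by (rule free_space_finite)
    have f': "r p \<noteq> \<zero> \<Longrightarrow> lin K X M (\<lambda>x. f x (fst p) (snd p))" for p
      unfolding r_def using f support_closed[OF tensor_rep[OF assms(1,2) True]] by simp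
    show ?thesis
    proof (rule linI)
      show "sm K V W M t (f x) \<in> carrier M" if "x \<in> carrier X" for x
        using that fc assms by simp
      fix x assume x: "x \<in> carrier X"
      show "sm K V W M t (f (c \<odot>\<^bsub>X\<^esub> x)) = c \<odot>\<^bsub>M\<^esub> sm K V W M t (f x)" if c: "c \<in> carrier K" for c
      proof -
        have "(\<Oplus>\<^bsub>M\<^esub>p\<in>{p. r p \<noteq> \<zero>}. r p \<odot>\<^bsub>M\<^esub> f (c \<odot>\<^bsub>X\<^esub> x) (fst p) (snd p))
            = (\<Oplus>\<^bsub>M\<^esub>p\<in>{p. r p \<noteq> \<zero>}. c \<odot>\<^bsub>M\<^esub> (r p \<odot>\<^bsub>M\<^esub> f x (fst p) (snd p)))"
          using val x c
          by (intro M.add.finprod_cong)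
            (auto simp: simp_implies_def lin_smult[OF f'] M.smult_assoc1[symmetric] m_comm)
        also have "\<dots> = c \<odot>\<^bsub>M\<^esub> (\<Oplus>\<^bsub>M\<^esub>p\<in>{p. r p \<noteq> \<zero>}. r p \<odot>\<^bsub>M\<^esub> f x (fst p) (snd p))"
          using val x c fin by (intro M.finsum_smult_ldistr[symmetric]) auto
        finally show ?thesis using x c by (simp add: eq)
      qed
      fix y assume y: "y \<in> carrier X"
      have "(\<Oplus>\<^bsub>M\<^esub>p\<in>{p. r p \<noteq> \<zero>}. r p \<odot>\<^bsub>M\<^esub> f (x \<oplus>\<^bsub>X\<^esub> y) (fst p) (snd p))
          = (\<Oplus>\<^bsub>M\<^esub>p\<in>{p. r p \<noteq> \<zero>}. r p \<odot>\<^bsub>M\<^esub> f x (fst p) (snd p) \<oplus>\<^bsub>M\<^esub> r p \<odot>\<^bsub>M\<^esub> f y (fst p) (snd p))"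
        using val x y
        by (intro M.add.finprod_cong)
          (auto simp: simp_implies_def lin_add[OF f'] M.smult_r_distr)
      also have "\<dots> = (\<Oplus>\<^bsub>M\<^esub>p\<in>{p. r p \<noteq> \<zero>}. r p \<odot>\<^bsub>M\<^esub> f x (fst p) (snd p))
          \<oplus>\<^bsub>M\<^esub> (\<Oplus>\<^bsub>M\<^esub>p\<in>{p. r p \<noteq> \<zero>}. r p \<odot>\<^bsub>M\<^esub> f y (fst p) (snd p))"
        using val x y by (intro M.add.finprod_multf) auto
      finally show "sm K V W M t (f (x \<oplus>\<^bsub>X\<^esub> y)) = sm K V W M t (f x) \<oplus>\<^bsub>M\<^esub> sm K V W M t (f y)"
        using x y by (simp add: eq)
    qed
  next
    case False
    then show ?thesis by (intro linI) (simp_all add: sm_def)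
  qed
qed

lemma sm_lin:
  assumes "module K V" "module K W" "module K M"
    and "\<And>b. b \<in> carrier W \<Longrightarrow> lin K V M (\<lambda>a. f a b)"
    and "\<And>a. a \<in> carrier V \<Longrightarrow> lin K W M (f a)"
  shows "lin K (V \<boxtimes> W) M (\<lambda>t. sm K V W M t f)"
proof -
  interpret tensor_pair K V W by (rule tensor_pairI) fact+
  have fc: "a \<in> carrier V \<Longrightarrow> b \<in> carrier W \<Longrightarrow> f a b \<in> carrier M" for a b
    using assms(5) by (auto intro: lin_closed)
  have "lin K (V \<boxtimes> W) M (\<lambda>t. sw K M t f)"
    by (rule sw_lin) (use assms fc in auto)
  then show ?thesis
    by (rule lin_cong[rotated 2]) (use assms fc in \<open>simp_all add: sm_eq_sw\<close>)
qed

lemma sm_tens [simp]: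
  assumes "module K V" "module K W" "module K M" "a \<in> carrier V" "b \<in> carrier W"
    and "\<And>b. b \<in> carrier W \<Longrightarrow> lin K V M (\<lambda>a. f a b)"
    and "\<And>a. a \<in> carrier V \<Longrightarrow> lin K W M (f a)"
  shows "sm K V W M (tens K V W a b) f = f a b"
proof -
  interpret tensor_pair K V W by (rule tensor_pairI) fact+
  have fc: "a \<in> carrier V \<Longrightarrow> b \<in> carrier W \<Longrightarrow> f a b \<in> carrier M" for a b
    using assms(7) by (auto intro: lin_closed)
  show ?thesis
    by (subst sm_eq_sw) (use assms fc in \<open>auto intro!: sw_tens\<close>)
qed

lemma lin_comp: "lin K V W f \<Longrightarrow> lin K W M g \<Longrightarrow> lin K V M (\<lambda>x. g (f x))"
  by (simp add: lin_def)

text \<open>As a rewrite rule it flattens a Sweedler sum whose argument is again a Sweedler sum.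
  Together with \<open>sm_tens\<close> it brings nested expressions to a normal form with all
  summations outside.\<close>

lemma sm_sm [simp]:
  assumes "module K V" "module K W" "module K X" "module K Y" "module K M"
    and "\<And>b. b \<in> carrier W \<Longrightarrow> lin K V M (\<lambda>a. f a b)"
    and "\<And>a. a \<in> carrier V \<Longrightarrow> lin K W M (f a)"
    and "\<And>a b. a \<in> carrier X \<Longrightarrow> b \<in> carrier Y \<Longrightarrow> g a b \<in> carrier (V \<boxtimes> W)"
  shows "sm K V W M (sm K X Y (V \<boxtimes> W) t g) f = sm K X Y M t (\<lambda>x y. sm K V W M (g x y) f)"
  by (rule sm_apply[where g="\<lambda>t. sm K V W M t f"]) (use assms in \<open>auto intro: sm_lin\<close>)

lemma lin_id [simp]: "lin K V V (\<lambda>x. x)"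
  by (simp add: lin_def)

lemma lin_tens_l [simp]:
  assumes "module K V" "module K W" "lin K X V f" "w \<in> carrier W"
  shows "lin K X (V \<boxtimes> W) (\<lambda>x. tens K V W (f x) w)"
proof -
  interpret tensor_pair K V W by (rule tensor_pairI) fact+
  have "lin K V (V \<boxtimes> W) (\<lambda>x. tens K V W x w)"
    using assms by (intro linI) (simp_all add: tens_add_l tens_smult_l)
  then show ?thesis using assms(3) lin_comp by blast
qed

lemma lin_tens_r [simp]:
  assumes "module K V" "module K W" "lin K X W f" "v \<in> carrier V"
  shows "lin K X (V \<boxtimes> W) (\<lambda>x. tens K V W v (f x))"
proof -
  interpret tensor_pair K V W by (rule tensor_pairI) fact+
  have "lin K W (V \<boxtimes> W) (\<lambda>x. tens K V W v x)"
    using assms by (intro linI) (simp_all add: tens_add_r tens_smult_r)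
  then show ?thesis using assms(3) lin_comp by blast
qed

lemma lin_sm [simp]:
  assumes "module K V" "module K W" "module K M" "lin K X (V \<boxtimes> W) t"
    and "\<And>b. b \<in> carrier W \<Longrightarrow> lin K V M (\<lambda>a. f a b)"
    and "\<And>a. a \<in> carrier V \<Longrightarrow> lin K W M (f a)"
  shows "lin K X M (\<lambda>x. sm K V W M (t x) f)"
  by (rule lin_comp[OF assms(4)]) (use assms in \<open>auto intro: sm_lin\<close>)

lemma lin_smult_scalar [simp]:
  assumes "module K M" "c \<in> carrier K" "lin K X M f"
  shows "lin K X M (\<lambda>x. c \<odot>\<^bsub>M\<^esub> f x)"
proof -
  interpret M: module K M by fact
  have "lin K M M (\<lambda>x. c \<odot>\<^bsub>M\<^esub> x)"
    using assms by (intro linI) (simp_all add: M.smult_r_distr M.smult_assoc1[symmetric] m_comm)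
  then show ?thesis using assms(3) lin_comp by blast
qed

lemma ground_algebra_sel [simp]:
  "carrier (ground_algebra K) = carrier K" "add (ground_algebra K) = add K"
  "mult (ground_algebra K) = mult K" "one (ground_algebra K) = one K"
  "smult (ground_algebra K) = mult K" "zero (ground_algebra K) = zero K"
  by (simp_all add: ground_algebra_def)

lemma lin_smult_vector [simp]:
  assumes "module K M" "m \<in> carrier M" "lin K X (ground_algebra K) f"
  shows "lin K X M (\<lambda>x. f x \<odot>\<^bsub>M\<^esub> m)"
proof -
  interpret M: module K M by fact
  have "lin K (ground_algebra K) M (\<lambda>x. x \<odot>\<^bsub>M\<^esub> m)"
    using assms by (intro linI) (simp_all add: M.smult_l_distr M.smult_assoc1)
  then show ?thesis using assms(3) lin_comp by blast
qed

lemma sm_tens_l [simp]: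
  assumes "module K V" "module K W" "module K X" "module K Y" "w \<in> carrier W"
    and "\<And>a b. a \<in> carrier X \<Longrightarrow> b \<in> carrier Y \<Longrightarrow> g a b \<in> carrier V"
  shows "tens K V W (sm K X Y V t g) w = sm K X Y (V \<boxtimes> W) t (\<lambda>a b. tens K V W (g a b) w)"
  by (rule sm_apply[where g="\<lambda>t. tens K V W t w"]) (use assms in auto)

lemma sm_tens_r [simp]:
  assumes "module K V" "module K W" "module K X" "module K Y" "v \<in> carrier V"
    and "\<And>a b. a \<in> carrier X \<Longrightarrow> b \<in> carrier Y \<Longrightarrow> g a b \<in> carrier W"
  shows "tens K V W v (sm K X Y W t g) = sm K X Y (V \<boxtimes> W) t (\<lambda>a b. tens K V W v (g a b))"
  by (rule sm_apply[where g="\<lambda>t. tens K V W v t"]) (use assms in auto)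

lemma smult_out [simp]:
  assumes "module K X" "module K Y" "module K M" "c \<in> carrier K"
    and "\<And>a b. a \<in> carrier X \<Longrightarrow> b \<in> carrier Y \<Longrightarrow> g a b \<in> carrier M"
  shows "sm K X Y M t (\<lambda>a b. c \<odot>\<^bsub>M\<^esub> g a b) = c \<odot>\<^bsub>M\<^esub> sm K X Y M t g"
  by (rule sm_apply[where g="\<lambda>t. c \<odot>\<^bsub>M\<^esub> t", symmetric]) (use assms in auto)

lemma sm_smult_arg [simp]:
  assumes "module K V" "module K W" "module K M" "c \<in> carrier K" "t \<in> carrier (V \<boxtimes> W)"
    and "\<And>b. b \<in> carrier W \<Longrightarrow> lin K V M (\<lambda>a. f a b)"
    and "\<And>a. a \<in> carrier V \<Longrightarrow> lin K W M (f a)"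
  shows "sm K V W M (c \<odot>\<^bsub>V \<boxtimes> W\<^esub> t) f = c \<odot>\<^bsub>M\<^esub> sm K V W M t f"
  by (rule lin_smult[where f="\<lambda>t. sm K V W M t f", OF sm_lin]) (use assms in simp_all)

lemma smult_smult [simp]:
  "module K M \<Longrightarrow> c \<in> carrier K \<Longrightarrow> d \<in> carrier K \<Longrightarrow> x \<in> carrier M
    \<Longrightarrow> (c \<otimes> d) \<odot>\<^bsub>M\<^esub> x = c \<odot>\<^bsub>M\<^esub> (d \<odot>\<^bsub>M\<^esub> x)"
  "module K M \<Longrightarrow> x \<in> carrier M \<Longrightarrow> \<one> \<odot>\<^bsub>M\<^esub> x = x"
  by (simp_all add: module.smult_assoc1 module.smult_one)

text \<open>The uniqueness half of the universal property. Read as a rule for an equation in t, it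
  is what permits replacing t by a pure tensor; f and g are found by abstracting the goal over
  t.\<close>

lemma tensor_ext:
  assumes "module K V" "module K W" "module K M"
    and "lin K (V \<boxtimes> W) M f" "lin K (V \<boxtimes> W) M g"
    and "\<And>v w. v \<in> carrier V \<Longrightarrow> w \<in> carrier W \<Longrightarrow> f (tens K V W v w) = g (tens K V W v w)"
    and "t \<in> carrier (V \<boxtimes> W)"
  shows "f t = g t"
proof -
  interpret tensor_pair K V W by (rule tensor_pairI) fact+
  note T = tensor_space_module
  show ?thesis
    using assms(7)
  proof (induction t rule: tensor_induct)
    case zero
    then show ?case
      using lin_zero[OF T assms(3,4)] lin_zero[OF T assms(3,5)] by simp
  next
    case (add s v w)
    then show ?case
      using assms(6) by (simp add: lin_add[OF assms(4)] lin_add[OF assms(5)] tens_closed)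
  qed
qed

lemma tensor_ext3:
  assumes "module K V" "module K W" "module K X" "module K M"
    and "lin K (V \<boxtimes> W \<boxtimes> X) M f"
    and "lin K (V \<boxtimes> W \<boxtimes> X) M g"
    and "\<And>v w x. v \<in> carrier V \<Longrightarrow> w \<in> carrier W \<Longrightarrow> x \<in> carrier X
      \<Longrightarrow> f (tens K V (W \<boxtimes> X) v (tens K W X w x))
        = g (tens K V (W \<boxtimes> X) v (tens K W X w x))"
    and "t \<in> carrier (V \<boxtimes> W \<boxtimes> X)"
  shows "f t = g t"
proof (rule tensor_ext[OF _ _ _ assms(5,6) _ assms(8)])
  fix v s assume v: "v \<in> carrier V" and s: "s \<in> carrier (W \<boxtimes> X)"
  have "lin K (W \<boxtimes> X) (V \<boxtimes> W \<boxtimes> X)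
      (\<lambda>s. tens K V (W \<boxtimes> X) v s)"
    using assms v by simp
  from lin_comp[OF this assms(5)] lin_comp[OF this assms(6)]
  show "f (tens K V (W \<boxtimes> X) v s) = g (tens K V (W \<boxtimes> X) v s)"
    by (rule tensor_ext[OF assms(2-4) _ _ _ s]) (use assms v in auto)
qed (use assms in auto)

lemma sm_eta [simp]:
  assumes "module K V" "module K W" "t \<in> carrier (V \<boxtimes> W)"
  shows "sm K V W (V \<boxtimes> W) t (tens K V W) = t"
  by (rule tensor_ext[where f="\<lambda>t. sm K V W (V \<boxtimes> W) t (\<lambda>a b. tens K V W a b)" and
      g="\<lambda>t. t" and M="V \<boxtimes> W", OF assms(1,2)])
    (use assms in simp_all)

end

section \<open>Tensor products of algebras\<close>

sublocale nonassoc_algebra \<subseteq> ground_field K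
  by unfold_locales

context nonassoc_algebra
begin

declare nonassoc_algebra_axioms [simp] module_axioms [simp] A_one_closed [simp]

lemma mult_lin:
  shows "y \<in> carrier A \<Longrightarrow> lin K A A (\<lambda>x. x \<otimes>\<^bsub>A\<^esub> y)" "x \<in> carrier A \<Longrightarrow> lin K A A (\<lambda>y. x \<otimes>\<^bsub>A\<^esub> y)"
  by (simp_all add: linI A_mult_closed A_l_distr A_r_distr A_smult_l A_smult_r)

end

declare (in k_algebra) k_algebra_axioms [simp]

context ground_field
begin

lemma nonassoc_algebra_module: "nonassoc_algebra K A \<Longrightarrow> module K A"
  by (simp add: nonassoc_algebra_def)

lemma k_algebra_nonassoc [simp]: "k_algebra K A \<Longrightarrow> nonassoc_algebra K A"
  by (simp add: k_algebra_def)

lemma k_algebra_module [simp]: "k_algebra K A \<Longrightarrow> module K A"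
  by (simp add: k_algebra_def nonassoc_algebra_def)

text \<open>The premise \<open>space A = space M\<close>, here and in the following rules, is due to
  the normal form: the carrier of an algebra has already been rewritten to that of its underlying
  space, while unit and product still mention the algebra.\<close>

lemma one_in [simp]: "nonassoc_algebra K A \<Longrightarrow> space A = space M \<Longrightarrow> \<one>\<^bsub>A\<^esub> \<in> carrier M"
  using nonassoc_algebra.A_one_closed[of K A] space_rules(1)[of A M] by simp

lemma mult_in [simp]:
  "nonassoc_algebra K A \<Longrightarrow> space A = space M \<Longrightarrow> x \<in> carrier M \<Longrightarrow> y \<in> carrier M
    \<Longrightarrow> x \<otimes>\<^bsub>A\<^esub> y \<in> carrier M"
  using nonassoc_algebra.A_mult_closed[of K A x y] space_rules(1)[of A M] by simp

lemma one_mult [simp]: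
  "nonassoc_algebra K A \<Longrightarrow> x \<in> carrier A \<Longrightarrow> \<one>\<^bsub>A\<^esub> \<otimes>\<^bsub>A\<^esub> x = x"
  "nonassoc_algebra K A \<Longrightarrow> x \<in> carrier A \<Longrightarrow> x \<otimes>\<^bsub>A\<^esub> \<one>\<^bsub>A\<^esub> = x"
  using nonassoc_algebra.A_l_one[of K A x] nonassoc_algebra.A_r_one[of K A x] by simp_all

lemma lin_mult_l [simp]:
  assumes "nonassoc_algebra K A" "space A = space M" "lin K X M f" "y \<in> carrier M"
  shows "lin K X M (\<lambda>x. f x \<otimes>\<^bsub>A\<^esub> y)"
proof (rule lin_comp[OF assms(3)])
  show "lin K M M (\<lambda>x. x \<otimes>\<^bsub>A\<^esub> y)"
    using nonassoc_algebra.mult_lin(1)[OF assms(1), of y] assms(4) space_rules(1)[OF assms(2)]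
      lin_space[OF assms(2,2), of K] by simp
qed

lemma lin_mult_r [simp]:
  assumes "nonassoc_algebra K A" "space A = space M" "lin K X M f" "y \<in> carrier M"
  shows "lin K X M (\<lambda>x. y \<otimes>\<^bsub>A\<^esub> f x)"
proof (rule lin_comp[OF assms(3)])
  show "lin K M M (\<lambda>x. y \<otimes>\<^bsub>A\<^esub> x)"
    using nonassoc_algebra.mult_lin(2)[OF assms(1), of y] assms(4) space_rules(1)[OF assms(2)]
      lin_space[OF assms(2,2), of K] by simp
qed

lemma sm_mult_l [simp]:
  assumes "nonassoc_algebra K A" "space A = space M" "module K X" "module K Y" "c \<in> carrier M"
    and "\<And>a b. a \<in> carrier X \<Longrightarrow> b \<in> carrier Y \<Longrightarrow> g a b \<in> carrier M"
  shows "sm K X Y M t g \<otimes>\<^bsub>A\<^esub> c = sm K X Y M t (\<lambda>a b. g a b \<otimes>\<^bsub>A\<^esub> c)"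
  using nonassoc_algebra_module[OF assms(1)] module_space[OF assms(2)]
  by (intro sm_apply[where g="\<lambda>t. t \<otimes>\<^bsub>A\<^esub> c"]) (use assms in auto)

lemma sm_mult_r [simp]:
  assumes "nonassoc_algebra K A" "space A = space M" "module K X" "module K Y" "c \<in> carrier M"
    and "\<And>a b. a \<in> carrier X \<Longrightarrow> b \<in> carrier Y \<Longrightarrow> g a b \<in> carrier M"
  shows "c \<otimes>\<^bsub>A\<^esub> sm K X Y M t g = sm K X Y M t (\<lambda>a b. c \<otimes>\<^bsub>A\<^esub> g a b)"
  using nonassoc_algebra_module[OF assms(1)] module_space[OF assms(2)]
  by (intro sm_apply[where g="\<lambda>t. c \<otimes>\<^bsub>A\<^esub> t"]) (use assms in auto)

lemma smult_in [simp]: "module K M \<Longrightarrow> c \<in> carrier K \<Longrightarrow> x \<in> carrier M \<Longrightarrow> c \<odot>\<^bsub>M\<^esub> x \<in> carrier M"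
  by (rule module.smult_closed)

lemma smult_pull [simp]:
  "module K V \<Longrightarrow> module K W \<Longrightarrow> c \<in> carrier K \<Longrightarrow> v \<in> carrier V \<Longrightarrow> w \<in> carrier W
    \<Longrightarrow> tens K V W (c \<odot>\<^bsub>V\<^esub> v) w = c \<odot>\<^bsub>V \<boxtimes> W\<^esub> tens K V W v w"
  "module K V \<Longrightarrow> module K W \<Longrightarrow> c \<in> carrier K \<Longrightarrow> v \<in> carrier V \<Longrightarrow> w \<in> carrier W
    \<Longrightarrow> tens K V W v (c \<odot>\<^bsub>W\<^esub> w) = c \<odot>\<^bsub>V \<boxtimes> W\<^esub> tens K V W v w"
  using lin_smult[of K V "V \<boxtimes> W" "\<lambda>v. tens K V W v w" c v]
    lin_smult[of K W "V \<boxtimes> W" "\<lambda>w. tens K V W v w" c w]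
  by simp_all

lemma smult_pull_mult [simp]:
  "nonassoc_algebra K A \<Longrightarrow> space A = space M \<Longrightarrow> c \<in> carrier K \<Longrightarrow> x \<in> carrier M \<Longrightarrow> y \<in> carrier M
    \<Longrightarrow> (c \<odot>\<^bsub>M\<^esub> x) \<otimes>\<^bsub>A\<^esub> y = c \<odot>\<^bsub>M\<^esub> (x \<otimes>\<^bsub>A\<^esub> y)"
  "nonassoc_algebra K A \<Longrightarrow> space A = space M \<Longrightarrow> c \<in> carrier K \<Longrightarrow> x \<in> carrier M \<Longrightarrow> y \<in> carrier M
    \<Longrightarrow> x \<otimes>\<^bsub>A\<^esub> (c \<odot>\<^bsub>M\<^esub> y) = c \<odot>\<^bsub>M\<^esub> (x \<otimes>\<^bsub>A\<^esub> y)"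
  using nonassoc_algebra.A_smult_l[of K A c x y] nonassoc_algebra.A_smult_r[of K A c x y]
  by (simp_all add: space_eq_iff)

text \<open>Both bracketings are linear in each of the three factors, so it suffices to compare them
  on pure tensors. The factors are freed one at a time, from the last to the first.\<close>

lemma k_algebraI:
  assumes space: "space S = V \<boxtimes> W" and VW: "module K V" "module K W"
    and lin: "\<And>t. t \<in> carrier (V \<boxtimes> W)
        \<Longrightarrow> lin K (V \<boxtimes> W) (V \<boxtimes> W) (\<lambda>s. s \<otimes>\<^bsub>S\<^esub> t)"
      "\<And>s. s \<in> carrier (V \<boxtimes> W)
        \<Longrightarrow> lin K (V \<boxtimes> W) (V \<boxtimes> W) (\<lambda>t. s \<otimes>\<^bsub>S\<^esub> t)"
    and one: "\<one>\<^bsub>S\<^esub> \<in> carrier (V \<boxtimes> W)"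
      "\<And>v w. v \<in> carrier V \<Longrightarrow> w \<in> carrier W \<Longrightarrow> \<one>\<^bsub>S\<^esub> \<otimes>\<^bsub>S\<^esub> tens K V W v w = tens K V W v w"
      "\<And>v w. v \<in> carrier V \<Longrightarrow> w \<in> carrier W \<Longrightarrow> tens K V W v w \<otimes>\<^bsub>S\<^esub> \<one>\<^bsub>S\<^esub> = tens K V W v w"
    and assoc: "\<And>v w v' w' v'' w''. v \<in> carrier V \<Longrightarrow> w \<in> carrier W \<Longrightarrow> v' \<in> carrier V
        \<Longrightarrow> w' \<in> carrier W \<Longrightarrow> v'' \<in> carrier V \<Longrightarrow> w'' \<in> carrier W
        \<Longrightarrow> tens K V W v w \<otimes>\<^bsub>S\<^esub> tens K V W v' w' \<otimes>\<^bsub>S\<^esub> tens K V W v'' w''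
          = tens K V W v w \<otimes>\<^bsub>S\<^esub> (tens K V W v' w' \<otimes>\<^bsub>S\<^esub> tens K V W v'' w'')"
  shows "k_algebra K S"
proof -
  let ?T = "V \<boxtimes> W"
  have sel: "carrier S = carrier ?T" "add S = add ?T" "smult S = smult ?T"
    using space space_eq_iff[of S ?T] by simp_all
  have T: "module K ?T" using VW by simp
  have S: "module K S" using T space module_space[of S ?T K] by simp
  note closed = lin_closed[OF lin(1)]
  have assoc': "x \<otimes>\<^bsub>S\<^esub> y \<otimes>\<^bsub>S\<^esub> z = x \<otimes>\<^bsub>S\<^esub> (y \<otimes>\<^bsub>S\<^esub> z)"
    if x: "x \<in> carrier ?T" and y: "y \<in> carrier ?T" and z: "z \<in> carrier ?T" for x y z
  proof -
    note [intro] = closed lin(2)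
    note ext = tensor_ext[OF VW T]
    have 1: "tens K V W v w \<otimes>\<^bsub>S\<^esub> tens K V W v' w' \<otimes>\<^bsub>S\<^esub> z
        = tens K V W v w \<otimes>\<^bsub>S\<^esub> (tens K V W v' w' \<otimes>\<^bsub>S\<^esub> z)"
      if "v \<in> carrier V" "w \<in> carrier W" "v' \<in> carrier V" "w' \<in> carrier W" for v w v' w'
      by (rule ext[where f="\<lambda>z. tens K V W v w \<otimes>\<^bsub>S\<^esub> tens K V W v' w' \<otimes>\<^bsub>S\<^esub> z",
            OF lin(2) lin_comp[OF lin(2) lin(2)] assoc z])
        (use that VW in \<open>simp_all add: closed\<close>)
    have 2: "tens K V W v w \<otimes>\<^bsub>S\<^esub> y \<otimes>\<^bsub>S\<^esub> z = tens K V W v w \<otimes>\<^bsub>S\<^esub> (y \<otimes>\<^bsub>S\<^esub> z)"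
      if "v \<in> carrier V" "w \<in> carrier W" for v w
      by (rule ext[where f="\<lambda>y. tens K V W v w \<otimes>\<^bsub>S\<^esub> y \<otimes>\<^bsub>S\<^esub> z",
            OF lin_comp[OF lin(2) lin(1)] lin_comp[OF lin(1) lin(2)] 1 y])
        (use that VW z in \<open>simp_all add: closed\<close>)
    show ?thesis
      by (rule ext[where f="\<lambda>x. x \<otimes>\<^bsub>S\<^esub> y \<otimes>\<^bsub>S\<^esub> z",
            OF lin_comp[OF lin(1) lin(1)] lin(1) 2 x])
        (use that VW y z in \<open>simp_all add: closed\<close>)
  qed
  have one': "\<one>\<^bsub>S\<^esub> \<otimes>\<^bsub>S\<^esub> x = x" "x \<otimes>\<^bsub>S\<^esub> \<one>\<^bsub>S\<^esub> = x" if "x \<in> carrier ?T" for x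
    by (rule tensor_ext[OF VW T lin(2)[OF one(1)] lin_id one(2) that]
        tensor_ext[OF VW T lin(1)[OF one(1)] lin_id one(3) that]; assumption)+
  show ?thesis
    by (intro k_algebra.intro nonassoc_algebra.intro nonassoc_algebra_axioms.intro
        k_algebra_axioms.intro field_axioms S; unfold sel)
      (simp_all add: closed one one' lin_add[OF lin(1)] lin_add[OF lin(2)] lin_smult[OF lin(1)]
        lin_smult[OF lin(2)] assoc')
qed

lemma one_tensor [simp]: "\<one>\<^bsub>A \<star> B\<^esub> = tens K A B \<one>\<^bsub>A\<^esub> \<one>\<^bsub>B\<^esub>"
  by (simp add: tensor_def Let_def)

lemma tensor_mult:
  assumes A: "nonassoc_algebra K A" and B: "nonassoc_algebra K B"
    and "s \<in> carrier (A \<boxtimes> B)" "t \<in> carrier (A \<boxtimes> B)"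
  shows "s \<otimes>\<^bsub>A \<star> B\<^esub> t = sm K A B (A \<boxtimes> B) s (\<lambda>a b.
    sm K A B (A \<boxtimes> B) t (\<lambda>a' b'. tens K A B (a \<otimes>\<^bsub>A\<^esub> a') (b \<otimes>\<^bsub>B\<^esub> b')))"
proof -
  note [simp] = A B nonassoc_algebra_module[OF A] nonassoc_algebra_module[OF B]
  have "s \<otimes>\<^bsub>A \<star> B\<^esub> t = sw K (A \<boxtimes> B) s (\<lambda>a b.
    sw K (A \<boxtimes> B) t (\<lambda>a' b'. tens K A B (a \<otimes>\<^bsub>A\<^esub> a') (b \<otimes>\<^bsub>B\<^esub> b')))"
    by (simp add: tensor_def Let_def)
  also have "\<dots> = sm K A B (A \<boxtimes> B) s (\<lambda>a b.
    sm K A B (A \<boxtimes> B) t (\<lambda>a' b'. tens K A B (a \<otimes>\<^bsub>A\<^esub> a') (b \<otimes>\<^bsub>B\<^esub> b')))"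
    using assms(3,4) by (intro sw_eq_sm) simp_all
  finally show ?thesis .
qed

lemma tensor_mult_tens [simp]:
  assumes "nonassoc_algebra K A" "nonassoc_algebra K B" "space A = space V" "space B = space W"
    and "a \<in> carrier V" "b \<in> carrier W" "a' \<in> carrier V" "b' \<in> carrier W"
  shows "tens K V W a b \<otimes>\<^bsub>A \<star> B\<^esub> tens K V W a' b' = tens K V W (a \<otimes>\<^bsub>A\<^esub> a') (b \<otimes>\<^bsub>B\<^esub> b')"
proof -
  have VW: "tens K V W = tens K A B" "carrier V = carrier A" "carrier W = carrier B"
    using assms(3,4) tens_space[of V A W B K] space_rules(1)[of V A] space_rules(1)[of W B]
    by auto
  show ?thesis
    using assms(1,2,5-) nonassoc_algebra_module[OF assms(1)] nonassoc_algebra_module[OF assms(2)]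
    unfolding VW by (simp add: tensor_mult)
qed

lemma tensor_k_algebra [simp]:
  assumes A: "k_algebra K A" and B: "k_algebra K B"
  shows "k_algebra K (A \<star> B)"
proof -
  let ?T = "A \<boxtimes> B"
  note [simp] = A B
  have lin1: "lin K ?T ?T (\<lambda>s. s \<otimes>\<^bsub>A \<star> B\<^esub> t)" if "t \<in> carrier ?T" for t
    by (rule lin_cong[where g="\<lambda>s. sm K A B ?T s (\<lambda>a b.
        sm K A B ?T t (\<lambda>a' b'. tens K A B (a \<otimes>\<^bsub>A\<^esub> a') (b \<otimes>\<^bsub>B\<^esub> b')))"])
      (simp_all add: tensor_mult that)
  have lin2: "lin K ?T ?T (\<lambda>t. s \<otimes>\<^bsub>A \<star> B\<^esub> t)" if "s \<in> carrier ?T" for s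
    by (rule lin_cong[where g="\<lambda>t. sm K A B ?T s (\<lambda>a b.
        sm K A B ?T t (\<lambda>a' b'. tens K A B (a \<otimes>\<^bsub>A\<^esub> a') (b \<otimes>\<^bsub>B\<^esub> b')))"])
      (simp_all add: tensor_mult that)
  show ?thesis
    by (rule k_algebraI[of _ A B, OF _ _ _ lin1 lin2])
      (simp_all add: k_algebra.A_assoc[OF A] k_algebra.A_assoc[OF B])
qed

lemma alg_hom_lin: "alg_hom K A B f \<Longrightarrow> k_algebra K A \<Longrightarrow> lin K A B f"
  by (auto simp: alg_hom_def ring_hom_def lin_def)

lemma alg_hom_mult:
  "alg_hom K A B f \<Longrightarrow> x \<in> carrier A \<Longrightarrow> y \<in> carrier A \<Longrightarrow> f (x \<otimes>\<^bsub>A\<^esub> y) = f x \<otimes>\<^bsub>B\<^esub> f y"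
  and alg_hom_one: "alg_hom K A B f \<Longrightarrow> f \<one>\<^bsub>A\<^esub> = \<one>\<^bsub>B\<^esub>"
  by (auto simp: alg_hom_def ring_hom_def)

lemma alg_hom_lin_comp:
  "alg_hom K A B F \<Longrightarrow> k_algebra K A \<Longrightarrow> lin K X A f \<Longrightarrow> lin K X B (\<lambda>x. F (f x))"
  by (rule lin_comp[OF _ alg_hom_lin])

lemma alg_hom_in: "alg_hom K A B F \<Longrightarrow> k_algebra K A \<Longrightarrow> x \<in> carrier A \<Longrightarrow> F x \<in> carrier B"
  by (rule lin_closed[OF alg_hom_lin])

lemma alg_homI:
  "lin K A B f \<Longrightarrow> (\<And>x y. x \<in> carrier A \<Longrightarrow> y \<in> carrier A \<Longrightarrow> f (x \<otimes>\<^bsub>A\<^esub> y) = f x \<otimes>\<^bsub>B\<^esub> f y)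
    \<Longrightarrow> f \<one>\<^bsub>A\<^esub> = \<one>\<^bsub>B\<^esub> \<Longrightarrow> alg_hom K A B f"
  by (auto simp: alg_hom_def ring_hom_def lin_def)

lemma alg_hom_tensorI:
  assumes S: "k_algebra K S" and M: "k_algebra K M" and space: "space S = V \<boxtimes> W"
    and VW: "module K V" "module K W"
    and lin: "lin K (V \<boxtimes> W) M f"
    and pure: "\<And>v w v' w'. v \<in> carrier V \<Longrightarrow> w \<in> carrier W \<Longrightarrow> v' \<in> carrier V \<Longrightarrow> w' \<in> carrier W
        \<Longrightarrow> f (tens K V W v w \<otimes>\<^bsub>S\<^esub> tens K V W v' w') = f (tens K V W v w) \<otimes>\<^bsub>M\<^esub> f (tens K V W v' w')"
    and one: "f \<one>\<^bsub>S\<^esub> = \<one>\<^bsub>M\<^esub>"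
  shows "alg_hom K S M f"
proof (rule alg_homI)
  let ?T = "V \<boxtimes> W"
  have sp': "space S = space ?T" "space ?T = space S" using space by simp_all
  note [simp] = S M VW lin lin_closed[OF lin] lin_comp[OF _ lin] sp'
  show "lin K S M f" by (rule iffD2[OF lin_space[OF sp'(1) refl] lin])
  fix x y assume xy: "x \<in> carrier S" "y \<in> carrier S"
  then have x: "x \<in> carrier ?T" and y: "y \<in> carrier ?T"
    using space_rules(1)[OF sp'(1)] by simp_all
  have "f (x \<otimes>\<^bsub>S\<^esub> y) = f x \<otimes>\<^bsub>M\<^esub> f y" if "v \<in> carrier V" "w \<in> carrier W" "x = tens K V W v w" for v w x
    by (rule tensor_ext[OF VW _ _ _ _ y, of M "\<lambda>y. f (x \<otimes>\<^bsub>S\<^esub> y)"]) (use that pure in simp_all)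
  then show "f (x \<otimes>\<^bsub>S\<^esub> y) = f x \<otimes>\<^bsub>M\<^esub> f y"
    by (intro tensor_ext[OF VW _ _ _ _ x, of M "\<lambda>x. f (x \<otimes>\<^bsub>S\<^esub> y)"]) (use y in simp_all)
qed (rule one)

lemma alg_hom_tensor3I:
  assumes S: "k_algebra K S" and M: "k_algebra K M"
    and space: "space S = V \<boxtimes> W \<boxtimes> X"
    and VW: "module K V" "module K W" "module K X"
    and lin: "lin K (V \<boxtimes> W \<boxtimes> X) M f"
    and pure: "\<And>v w x v' w' x'. v \<in> carrier V \<Longrightarrow> w \<in> carrier W \<Longrightarrow> x \<in> carrier X
        \<Longrightarrow> v' \<in> carrier V \<Longrightarrow> w' \<in> carrier W \<Longrightarrow> x' \<in> carrier X
        \<Longrightarrow> f (tens K V (W \<boxtimes> X) v (tens K W X w x) \<otimes>\<^bsub>S\<^esub>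
              tens K V (W \<boxtimes> X) v' (tens K W X w' x'))
          = f (tens K V (W \<boxtimes> X) v (tens K W X w x))
            \<otimes>\<^bsub>M\<^esub> f (tens K V (W \<boxtimes> X) v' (tens K W X w' x'))"
    and one: "f \<one>\<^bsub>S\<^esub> = \<one>\<^bsub>M\<^esub>"
  shows "alg_hom K S M f"
proof (rule alg_homI)
  let ?T = "V \<boxtimes> W \<boxtimes> X"
  have sp': "space S = space ?T" "space ?T = space S" using space by simp_all
  note [simp] = S M VW lin lin_closed[OF lin] lin_comp[OF _ lin] sp'
  show "lin K S M f" by (rule iffD2[OF lin_space[OF sp'(1) refl] lin])
  fix x y assume xy: "x \<in> carrier S" "y \<in> carrier S"
  then have x: "x \<in> carrier ?T" and y: "y \<in> carrier ?T"
    using space_rules(1)[OF sp'(1)] by simp_all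
  have "f (x \<otimes>\<^bsub>S\<^esub> y) = f x \<otimes>\<^bsub>M\<^esub> f y"
    if "v \<in> carrier V" "w \<in> carrier W" "z \<in> carrier X"
      "x = tens K V (W \<boxtimes> X) v (tens K W X w z)" for v w x z
    by (rule tensor_ext3[OF VW _ _ _ _ y, of M "\<lambda>y. f (x \<otimes>\<^bsub>S\<^esub> y)"]) (use that pure in simp_all)
  then show "f (x \<otimes>\<^bsub>S\<^esub> y) = f x \<otimes>\<^bsub>M\<^esub> f y"
    by (intro tensor_ext3[OF VW _ _ _ _ x, of M "\<lambda>x. f (x \<otimes>\<^bsub>S\<^esub> y)"]) (use y in simp_all)
qed (rule one)

lemma k_algebra_monoid: "k_algebra K A \<Longrightarrow> monoid A"
  by (intro monoidI) (simp_all add: k_algebra.A_assoc)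

text \<open>Applied to the maps \<open>map3_1\<close>, \<open>map3_2\<close>, \<open>map3_3\<close>,
  \<open>unit_left\<close> and \<open>unit_right\<close>, it shows that all factors of a pentagon
  are invertible and that their inverses are the images of the inverse reassociators.\<close>

lemma alg_hom_Units:
  assumes "alg_hom K A B f" "k_algebra K A" "k_algebra K B" "x \<in> Units A"
  shows "f x \<in> Units B" "inv\<^bsub>B\<^esub> (f x) = f (inv\<^bsub>A\<^esub> x)"
proof -
  interpret A: monoid A by (rule k_algebra_monoid) fact
  interpret B: monoid B by (rule k_algebra_monoid) fact
  note l = lin_closed[OF alg_hom_lin[OF assms(1,2)]]
  have "f x \<otimes>\<^bsub>B\<^esub> f (inv\<^bsub>A\<^esub> x) = \<one>\<^bsub>B\<^esub>" "f (inv\<^bsub>A\<^esub> x) \<otimes>\<^bsub>B\<^esub> f x = \<one>\<^bsub>B\<^esub>"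
    using assms(4) by (simp_all flip: alg_hom_mult[OF assms(1)] add: alg_hom_one[OF assms(1)] A.Units_closed)
  moreover have "f x \<in> carrier B" "f (inv\<^bsub>A\<^esub> x) \<in> carrier B"
    using assms(4) by (simp_all add: l A.Units_closed)
  ultimately show "f x \<in> Units B" "inv\<^bsub>B\<^esub> (f x) = f (inv\<^bsub>A\<^esub> x)"
    using B.inv_char[of "f x" "f (inv\<^bsub>A\<^esub> x)"] by (auto simp: Units_def)
qed

lemma tuple_defs [simp]:
  "tensor3 K A B C = A \<star> B \<star> C"
  "tens3 K A B C = (\<lambda>a b c. tens K A (B \<star> C) a (tens K B C b c))"
  "tensor4 K A B C D = A \<star> B \<star> C \<star> D"
  "tens4 K A B C D = (\<lambda>a b c d. tens K A (B \<star> C \<star> D) a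
    (tens K B (C \<star> D) b (tens K C D c d)))"
  "sw3 K M t f = sw K M t (\<lambda>x s. sw K M s (\<lambda>y z. f x y z))"
  by (simp_all add: tensor3_def tens3_def tensor4_def tens4_def sw3_def fun_eq_iff)

lemma map2_1_sm:
  assumes "module K X" "module K A" "module K B" "module K C" "lin K X (A \<boxtimes> B) f"
    and "t \<in> carrier (X \<boxtimes> C)"
  shows "map2_1 K A B C f t = sm K X C (A \<boxtimes> B \<boxtimes> C) t (\<lambda>x y.
    sm K A B (A \<boxtimes> B \<boxtimes> C) (f x) (\<lambda>a b.
      tens K A (B \<boxtimes> C) a (tens K B C b y)))"
  unfolding map2_1_def tuple_defs unfolding tensor_to_space
  using assms lin_closed[OF assms(5)]
  by (intro sw_eq_sm) simp_all

lemma map2_2_sm: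
  assumes "module K X" "module K A" "module K B" "module K C" "lin K X (B \<boxtimes> C) f"
    and "t \<in> carrier (A \<boxtimes> X)"
  shows "map2_2 K A B C f t = sm K A X (A \<boxtimes> B \<boxtimes> C) t (\<lambda>x y.
    sm K B C (A \<boxtimes> B \<boxtimes> C) (f y) (\<lambda>a b.
      tens K A (B \<boxtimes> C) x (tens K B C a b)))"
  unfolding map2_2_def tuple_defs unfolding tensor_to_space
  using assms lin_closed[OF assms(5)]
  by (intro sw_eq_sm) simp_all

lemma map3_1_sm:
  assumes "module K X" "module K A" "module K B" "module K C" "module K D"
    and "lin K X (A \<boxtimes> B) f"
    and "t \<in> carrier (X \<boxtimes> C \<boxtimes> D)"
  defines "T \<equiv> A \<boxtimes> B \<boxtimes> C \<boxtimes> D"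
  shows "map3_1 K A B C D f t = sm K X (C \<boxtimes> D) T t (\<lambda>x s. sm K C D T s (\<lambda>y z.
    sm K A B T (f x) (\<lambda>a b.
      tens K A (B \<boxtimes> C \<boxtimes> D) a
        (tens K B (C \<boxtimes> D) b (tens K C D y z)))))"
  unfolding map3_1_def T_def tuple_defs unfolding tensor_to_space
  using assms(1-7) lin_closed[OF assms(6)]
  by (intro sw_eq_sm) simp_all

lemma map3_2_sm:
  assumes "module K X" "module K A" "module K B" "module K C" "module K D"
    and "lin K X (B \<boxtimes> C) f"
    and "t \<in> carrier (A \<boxtimes> X \<boxtimes> D)"
  defines "T \<equiv> A \<boxtimes> B \<boxtimes> C \<boxtimes> D"
  shows "map3_2 K A B C D f t = sm K A (X \<boxtimes> D) T t (\<lambda>x s. sm K X D T s (\<lambda>y z.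
    sm K B C T (f y) (\<lambda>a b.
      tens K A (B \<boxtimes> C \<boxtimes> D) x
        (tens K B (C \<boxtimes> D) a (tens K C D b z)))))"
  unfolding map3_2_def T_def tuple_defs unfolding tensor_to_space
  using assms(1-7) lin_closed[OF assms(6)]
  by (intro sw_eq_sm) simp_all

lemma map3_3_sm:
  assumes "module K X" "module K A" "module K B" "module K C" "module K D"
    and "lin K X (C \<boxtimes> D) f"
    and "t \<in> carrier (A \<boxtimes> B \<boxtimes> X)"
  defines "T \<equiv> A \<boxtimes> B \<boxtimes> C \<boxtimes> D"
  shows "map3_3 K A B C D f t = sm K A (B \<boxtimes> X) T t (\<lambda>x s. sm K B X T s (\<lambda>y z.
    sm K C D T (f z) (\<lambda>a b.
      tens K A (B \<boxtimes> C \<boxtimes> D) x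
        (tens K B (C \<boxtimes> D) y (tens K C D a b)))))"
  unfolding map3_3_def T_def tuple_defs unfolding tensor_to_space
  using assms(1-7) lin_closed[OF assms(6)]
  by (intro sw_eq_sm) simp_all

lemma unit_right_sm:
  assumes "module K A" "module K B" "module K C" "nonassoc_algebra K D"
    and "t \<in> carrier (A \<boxtimes> B \<boxtimes> C)"
  defines "T \<equiv> A \<boxtimes> B \<boxtimes> C \<boxtimes> D"
  shows "unit_right K A B C D t = sm K A (B \<boxtimes> C) T t (\<lambda>x s. sm K B C T s (\<lambda>y z.
      tens K A (B \<boxtimes> C \<boxtimes> D) x
        (tens K B (C \<boxtimes> D) y (tens K C D z \<one>\<^bsub>D\<^esub>))))"
  unfolding unit_right_def T_def tuple_defs unfolding tensor_to_space
  using assms(1-5) nonassoc_algebra_module[OF assms(4)]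
  by (intro sw_eq_sm) simp_all

lemma unit_left_tens:
  "unit_left K A B C D = (\<lambda>t. tens K A (B \<boxtimes> C \<boxtimes> D) \<one>\<^bsub>A\<^esub> t)"
  by (simp add: unit_left_def fun_eq_iff)

text \<open>It adds a linear continuation g to a known Sweedler sum. An axiom such as the counit
  law, stated with values in one algebra, then applies inside larger expressions.\<close>

lemma lin_sm_eq:
  assumes "sm K V W M t f = u" "module K V" "module K W" "module K M" "module K M'" "lin K M M' g"
    and "\<And>a b. a \<in> carrier V \<Longrightarrow> b \<in> carrier W \<Longrightarrow> f a b \<in> carrier M"
  shows "sm K V W M' t (\<lambda>a b. g (f a b)) = g u"
  unfolding assms(1)[symmetric] by (rule sm_apply[symmetric]) (use assms in simp_all)

text \<open>For pure s both sides are the sum over t alone. The rule closes the goals that remain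
  after simplification, where the two sides differ only in the order of two independent
  summations.\<close>

lemma sm_comm:
  assumes "module K V" "module K W" "module K X" "module K Y" "module K M"
    and "\<And>b c d. b \<in> carrier W \<Longrightarrow> c \<in> carrier X \<Longrightarrow> d \<in> carrier Y \<Longrightarrow> lin K V M (\<lambda>a. f a b c d)"
    and "\<And>a c d. a \<in> carrier V \<Longrightarrow> c \<in> carrier X \<Longrightarrow> d \<in> carrier Y \<Longrightarrow> lin K W M (\<lambda>b. f a b c d)"
    and "s \<in> carrier (V \<boxtimes> W)"
  shows "sm K V W M s (\<lambda>a b. sm K X Y M t (\<lambda>c d. f a b c d))
    = sm K X Y M t (\<lambda>c d. sm K V W M s (\<lambda>a b. f a b c d))"
proof (rule tensor_ext[of V W M "\<lambda>s. sm K V W M s (\<lambda>a b. sm K X Y M t (\<lambda>c d. f a b c d))"])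
  show "lin K (V \<boxtimes> W) M (\<lambda>s. sm K V W M s (\<lambda>a b. sm K X Y M t (\<lambda>c d. f a b c d)))"
    "lin K (V \<boxtimes> W) M (\<lambda>s. sm K X Y M t (\<lambda>c d. sm K V W M s (\<lambda>a b. f a b c d)))"
    using assms by simp_all
  fix v w assume "v \<in> carrier V" "w \<in> carrier W"
  then show "sm K V W M (tens K V W v w) (\<lambda>a b. sm K X Y M t (\<lambda>c d. f a b c d))
      = sm K X Y M t (\<lambda>c d. sm K V W M (tens K V W v w) (\<lambda>a b. f a b c d))"
    using assms by simp
qed (use assms in simp_all)

lemma alg_hom_mult_sm:
  assumes "k_algebra K X" "k_algebra K A" "k_algebra K B" and f: "alg_hom K X (A \<star> B) f"
    and "x \<in> carrier X" "y \<in> carrier X"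
  shows "f (x \<otimes>\<^bsub>X\<^esub> y) = sm K A B (A \<boxtimes> B) (f x) (\<lambda>a b. sm K A B (A \<boxtimes> B) (f y) (\<lambda>a' b'.
    tens K A B (a \<otimes>\<^bsub>A\<^esub> a') (b \<otimes>\<^bsub>B\<^esub> b')))"
  using assms alg_hom_in[OF f] by (simp add: alg_hom_mult[OF f] tensor_mult)

lemma alg_hom_map2_1:
  assumes "k_algebra K X" "k_algebra K A" "k_algebra K B" "k_algebra K C"
    and f: "alg_hom K X (A \<star> B) f"
  shows "alg_hom K (X \<star> C) (tensor3 K A B C) (map2_1 K A B C f)"
proof -
  have lf: "lin K X (A \<boxtimes> B) f"
    using alg_hom_lin[OF f] assms by simp
  note [simp] = assms(1-4) lin_closed[OF lf] map2_1_sm[OF _ _ _ _ lf] lin_comp[OF _ lf]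
    alg_hom_mult_sm[OF _ _ _ f] alg_hom_one[OF f] lf
  show ?thesis
    by (rule alg_hom_tensorI[of _ _ X C], simp_all, rule lin_cong[rotated 2], rule lin_sm, simp_all)
      (subst sm_comm, simp_all)
qed

lemma alg_hom_map2_2:
  assumes "k_algebra K X" "k_algebra K A" "k_algebra K B" "k_algebra K C"
    and f: "alg_hom K X (B \<star> C) f"
  shows "alg_hom K (A \<star> X) (tensor3 K A B C) (map2_2 K A B C f)"
proof -
  have lf: "lin K X (B \<boxtimes> C) f"
    using alg_hom_lin[OF f] assms by simp
  note [simp] = assms(1-4) lin_closed[OF lf] map2_2_sm[OF _ _ _ _ lf] lin_comp[OF _ lf]
    alg_hom_mult_sm[OF _ _ _ f] alg_hom_one[OF f] lf
  show ?thesis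
    by (rule alg_hom_tensorI[of _ _ A X], simp_all, rule lin_cong[rotated 2], rule lin_sm, simp_all)
      (subst sm_comm, simp_all)
qed

lemma alg_hom_map3_1:
  assumes "k_algebra K X" "k_algebra K A" "k_algebra K B" "k_algebra K C" "k_algebra K D"
    and f: "alg_hom K X (A \<star> B) f"
  shows "alg_hom K (tensor3 K X C D) (tensor4 K A B C D) (map3_1 K A B C D f)"
proof -
  have lf: "lin K X (A \<boxtimes> B) f"
    using alg_hom_lin[OF f] assms by simp
  note [simp] = assms(1-5) lin_closed[OF lf] map3_1_sm[OF _ _ _ _ _ lf] lin_comp[OF _ lf]
    alg_hom_mult_sm[OF _ _ _ f] alg_hom_one[OF f] lf
  show ?thesis
    by (rule alg_hom_tensor3I[of _ _ X C D], simp_all, rule lin_cong[rotated 2], rule lin_sm, simp_all)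
      (subst sm_comm, simp_all)
qed

lemma alg_hom_map3_2:
  assumes "k_algebra K X" "k_algebra K A" "k_algebra K B" "k_algebra K C" "k_algebra K D"
    and f: "alg_hom K X (B \<star> C) f"
  shows "alg_hom K (tensor3 K A X D) (tensor4 K A B C D) (map3_2 K A B C D f)"
proof -
  have lf: "lin K X (B \<boxtimes> C) f"
    using alg_hom_lin[OF f] assms by simp
  note [simp] = assms(1-5) lin_closed[OF lf] map3_2_sm[OF _ _ _ _ _ lf] lin_comp[OF _ lf]
    alg_hom_mult_sm[OF _ _ _ f] alg_hom_one[OF f] lf
  show ?thesis
    by (rule alg_hom_tensor3I[of _ _ A X D], simp_all, rule lin_cong[rotated 2], rule lin_sm, simp_all)
      (subst sm_comm, simp_all)
qed

lemma alg_hom_map3_3: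
  assumes "k_algebra K X" "k_algebra K A" "k_algebra K B" "k_algebra K C" "k_algebra K D"
    and f: "alg_hom K X (C \<star> D) f"
  shows "alg_hom K (tensor3 K A B X) (tensor4 K A B C D) (map3_3 K A B C D f)"
proof -
  have lf: "lin K X (C \<boxtimes> D) f"
    using alg_hom_lin[OF f] assms by simp
  note [simp] = assms(1-5) lin_closed[OF lf] map3_3_sm[OF _ _ _ _ _ lf] lin_comp[OF _ lf]
    alg_hom_mult_sm[OF _ _ _ f] alg_hom_one[OF f] lf
  show ?thesis
    by (rule alg_hom_tensor3I[of _ _ A B X], simp_all, rule lin_cong[rotated 2], rule lin_sm, simp_all)
      (subst sm_comm, simp_all)
qed

lemma alg_hom_unit_left:
  assumes "k_algebra K A" "k_algebra K B" "k_algebra K C" "k_algebra K D"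
  shows "alg_hom K (tensor3 K B C D) (tensor4 K A B C D) (unit_left K A B C D)"
proof -
  note [simp] = assms unit_left_tens
  show ?thesis by (rule alg_homI) simp_all
qed

lemma alg_hom_unit_right:
  assumes "k_algebra K A" "k_algebra K B" "k_algebra K C" "k_algebra K D"
  shows "alg_hom K (tensor3 K A B C) (tensor4 K A B C D) (unit_right K A B C D)"
proof -
  note [simp] = assms unit_right_sm
  show ?thesis
    by (rule alg_hom_tensor3I[of _ _ A B C], simp_all, rule lin_cong[rotated 2], rule lin_sm, simp_all)
qed

lemmas unit_maps [simp] =
  alg_hom_unit_left[THEN alg_hom_lin_comp, simplified] alg_hom_unit_right[THEN alg_hom_lin_comp, simplified]
  alg_hom_unit_left[THEN alg_hom_in, simplified] alg_hom_unit_right[THEN alg_hom_in, simplified]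

lemmas map2_maps = alg_hom_map2_1[THEN alg_hom_lin_comp] alg_hom_map2_2[THEN alg_hom_lin_comp]
  alg_hom_map2_1[THEN alg_hom_in] alg_hom_map2_2[THEN alg_hom_in]

lemmas map3_maps = alg_hom_map3_1[THEN alg_hom_lin_comp] alg_hom_map3_2[THEN alg_hom_lin_comp]
  alg_hom_map3_3[THEN alg_hom_lin_comp] alg_hom_map3_1[THEN alg_hom_in]
  alg_hom_map3_2[THEN alg_hom_in] alg_hom_map3_3[THEN alg_hom_in]

end

section \<open>Coactions and counits\<close>

context quasi_bialgebra
begin

abbreviation HH where "HH \<equiv> H \<boxtimes> H"
abbreviation HHH where "HHH \<equiv> H \<boxtimes> H \<boxtimes> H"

lemma Delta_lin [simp]: "lin K H HH \<Delta>"
  using alg_hom_lin[OF comult_hom] by simp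

lemma Delta_in [simp]: "h \<in> carrier H \<Longrightarrow> \<Delta> h \<in> carrier HH"
  by (rule lin_closed[OF Delta_lin])

lemma Delta_one [simp]: "\<Delta> \<one>\<^bsub>H\<^esub> = tens K H H \<one>\<^bsub>H\<^esub> \<one>\<^bsub>H\<^esub>"
  using alg_hom_one[OF comult_hom] by simp

lemma Delta_mult [simp]:
  "x \<in> carrier H \<Longrightarrow> y \<in> carrier H \<Longrightarrow> \<Delta> (x \<otimes>\<^bsub>H\<^esub> y) =
    sm K H H HH (\<Delta> x) (\<lambda>a b. sm K H H HH (\<Delta> y) (\<lambda>a' b'.
      tens K H H (a \<otimes>\<^bsub>H\<^esub> a') (b \<otimes>\<^bsub>H\<^esub> b')))"
  by (rule alg_hom_mult_sm[OF _ _ _ comult_hom]) simp_all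

lemma eps_lin [simp]: "lin K H (ground_algebra K) \<epsilon>"
  using alg_hom_lin[OF counit_hom] by simp

lemma eps_in [simp]: "h \<in> carrier H \<Longrightarrow> \<epsilon> h \<in> carrier K"
  using lin_closed[OF eps_lin] by simp

lemma eps_one [simp]: "\<epsilon> \<one>\<^bsub>H\<^esub> = \<one>\<^bsub>K\<^esub>"
  using alg_hom_one[OF counit_hom] by simp

lemma eps_mult [simp]: "x \<in> carrier H \<Longrightarrow> y \<in> carrier H \<Longrightarrow> \<epsilon> (x \<otimes>\<^bsub>H\<^esub> y) = \<epsilon> x \<otimes>\<^bsub>K\<^esub> \<epsilon> y"
  using alg_hom_mult[OF counit_hom] by simp

lemma Phi_in [simp]:
  "\<Phi> \<in> carrier HHH"
  "inv\<^bsub>H \<star> H \<star> H\<^esub> \<Phi> \<in> carrier HHH"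
  using reassoc_unit monoid.Units_closed[OF k_algebra_monoid[of "tensor3 K H H H"], of \<Phi>]
    monoid.Units_inv_closed[OF k_algebra_monoid[of "tensor3 K H H H"], of \<Phi>] by simp_all

lemmas Delta_maps [simp] =
  map2_maps[OF _ _ _ _ comult_hom, simplified] map3_maps[OF _ _ _ _ _ comult_hom, simplified]

text \<open>The axiom is the case where g is the identity. The form with a linear g matches
  \<epsilon> wherever it occurs inside a longer sum, after all scalars have been pulled to the
  front.\<close>

lemma counit_l [simp]:
  assumes "module K M" "h \<in> carrier H" "lin K H M g"
  shows "sm K H H M (\<Delta> h) (\<lambda>p q. \<epsilon> p \<odot>\<^bsub>M\<^esub> g q) = g h"
proof -
  have *: "sm K H H H (\<Delta> h) (\<lambda>p q. \<epsilon> p \<odot>\<^bsub>H\<^esub> q) = h"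
    using assms counit_left[OF assms(2)] by (subst sm_eq_sw) simp_all
  from lin_sm_eq[OF * _ _ _ assms(1,3)] show ?thesis
    using assms by (simp add: lin_smult[OF assms(3)])
qed

lemma counit_r [simp]:
  assumes "module K M" "h \<in> carrier H" "lin K H M g"
  shows "sm K H H M (\<Delta> h) (\<lambda>p q. \<epsilon> q \<odot>\<^bsub>M\<^esub> g p) = g h"
proof -
  have *: "sm K H H H (\<Delta> h) (\<lambda>p q. \<epsilon> q \<odot>\<^bsub>H\<^esub> p) = h"
    using assms counit_right[OF assms(2)] by (subst sm_eq_sw) simp_all
  from lin_sm_eq[OF * _ _ _ assms(1,3)] show ?thesis
    using assms by (simp add: lin_smult[OF assms(3)])
qed

lemma smult_commute:
  "module K M \<Longrightarrow> c \<in> carrier K \<Longrightarrow> d \<in> carrier K \<Longrightarrow> x \<in> carrier M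
    \<Longrightarrow> c \<odot>\<^bsub>M\<^esub> (d \<odot>\<^bsub>M\<^esub> x) = d \<odot>\<^bsub>M\<^esub> (c \<odot>\<^bsub>M\<^esub> x)"
  by (simp flip: smult_smult(1) add: m_comm del: smult_smult(1))

text \<open>The maps with \<epsilon> in one slot receive names because they are algebra maps: a
  normalisation then passes to the inverse of a reassociator, and \<epsilon> can be applied to both
  sides of a pentagon factor by factor.\<close>

definition counit1 where
  "counit1 Y Z = (\<lambda>t. sm K H (Y \<boxtimes> Z) (Y \<boxtimes> Z) t (\<lambda>h s.
    sm K Y Z (Y \<boxtimes> Z) s (\<lambda>y z. \<epsilon> h \<odot>\<^bsub>Y \<boxtimes> Z\<^esub> tens K Y Z y z)))"

definition counit2 where
  "counit2 Y Z = (\<lambda>t. sm K Y (H \<boxtimes> Z) (Y \<boxtimes> Z) t (\<lambda>y s.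
    sm K H Z (Y \<boxtimes> Z) s (\<lambda>h z. \<epsilon> h \<odot>\<^bsub>Y \<boxtimes> Z\<^esub> tens K Y Z y z)))"

definition counit3 where
  "counit3 Y Z = (\<lambda>t. sm K Y (Z \<boxtimes> H) (Y \<boxtimes> Z) t (\<lambda>y s.
    sm K Z H (Y \<boxtimes> Z) s (\<lambda>z h. \<epsilon> h \<odot>\<^bsub>Y \<boxtimes> Z\<^esub> tens K Y Z y z)))"

lemma
  assumes "k_algebra K Y" "k_algebra K Z"
  shows counit1_hom: "alg_hom K (tensor3 K H Y Z) (Y \<star> Z) (counit1 Y Z)"
    and counit2_hom: "alg_hom K (tensor3 K Y H Z) (Y \<star> Z) (counit2 Y Z)"
    and counit3_hom: "alg_hom K (tensor3 K Y Z H) (Y \<star> Z) (counit3 Y Z)"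
  by (rule alg_hom_tensor3I[of _ _ H Y Z] alg_hom_tensor3I[of _ _ Y H Z] alg_hom_tensor3I[of _ _ Y Z H];
      use assms in \<open>simp add: counit1_def counit2_def counit3_def smult_commute\<close>)+

lemma counit1_tens [simp]:
  "k_algebra K Y \<Longrightarrow> k_algebra K Z \<Longrightarrow> h \<in> carrier H \<Longrightarrow> s \<in> carrier (Y \<boxtimes> Z)
    \<Longrightarrow> counit1 Y Z (tens K H (Y \<boxtimes> Z) h s) = \<epsilon> h \<odot>\<^bsub>Y \<boxtimes> Z\<^esub> s"
  by (simp add: counit1_def sm_eta)

lemma counit1_lin [simp]:
    "k_algebra K Y \<Longrightarrow> k_algebra K Z \<Longrightarrow> lin K X (H \<boxtimes> Y \<boxtimes> Z) f
      \<Longrightarrow> lin K X (Y \<boxtimes> Z) (\<lambda>x. counit1 Y Z (f x))"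
  and counit2_lin [simp]:
    "k_algebra K Y \<Longrightarrow> k_algebra K Z \<Longrightarrow> lin K X (Y \<boxtimes> H \<boxtimes> Z) g
      \<Longrightarrow> lin K X (Y \<boxtimes> Z) (\<lambda>x. counit2 Y Z (g x))"
  and counit3_lin [simp]:
    "k_algebra K Y \<Longrightarrow> k_algebra K Z \<Longrightarrow> lin K X (Y \<boxtimes> Z \<boxtimes> H) h
      \<Longrightarrow> lin K X (Y \<boxtimes> Z) (\<lambda>x. counit3 Y Z (h x))"
  by (simp_all add: counit1_def counit2_def counit3_def)

lemma counit_in [simp]:
  "k_algebra K Y \<Longrightarrow> k_algebra K Z \<Longrightarrow> counit1 Y Z s \<in> carrier (Y \<boxtimes> Z)"
  "k_algebra K Y \<Longrightarrow> k_algebra K Z \<Longrightarrow> counit2 Y Z t \<in> carrier (Y \<boxtimes> Z)"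
  "k_algebra K Y \<Longrightarrow> k_algebra K Z \<Longrightarrow> counit3 Y Z r \<in> carrier (Y \<boxtimes> Z)"
  by (simp_all add: counit1_def counit2_def counit3_def)

text \<open>The normalisation of t with a linear continuation g. As a simp rule it deletes a
  reassociator as soon as one of its legs occurs only below \<epsilon>, which happens whenever that
  leg acts on a unit.\<close>

lemma counit1_apply:
  assumes "k_algebra K Y" "k_algebra K Z" "module K M" "lin K (Y \<boxtimes> Z) M g"
    and 1: "counit1 Y Z t = \<one>\<^bsub>Y \<star> Z\<^esub>"
  shows "sm K H (Y \<boxtimes> Z) M t (\<lambda>h s. \<epsilon> h \<odot>\<^bsub>M\<^esub> g s) = g (tens K Y Z \<one>\<^bsub>Y\<^esub> \<one>\<^bsub>Z\<^esub>)"
proof -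
  note [simp] = assms(1-4) lin_closed[OF assms(4)] lin_smult[OF assms(4)]
  have "g (tens K Y Z \<one>\<^bsub>Y\<^esub> \<one>\<^bsub>Z\<^esub>) = g (counit1 Y Z t)"
    using 1 by simp
  also have "\<dots> = g (sm K H (Y \<boxtimes> Z) (Y \<boxtimes> Z) t
      (\<lambda>h s. \<epsilon> h \<odot>\<^bsub>Y \<boxtimes> Z\<^esub> s))"
    by (simp add: counit1_def)
  also have "\<dots> = sm K H (Y \<boxtimes> Z) M t (\<lambda>h s. g (\<epsilon> h \<odot>\<^bsub>Y \<boxtimes> Z\<^esub> s))"
    by (rule sm_apply) simp_all
  finally show ?thesis by simp
qed

lemma counit2_apply:
  assumes "k_algebra K Y" "k_algebra K Z" "module K M"
    and g: "\<And>y. y \<in> carrier Y \<Longrightarrow> lin K Z M (g y)" "\<And>z. z \<in> carrier Z \<Longrightarrow> lin K Y M (\<lambda>y. g y z)"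
    and 1: "counit2 Y Z t = \<one>\<^bsub>Y \<star> Z\<^esub>"
  shows "sm K Y (H \<boxtimes> Z) M t (\<lambda>y s. sm K H Z M s (\<lambda>h z. \<epsilon> h \<odot>\<^bsub>M\<^esub> g y z))
    = g \<one>\<^bsub>Y\<^esub> \<one>\<^bsub>Z\<^esub>"
proof -
  note [simp] = assms(1-3) g lin_closed[OF g(1)]
  have "g \<one>\<^bsub>Y\<^esub> \<one>\<^bsub>Z\<^esub> = sm K Y Z M (counit2 Y Z t) g"
    using 1 by simp
  then show ?thesis by (simp add: counit2_def)
qed

lemma counit3_apply:
  assumes "k_algebra K Y" "k_algebra K Z" "module K M"
    and g: "\<And>y. y \<in> carrier Y \<Longrightarrow> lin K Z M (g y)" "\<And>z. z \<in> carrier Z \<Longrightarrow> lin K Y M (\<lambda>y. g y z)"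
    and 1: "counit3 Y Z t = \<one>\<^bsub>Y \<star> Z\<^esub>"
  shows "sm K Y (Z \<boxtimes> H) M t (\<lambda>y s. sm K Z H M s (\<lambda>z h. \<epsilon> h \<odot>\<^bsub>M\<^esub> g y z))
    = g \<one>\<^bsub>Y\<^esub> \<one>\<^bsub>Z\<^esub>"
proof -
  note [simp] = assms(1-3) g lin_closed[OF g(1)]
  have "g \<one>\<^bsub>Y\<^esub> \<one>\<^bsub>Z\<^esub> = sm K Y Z M (counit3 Y Z t) g"
    using 1 by simp
  then show ?thesis by (simp add: counit3_def)
qed

lemma
  assumes "k_algebra K Y" "k_algebra K Z"
  shows counit1_eq: "t \<in> carrier (H \<boxtimes> Y \<boxtimes> Z)
      \<Longrightarrow> sw3 K (Y \<star> Z) t (\<lambda>x y z. \<epsilon> x \<odot>\<^bsub>Y \<star> Z\<^esub> tens K Y Z y z) = counit1 Y Z t"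
    and counit2_eq: "s \<in> carrier (Y \<boxtimes> H \<boxtimes> Z)
      \<Longrightarrow> sw3 K (Y \<star> Z) s (\<lambda>x y z. \<epsilon> y \<odot>\<^bsub>Y \<star> Z\<^esub> tens K Y Z x z) = counit2 Y Z s"
    and counit3_eq: "r \<in> carrier (Y \<boxtimes> Z \<boxtimes> H)
      \<Longrightarrow> sw3 K (Y \<star> Z) r (\<lambda>x y z. \<epsilon> z \<odot>\<^bsub>Y \<star> Z\<^esub> tens K Y Z x y) = counit3 Y Z r"
  unfolding counit1_def counit2_def counit3_def tuple_defs unfolding tensor_to_space using assms
  by (intro sw_eq_sm; simp del: smult_out)+

text \<open>An algebra map respects inverses, and the inverse of 1 is 1.\<close>

lemma
  assumes "k_algebra K Y" "k_algebra K Z"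
  shows counit1_inv: "t \<in> Units (tensor3 K H Y Z) \<Longrightarrow> counit1 Y Z t = \<one>\<^bsub>Y \<star> Z\<^esub>
      \<Longrightarrow> counit1 Y Z (inv\<^bsub>tensor3 K H Y Z\<^esub> t) = \<one>\<^bsub>Y \<star> Z\<^esub>"
    and counit2_inv: "s \<in> Units (tensor3 K Y H Z) \<Longrightarrow> counit2 Y Z s = \<one>\<^bsub>Y \<star> Z\<^esub>
      \<Longrightarrow> counit2 Y Z (inv\<^bsub>tensor3 K Y H Z\<^esub> s) = \<one>\<^bsub>Y \<star> Z\<^esub>"
    and counit3_inv: "r \<in> Units (tensor3 K Y Z H) \<Longrightarrow> counit3 Y Z r = \<one>\<^bsub>Y \<star> Z\<^esub>
      \<Longrightarrow> counit3 Y Z (inv\<^bsub>tensor3 K Y Z H\<^esub> r) = \<one>\<^bsub>Y \<star> Z\<^esub>"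
  using alg_hom_Units(2)[OF counit1_hom[OF assms], of t] alg_hom_Units(2)[OF counit2_hom[OF assms], of s]
    alg_hom_Units(2)[OF counit3_hom[OF assms], of r] assms monoid.inv_one[OF k_algebra_monoid[of "Y \<star> Z"]]
  by (simp_all del: one_tensor)

lemma counit2_Phi: "counit2 H H \<Phi> = \<one>\<^bsub>H \<star> H\<^esub>"
  using reassoc_counit by (subst counit2_eq[symmetric]) simp_all

end

section \<open>Coactions without reassociator, and the normalisation of \<Phi>lr\<close>

lemma (in monoid) Units_r_cancel:
  assumes "x \<in> Units G" "a \<in> carrier G" "b \<in> carrier G" "a \<otimes> x = b \<otimes> x"
  shows "a = b"
proof -
  have "a \<otimes> x \<otimes> inv x = b \<otimes> x \<otimes> inv x"
    using assms(4) by simp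
  then show ?thesis using assms(1-3) by (simp add: m_assoc Units_closed)
qed

text \<open>The coaction is separated from its reassociator because H has to be treated before it is
  known to be a comodule algebra over itself: the outer normalisations of \<Phi> are first derived
  from this weaker structure.\<close>

locale left_coaction = quasi_bialgebra K H \<Delta> \<epsilon> \<Phi> + U: k_algebra K U
  for K :: "'k ring" and H :: "('k, 'h) module" and \<Delta> \<epsilon> \<Phi>
    and U :: "('k, 'u) module" and lam +
  assumes lam_hom: "alg_hom K U (tensor K H U) lam"
    and lam_counit: "u \<in> carrier U \<Longrightarrow> sw K U (lam u) (\<lambda>u\<^sub>1 u\<^sub>0. \<epsilon> u\<^sub>1 \<odot>\<^bsub>U\<^esub> u\<^sub>0) = u"
begin

abbreviation HHU where "HHU \<equiv> H \<boxtimes> H \<boxtimes> U"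
abbreviation HU where "HU \<equiv> H \<boxtimes> U"

lemma lam_lin [simp]: "lin K U HU lam"
  using alg_hom_lin[OF lam_hom] by simp

lemma lam_in [simp]: "u \<in> carrier U \<Longrightarrow> lam u \<in> carrier HU"
  by (rule lin_closed[OF lam_lin])

lemma lam_one [simp]: "lam \<one>\<^bsub>U\<^esub> = tens K H U \<one>\<^bsub>H\<^esub> \<one>\<^bsub>U\<^esub>"
  using alg_hom_one[OF lam_hom] by simp

lemma lam_mult [simp]:
  "x \<in> carrier U \<Longrightarrow> y \<in> carrier U \<Longrightarrow> lam (x \<otimes>\<^bsub>U\<^esub> y) =
    sm K H U HU (lam x) (\<lambda>a b. sm K H U HU (lam y) (\<lambda>a' b'.
      tens K H U (a \<otimes>\<^bsub>H\<^esub> a') (b \<otimes>\<^bsub>U\<^esub> b')))"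
  by (rule alg_hom_mult_sm[OF _ _ _ lam_hom]) simp_all

lemmas lam_maps [simp] =
  map2_maps[OF _ _ _ _ lam_hom, simplified] map3_maps[OF _ _ _ _ _ lam_hom, simplified]

lemma lam_counit_sm [simp]:
  assumes "module K M" "u \<in> carrier U" "lin K U M g"
  shows "sm K H U M (lam u) (\<lambda>p q. \<epsilon> p \<odot>\<^bsub>M\<^esub> g q) = g u"
proof -
  have *: "sm K H U U (lam u) (\<lambda>p q. \<epsilon> p \<odot>\<^bsub>U\<^esub> q) = u"
    using assms lam_counit[OF assms(2)] by (subst sm_eq_sw) simp_all
  from lin_sm_eq[OF * _ _ _ assms(1,3)] show ?thesis
    using assms by (simp add: lin_smult[OF assms(3)])
qed

end

locale right_coaction = quasi_bialgebra K H \<Delta> \<epsilon> \<Phi> + U: k_algebra K U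
  for K :: "'k ring" and H :: "('k, 'h) module" and \<Delta> \<epsilon> \<Phi>
    and U :: "('k, 'u) module" and \<rho> +
  assumes rho_hom: "alg_hom K U (tensor K U H) \<rho>"
    and rho_counit: "u \<in> carrier U \<Longrightarrow> sw K U (\<rho> u) (\<lambda>u\<^sub>0 u\<^sub>1. \<epsilon> u\<^sub>1 \<odot>\<^bsub>U\<^esub> u\<^sub>0) = u"
begin

abbreviation UHH where "UHH \<equiv> U \<boxtimes> H \<boxtimes> H"
abbreviation UH where "UH \<equiv> U \<boxtimes> H"

lemma rho_lin [simp]: "lin K U UH \<rho>"
  using alg_hom_lin[OF rho_hom] by simp

lemma rho_in [simp]: "u \<in> carrier U \<Longrightarrow> \<rho> u \<in> carrier UH"
  by (rule lin_closed[OF rho_lin])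

lemma rho_one [simp]: "\<rho> \<one>\<^bsub>U\<^esub> = tens K U H \<one>\<^bsub>U\<^esub> \<one>\<^bsub>H\<^esub>"
  using alg_hom_one[OF rho_hom] by simp

lemma rho_mult [simp]:
  "x \<in> carrier U \<Longrightarrow> y \<in> carrier U \<Longrightarrow> \<rho> (x \<otimes>\<^bsub>U\<^esub> y) =
    sm K U H UH (\<rho> x) (\<lambda>a b. sm K U H UH (\<rho> y) (\<lambda>a' b'.
      tens K U H (a \<otimes>\<^bsub>U\<^esub> a') (b \<otimes>\<^bsub>H\<^esub> b')))"
  by (rule alg_hom_mult_sm[OF _ _ _ rho_hom]) simp_all

lemmas rho_maps [simp] =
  map2_maps[OF _ _ _ _ rho_hom, simplified] map3_maps[OF _ _ _ _ _ rho_hom, simplified]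

lemma rho_counit_sm [simp]:
  assumes "module K M" "u \<in> carrier U" "lin K U M g"
  shows "sm K U H M (\<rho> u) (\<lambda>p q. \<epsilon> q \<odot>\<^bsub>M\<^esub> g p) = g u"
proof -
  have *: "sm K U H U (\<rho> u) (\<lambda>p q. \<epsilon> q \<odot>\<^bsub>U\<^esub> p) = u"
    using assms rho_counit[OF assms(2)] by (subst sm_eq_sw) simp_all
  from lin_sm_eq[OF * _ _ _ assms(1,3)] show ?thesis
    using assms by (simp add: lin_smult[OF assms(3)])
qed

end

locale bicoaction = left_coaction + right_coaction
begin

abbreviation HUH where "HUH \<equiv> H \<boxtimes> U \<boxtimes> H"

text \<open>Put \<epsilon> into the second of the four slots of the pentagon. The counit laws of lam
  and \<Delta> turn two factors into \<Phi>lr, both factors made from \<Phi>lam become 1, and (1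
  \<otimes> (\<epsilon> \<otimes> id \<otimes> id) \<Phi>lr) \<Phi>lr = \<Phi>lr remains.\<close>

lemma counit_slot1:
  assumes lam: "\<Phi>lam \<in> carrier HHU" "counit2 H U \<Phi>lam = \<one>\<^bsub>H \<star> U\<^esub>"
    and lr: "\<Phi>lr \<in> Units (tensor3 K H U H)"
    and pent: "unit_left K H H U H \<Phi>lr \<otimes>\<^bsub>tensor4 K H H U H\<^esub> map3_2 K H H U H lam \<Phi>lr
          \<otimes>\<^bsub>tensor4 K H H U H\<^esub> unit_right K H H U H \<Phi>lam
        = map3_3 K H H U H \<rho> \<Phi>lam \<otimes>\<^bsub>tensor4 K H H U H\<^esub> map3_1 K H H U H \<Delta> \<Phi>lr"
  shows "counit1 U H \<Phi>lr = \<one>\<^bsub>U \<star> H\<^esub>"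
proof -
  let ?T3 = "HUH" and ?c = "counit2 H (U \<star> H)"
  let ?A3 = "H \<star> U \<star> H" and ?A4 = "H \<star> H \<star> U \<star> H"
  interpret A3: monoid ?A3 by (rule k_algebra_monoid) simp
  note maps = map3_1_sm[OF _ _ _ _ _ Delta_lin] map3_2_sm[OF _ _ _ _ _ lam_lin]
      map3_3_sm[OF _ _ _ _ _ rho_lin]
    unit_right_sm unit_left_tens
  have lr_in [simp]: "\<Phi>lr \<in> carrier ?T3"
    using lr A3.Units_closed by simp
  note [simp] = lam(1)
  have 1: "?c (unit_left K H H U H t) = tens K H UH \<one>\<^bsub>H\<^esub> (counit1 U H t)"
    if "t \<in> carrier ?T3" for t
    by (rule tensor_ext3[of H U H ?T3 "\<lambda>t. ?c (unit_left K H H U H t)", OF _ _ _ _ _ _ _ that])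
      ((simp_all add: maps)?, (simp_all add: counit2_def)?)
  have 2: "?c (map3_2 K H H U H lam t) = t" if "t \<in> carrier ?T3" for t
    by (rule tensor_ext3[of H U H ?T3 "\<lambda>t. ?c (map3_2 K H H U H lam t)", OF _ _ _ _ _ _ _ that])
      ((simp_all add: maps)?, (simp_all add: counit2_def)?)
  have 3: "?c (map3_1 K H H U H \<Delta> t) = t" if "t \<in> carrier ?T3" for t
    by (rule tensor_ext3[of H U H ?T3 "\<lambda>t. ?c (map3_1 K H H U H \<Delta> t)", OF _ _ _ _ _ _ _ that])
      ((simp_all add: maps)?, (simp_all add: counit2_def)?)
  have 4: "?c (unit_right K H H U H t) = sm K H U ?T3 (counit2 H U t) (\<lambda>h u. tens K H UH h (tens K U H u \<one>\<^bsub>H\<^esub>))"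
    if "t \<in> carrier HHU" for t
    by (rule tensor_ext3[of H H U ?T3 "\<lambda>t. ?c (unit_right K H H U H t)", OF _ _ _ _ _ _ _ that])
      ((simp_all add: maps)?, (simp_all add: counit2_def)?)
  have 5: "?c (map3_3 K H H U H \<rho> t) = sm K H U ?T3 (counit2 H U t)
      (\<lambda>h u. sm K U H ?T3 (\<rho> u) (\<lambda>a b. tens K H UH h (tens K U H a b)))"
    if "t \<in> carrier HHU" for t
    by (rule tensor_ext3[of H H U ?T3 "\<lambda>t. ?c (map3_3 K H H U H \<rho> t)", OF _ _ _ _ _ _ _ that])
      ((simp_all add: maps)?, (simp_all add: counit2_def)?)
  note c_mult = alg_hom_mult[OF counit2_hom[of H "U \<star> H"], simplified]
  have "?c (unit_left K H H U H \<Phi>lr \<otimes>\<^bsub>?A4\<^esub> map3_2 K H H U H lam \<Phi>lr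
          \<otimes>\<^bsub>?A4\<^esub> unit_right K H H U H \<Phi>lam)
      = ?c (map3_3 K H H U H \<rho> \<Phi>lam \<otimes>\<^bsub>?A4\<^esub> map3_1 K H H U H \<Delta> \<Phi>lr)"
    using pent by simp
  then have "tens K H UH \<one>\<^bsub>H\<^esub> (counit1 U H \<Phi>lr) \<otimes>\<^bsub>?A3\<^esub> \<Phi>lr = \<one>\<^bsub>?A3\<^esub> \<otimes>\<^bsub>?A3\<^esub> \<Phi>lr"
    using A3.r_one[of "tens K H UH \<one>\<^bsub>H\<^esub> (counit1 U H \<Phi>lr) \<otimes>\<^bsub>?A3\<^esub> \<Phi>lr"]
    by (simp add: c_mult 1 2 3 4 5 lam(2))
  then have "tens K H UH \<one>\<^bsub>H\<^esub> (counit1 U H \<Phi>lr) = \<one>\<^bsub>?A3\<^esub>"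
    using A3.Units_r_cancel[of \<Phi>lr "tens K H UH \<one>\<^bsub>H\<^esub> (counit1 U H \<Phi>lr)" "\<one>\<^bsub>?A3\<^esub>"] lr
    by simp
  \<comment> \<open>Applying \<epsilon> to the first slot strips the leading 1, because
    \<epsilon>(1) = 1.\<close>
  then have "counit1 U H (tens K H UH \<one>\<^bsub>H\<^esub> (counit1 U H \<Phi>lr)) = counit1 U H \<one>\<^bsub>?A3\<^esub>"
    by simp
  then show ?thesis
    by simp
qed

text \<open>Here \<epsilon> goes into the third slot: both factors made from \<Phi>\<rho> become 1,
  the counit laws of \<rho> and \<Delta> give \<Phi>lr twice, and \<Phi>lr ((id \<otimes> id
  \<otimes> \<epsilon>) \<Phi>lr \<otimes> 1) = \<Phi>lr remains.\<close>

lemma counit_slot3: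
  assumes rho: "\<Phi>\<rho> \<in> carrier UHH" "counit2 U H \<Phi>\<rho> = \<one>\<^bsub>U \<star> H\<^esub>"
    and lr: "\<Phi>lr \<in> Units (tensor3 K H U H)"
    and pent: "unit_left K H U H H \<Phi>\<rho> \<otimes>\<^bsub>tensor4 K H U H H\<^esub> map3_2 K H U H H \<rho> \<Phi>lr
          \<otimes>\<^bsub>tensor4 K H U H H\<^esub> unit_right K H U H H \<Phi>lr
        = map3_3 K H U H H \<Delta> \<Phi>lr \<otimes>\<^bsub>tensor4 K H U H H\<^esub> map3_1 K H U H H lam \<Phi>\<rho>"
  shows "counit3 H U \<Phi>lr = \<one>\<^bsub>H \<star> U\<^esub>"
proof -
  let ?T3 = "HUH" and ?T4 = "UHH"
  \<comment> \<open>This is id \<otimes> id \<otimes> \<epsilon> \<otimes> id. The third slot lies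
    inside the nested right factor, so the map is built as id \<otimes>
    \<open>counit2\<close>.\<close>
  define c where "c = (\<lambda>t. sm K H ?T4 ?T3 t (\<lambda>h s. tens K H UH h (counit2 U H s)))"
  let ?A3 = "H \<star> U \<star> H" and ?A4 = "H \<star> U \<star> H \<star> H"
  interpret A3: monoid ?A3 by (rule k_algebra_monoid) simp
  note maps = map3_1_sm[OF _ _ _ _ _ lam_lin] map3_2_sm[OF _ _ _ _ _ rho_lin]
      map3_3_sm[OF _ _ _ _ _ Delta_lin]
    unit_right_sm unit_left_tens
  have lr_in [simp]: "\<Phi>lr \<in> carrier ?T3"
    using lr A3.Units_closed by simp
  note [simp] = rho(1)
  have c_hom: "alg_hom K ?A4 ?A3 c"
    using alg_hom_mult[OF counit2_hom[of U H]] alg_hom_one[OF counit2_hom[of U H]]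
    unfolding c_def by (intro alg_hom_tensorI[of _ _ H ?T4]) simp_all
  have 1: "c (unit_left K H U H H t) = tens K H UH \<one>\<^bsub>H\<^esub> (counit2 U H t)"
    if "t \<in> carrier UHH" for t
    by (rule tensor_ext3[of U H H ?T3 "\<lambda>t. c (unit_left K H U H H t)", OF _ _ _ _ _ _ _ that])
      ((simp_all add: maps c_def)?, (simp_all add: counit2_def)?)
  have 2: "c (map3_2 K H U H H \<rho> t) = t" if "t \<in> carrier ?T3" for t
    by (rule tensor_ext3[of H U H ?T3 "\<lambda>t. c (map3_2 K H U H H \<rho> t)", OF _ _ _ _ _ _ _ that])
      ((simp_all add: maps c_def)?, (simp_all add: counit2_def)?)
  have 3: "c (map3_3 K H U H H \<Delta> t) = t" if "t \<in> carrier ?T3" for t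
    by (rule tensor_ext3[of H U H ?T3 "\<lambda>t. c (map3_3 K H U H H \<Delta> t)", OF _ _ _ _ _ _ _ that])
      ((simp_all add: maps c_def)?, (simp_all add: counit2_def)?)
  have 4: "c (unit_right K H U H H t) = sm K H U ?T3 (counit3 H U t) (\<lambda>h u. tens K H UH h (tens K U H u \<one>\<^bsub>H\<^esub>))"
    if "t \<in> carrier ?T3" for t
    by (rule tensor_ext3[of H U H ?T3 "\<lambda>t. c (unit_right K H U H H t)", OF _ _ _ _ _ _ _ that])
      ((simp_all add: maps c_def)?, (simp_all add: counit2_def counit3_def)?)
  have 5: "c (map3_1 K H U H H lam t) = sm K U H ?T3 (counit2 U H t)
      (\<lambda>u h. sm K H U ?T3 (lam u) (\<lambda>a b. tens K H UH a (tens K U H b h)))"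
    if "t \<in> carrier UHH" for t
    by (rule tensor_ext3[of U H H ?T3 "\<lambda>t. c (map3_1 K H U H H lam t)", OF _ _ _ _ _ _ _ that])
      ((simp_all add: maps c_def)?, (simp_all add: counit2_def)?)
  let ?R = "sm K H U ?T3 (counit3 H U \<Phi>lr) (\<lambda>h u. tens K H UH h (tens K U H u \<one>\<^bsub>H\<^esub>))"
  note c_mult = alg_hom_mult[OF c_hom, simplified]
  have "c (unit_left K H U H H \<Phi>\<rho> \<otimes>\<^bsub>?A4\<^esub> map3_2 K H U H H \<rho> \<Phi>lr
          \<otimes>\<^bsub>?A4\<^esub> unit_right K H U H H \<Phi>lr)
      = c (map3_3 K H U H H \<Delta> \<Phi>lr \<otimes>\<^bsub>?A4\<^esub> map3_1 K H U H H lam \<Phi>\<rho>)"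
    using pent by simp
  then have "\<one>\<^bsub>?A3\<^esub> \<otimes>\<^bsub>?A3\<^esub> \<Phi>lr \<otimes>\<^bsub>?A3\<^esub> ?R = \<Phi>lr \<otimes>\<^bsub>?A3\<^esub> \<one>\<^bsub>?A3\<^esub>"
    by (simp add: c_mult 1 2 3 4 5 rho(2))
  then have "?R = \<one>\<^bsub>?A3\<^esub>"
    using A3.Units_l_cancel[of \<Phi>lr ?R "\<one>\<^bsub>?A3\<^esub>"] A3.l_one[OF A3.Units_closed, of \<Phi>lr] lr
    by (simp del: one_tensor A3.Units_l_cancel)
  then have "counit3 H U ?R = counit3 H U \<one>\<^bsub>?A3\<^esub>"
    by simp
  then show ?thesis
    by (simp, simp add: counit3_def)
qed

end

section \<open>The inverse reassociators\<close>

text \<open>The four ways of solving p q r = s t that are used. They differ in which of the factors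
  stay uninverted: a reassociator that enters a construction directly must not be inverted, one that
  enters through its inverse must be.\<close>

lemma (in monoid) pentagon_inverse:
  assumes "p \<in> Units G" "q \<in> Units G" "r \<in> Units G" "s \<in> Units G" "t \<in> Units G"
    and "p \<otimes> q \<otimes> r = s \<otimes> t"
  shows "r \<otimes> inv t \<otimes> inv s = inv q \<otimes> inv p" "inv t \<otimes> inv s = inv r \<otimes> inv q \<otimes> inv p"
    "inv s \<otimes> p = t \<otimes> inv r \<otimes> inv q" "inv q \<otimes> inv p \<otimes> s = r \<otimes> inv t"
proof -
  note [simp] = assms(1-5)[THEN Units_closed] assms(1-5)
  have cancel [simp]: "inv x \<otimes> (x \<otimes> y) = y" "x \<otimes> (inv x \<otimes> y) = y"
    if "x \<in> Units G" "y \<in> carrier G" for x y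
    using that by (simp_all flip: m_assoc add: Units_closed)
  \<comment> \<open>The inverse of p q r, inserted in order to cancel against the other side of the
    pentagon.\<close>
  let ?z = "inv r \<otimes> (inv q \<otimes> inv p)"
  have "inv t \<otimes> inv s = inv t \<otimes> (inv s \<otimes> (p \<otimes> (q \<otimes> (r \<otimes> ?z))))"
    by simp
  also have "\<dots> = inv t \<otimes> (inv s \<otimes> (p \<otimes> q \<otimes> r \<otimes> ?z))"
    by (simp only: m_assoc m_closed Units_inv_closed assms(1-5) assms(1-5)[THEN Units_closed])
  also have "\<dots> = inv t \<otimes> (inv s \<otimes> (s \<otimes> t \<otimes> ?z))"
    by (simp only: assms(6))
  also have "\<dots> = ?z"
    by (simp add: m_assoc)
  finally have inv: "inv t \<otimes> inv s = ?z" .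
  show "inv t \<otimes> inv s = inv r \<otimes> inv q \<otimes> inv p"
    using inv by (simp add: m_assoc)
  have "r \<otimes> (inv t \<otimes> inv s) = inv q \<otimes> inv p"
    unfolding inv by simp
  then show eq: "r \<otimes> inv t \<otimes> inv s = inv q \<otimes> inv p"
    by (simp add: m_assoc)
  have "inv s \<otimes> p = t \<otimes> (inv t \<otimes> inv s) \<otimes> p"
    by (simp add: m_assoc)
  also have "\<dots> = t \<otimes> inv r \<otimes> inv q"
    unfolding inv by (simp add: m_assoc)
  finally show "inv s \<otimes> p = t \<otimes> inv r \<otimes> inv q" .
  have "inv q \<otimes> inv p \<otimes> s = r \<otimes> inv t \<otimes> inv s \<otimes> s"
    using eq by simp
  then show "inv q \<otimes> inv p \<otimes> s = r \<otimes> inv t"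
    by (simp add: m_assoc)
qed

lemma (in monoid) intertwine_inverse:
  assumes "p \<in> Units G" "x \<in> carrier G" "y \<in> carrier G" "p \<otimes> x = y \<otimes> p"
  shows "x \<otimes> inv p = inv p \<otimes> y"
proof -
  have "inv p \<otimes> (p \<otimes> x) \<otimes> inv p = inv p \<otimes> (y \<otimes> p) \<otimes> inv p"
    using assms(4) by simp
  then have "(inv p \<otimes> p) \<otimes> (x \<otimes> inv p) = inv p \<otimes> (y \<otimes> (p \<otimes> inv p))"
    using assms(1-3) by (simp only: m_assoc Units_closed Units_inv_closed m_closed)
  then show ?thesis using assms(1-3) by simp
qed

sublocale left_comodule_algebra \<subseteq> left_coaction
  by unfold_locales (rule lam_hom lam_counit; assumption?)+

sublocale right_comodule_algebra \<subseteq> right_coaction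
  by unfold_locales (rule rho_hom rho_counit; assumption?)+

sublocale bicomodule_algebra \<subseteq> bicoaction
  by unfold_locales

context left_comodule_algebra
begin

lemma Phi_lam_in [simp]:
  "\<Phi>lam \<in> carrier HHU"
  "inv\<^bsub>H \<star> H \<star> U\<^esub> \<Phi>lam \<in> carrier HHU"
  using Phi_lam_unit monoid.Units_closed[OF k_algebra_monoid[of "tensor3 K H H U"], of \<Phi>lam]
    monoid.Units_inv_closed[OF k_algebra_monoid[of "tensor3 K H H U"], of \<Phi>lam] by simp_all

lemma Phi_lam_counits:
  "counit2 H U \<Phi>lam = \<one>\<^bsub>H \<star> U\<^esub>" "counit1 H U \<Phi>lam = \<one>\<^bsub>H \<star> U\<^esub>"
  using Phi_lam_counit_2 Phi_lam_counit_1 counit2_eq[of H U \<Phi>lam] counit1_eq[of H U \<Phi>lam] by simp_all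

lemmas Phi_lam_inv_counits = counit2_inv[OF _ _ Phi_lam_unit Phi_lam_counits(1), simplified tuple_defs]
  counit1_inv[OF _ _ Phi_lam_unit Phi_lam_counits(2), simplified tuple_defs]

lemmas Phi_lam_counits_apply [simp] =
  counit2_apply[OF _ _ _ _ _ Phi_lam_counits(1)] counit1_apply[OF _ _ _ _ Phi_lam_counits(2)]
  counit2_apply[OF _ _ _ _ _ Phi_lam_inv_counits(1)] counit1_apply[OF _ _ _ _ Phi_lam_inv_counits(2)]

lemma lam_quasi_coassoc_inv:
  assumes "u \<in> carrier U"
  shows "map2_1 K H H U \<Delta> (lam u) \<otimes>\<^bsub>H \<star> H \<star> U\<^esub> inv\<^bsub>H \<star> H \<star> U\<^esub> \<Phi>lam
    = inv\<^bsub>H \<star> H \<star> U\<^esub> \<Phi>lam \<otimes>\<^bsub>H \<star> H \<star> U\<^esub> map2_2 K H H U lam (lam u)"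
  by (rule monoid.intertwine_inverse[OF k_algebra_monoid])
    (use lam_quasi_coassoc[OF assms] assms Phi_lam_unit in simp_all)

text \<open>\<Phi> stays uninverted because quasi-associativity of A uses \<Phi> itself, while the
  left smash product is built from the inverse of \<Phi>lam.\<close>

lemma lam_pentagon_inv:
  defines "A4 \<equiv> H \<star> H \<star> H \<star> U" and "\<phi> \<equiv> inv\<^bsub>H \<star> H \<star> U\<^esub> \<Phi>lam"
  shows "unit_right K H H H U \<Phi> \<otimes>\<^bsub>A4\<^esub> map3_1 K H H H U \<Delta> \<phi> \<otimes>\<^bsub>A4\<^esub> map3_3 K H H H U lam \<phi>
    = map3_2 K H H H U \<Delta> \<phi> \<otimes>\<^bsub>A4\<^esub> unit_left K H H H U \<phi>"
proof -
  interpret A4: monoid A4 unfolding A4_def by (rule k_algebra_monoid) simp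
  note U = alg_hom_Units[OF alg_hom_unit_left[of H H H U] _ _ Phi_lam_unit]
    alg_hom_Units[OF alg_hom_unit_right[of H H H U] _ _ reassoc_unit]
    alg_hom_Units[OF alg_hom_map3_1[of H H H H U, OF _ _ _ _ _ comult_hom] _ _ Phi_lam_unit]
    alg_hom_Units[OF alg_hom_map3_2[of H H H H U, OF _ _ _ _ _ comult_hom] _ _ Phi_lam_unit]
    alg_hom_Units[OF alg_hom_map3_3[of U H H H U, OF _ _ _ _ _ lam_hom] _ _ Phi_lam_unit]
  show ?thesis
    using A4.pentagon_inverse(1)[OF _ _ _ _ _ lam_pentagon[simplified, folded A4_def]] U
      Phi_lam_unit reassoc_unit unfolding A4_def \<phi>_def by simp
qed

end

section \<open>Left smash products\<close>

context left_module_algebra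
begin

lemma act_in [simp]: "h \<in> carrier H \<Longrightarrow> a \<in> carrier A \<Longrightarrow> act h a \<in> carrier A"
  by (rule act_closed)

lemma act_lin_l [simp]: "lin K X H f \<Longrightarrow> a \<in> carrier A \<Longrightarrow> lin K X A (\<lambda>x. act (f x) a)"
  by (rule lin_comp[where g="\<lambda>h. act h a"]) (auto intro!: linI simp: act_add_l act_smult_l)

lemma act_lin_r [simp]: "lin K X A f \<Longrightarrow> h \<in> carrier H \<Longrightarrow> lin K X A (\<lambda>x. act h (f x))"
  by (rule lin_comp[where g="\<lambda>a. act h a"]) (auto intro!: linI simp: act_add_r act_smult_r)

declare act_smult_l [simp] act_smult_r [simp] act_one [simp] act_unit [simp] act_prod [simp]

lemma act_act [simp]:
  "h \<in> carrier H \<Longrightarrow> h' \<in> carrier H \<Longrightarrow> a \<in> carrier A \<Longrightarrow> act h (act h' a) = act (h \<otimes>\<^bsub>H\<^esub> h') a"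
  by (simp add: act_mult)

lemma act_prod_sm [simp]:
  assumes "h \<in> carrier H" "a \<in> carrier A" "a' \<in> carrier A"
  shows "act h (a \<otimes>\<^bsub>A\<^esub> a') = sm K H H A (\<Delta> h) (\<lambda>h\<^sub>1 h\<^sub>2. act h\<^sub>1 a \<otimes>\<^bsub>A\<^esub> act h\<^sub>2 a')"
  unfolding act_prod[OF assms] using assms by (intro sw_eq_sm) simp_all

declare act_prod [simp del]

text \<open>Oriented towards right-bracketed products in A. Each use releases one copy of \<Phi>,
  which is the origin of the factor \<open>unit_right K H H H U \<Phi>\<close> in
  \<open>S_assoc_l\<close>.\<close>

lemma quasi_assoc_sm [simp]:
  assumes "a \<in> carrier A" "a' \<in> carrier A" "a'' \<in> carrier A"
  shows "a \<otimes>\<^bsub>A\<^esub> a' \<otimes>\<^bsub>A\<^esub> a'' = sm K H HH A \<Phi> (\<lambda>x s. sm K H H A s (\<lambda>y z.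
    act x a \<otimes>\<^bsub>A\<^esub> (act y a' \<otimes>\<^bsub>A\<^esub> act z a'')))"
  unfolding quasi_assoc[OF assms] tuple_defs using assms by (intro sw_eq_sm) simp_all

end

locale left_smash_setting = left_comodule_algebra K H \<Delta> \<epsilon> \<Phi> U lam \<Phi>lam
    + MA: left_module_algebra K H \<Delta> \<epsilon> \<Phi> A act
  for K :: "'k ring" and H :: "('k, 'h) module" and \<Delta> \<epsilon> \<Phi>
    and U :: "('k, 'u) module" and lam \<Phi>lam and A :: "('k, 'a) module" and act
begin

abbreviation S where "S \<equiv> left_smash K H A act U lam \<Phi>lam"
abbreviation T where "T \<equiv> A \<boxtimes> U"
abbreviation \<phi> where "\<phi> \<equiv> inv\<^bsub>H \<star> H \<star> U\<^esub> \<Phi>lam"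

lemma space_S: "space S = T"
  by (simp add: left_smash_def Let_def)

lemma space_S_eq: "space S = space T"
  by (simp add: space_S)

lemmas S_to_space [simp] = space_rules[OF space_S_eq]

lemma one_S [simp]: "\<one>\<^bsub>S\<^esub> = tens K A U \<one>\<^bsub>A\<^esub> \<one>\<^bsub>U\<^esub>"
  by (simp add: left_smash_def Let_def)

lemma A_assoc_H [simp]:
  "x \<in> carrier H \<Longrightarrow> y \<in> carrier H \<Longrightarrow> z \<in> carrier H \<Longrightarrow> x \<otimes>\<^bsub>H\<^esub> y \<otimes>\<^bsub>H\<^esub> z = x \<otimes>\<^bsub>H\<^esub> (y \<otimes>\<^bsub>H\<^esub> z)"
  "x' \<in> carrier U \<Longrightarrow> y' \<in> carrier U \<Longrightarrow> z' \<in> carrier U \<Longrightarrow> x' \<otimes>\<^bsub>U\<^esub> y' \<otimes>\<^bsub>U\<^esub> z' = x' \<otimes>\<^bsub>U\<^esub> (y' \<otimes>\<^bsub>U\<^esub> z')"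
  by (rule A_assoc U.A_assoc; assumption)+

text \<open>The multiplication of \<open>S\<close> with an arbitrary tensor \<open>P\<close> in place of \<open>\<phi>\<close>: in an iterated product every
  occurrence of \<open>\<phi>\<close> can then be reduced to pure tensors separately.\<close>

definition mult_l where
  "mult_l P s t = sm K A U T s (\<lambda>a u. sm K A U T t (\<lambda>a' u'.
    sm K H HU T P (\<lambda>x\<^sub>1 s. sm K H U T s (\<lambda>x\<^sub>2 x\<^sub>3. sm K H U T (lam u) (\<lambda>u\<^sub>1 u\<^sub>0.
      tens K A U (act x\<^sub>1 a \<otimes>\<^bsub>A\<^esub> act (x\<^sub>2 \<otimes>\<^bsub>H\<^esub> u\<^sub>1) a') (x\<^sub>3 \<otimes>\<^bsub>U\<^esub> (u\<^sub>0 \<otimes>\<^bsub>U\<^esub> u')))))))"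

lemma S_mult:
  assumes "s \<in> carrier T" "t \<in> carrier T"
  shows "s \<otimes>\<^bsub>S\<^esub> t = mult_l \<phi> s t"
proof -
  have "s \<otimes>\<^bsub>S\<^esub> t = sw K T s (\<lambda>a u. sw K T t (\<lambda>a' u'.
    sw K T \<phi> (\<lambda>x\<^sub>1 s. sw K T s (\<lambda>x\<^sub>2 x\<^sub>3. sw K T (lam u) (\<lambda>u\<^sub>1 u\<^sub>0.
      tens K A U (act x\<^sub>1 a \<otimes>\<^bsub>A\<^esub> act (x\<^sub>2 \<otimes>\<^bsub>H\<^esub> u\<^sub>1) a') (x\<^sub>3 \<otimes>\<^bsub>U\<^esub> u\<^sub>0 \<otimes>\<^bsub>U\<^esub> u'))))))"
    by (simp add: left_smash_def Let_def)
  also have "\<dots> = mult_l \<phi> s t"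
    unfolding mult_l_def using assms by (intro sw_eq_sm) simp_all
  finally show ?thesis .
qed

lemma mult_l_in [simp]: "s \<in> carrier T \<Longrightarrow> t \<in> carrier T \<Longrightarrow> mult_l P s t \<in> carrier T"
  by (simp add: mult_l_def)

lemma S_mult_lin:
  "t \<in> carrier T \<Longrightarrow> lin K T T (\<lambda>s. s \<otimes>\<^bsub>S\<^esub> t)"
  "s \<in> carrier T \<Longrightarrow> lin K T T (\<lambda>t. s \<otimes>\<^bsub>S\<^esub> t)"
  by (rule lin_cong, simp, rule S_mult, assumption+, simp add: mult_l_def)
     (rule lin_cong, simp, rule S_mult, assumption+, simp add: mult_l_def)

abbreviation A4 where "A4 \<equiv> H \<star> H \<star> H \<star> U"

text \<open>The first factor u is absent: its iterated coaction is part of t, since that is where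
  quasi-coassociativity has to act on it. The coaction of u' is taken only once and enters both
  bracketings in the same way, so it stays outside.\<close>

definition ev_assoc_l where
  "ev_assoc_l a u' a' a'' u'' t = sm K H HHU T t (\<lambda>h s.
    sm K H HU T s (\<lambda>k r. sm K H U T r (\<lambda>l v. sm K H U T (lam u') (\<lambda>p q.
      tens K A U (act h a \<otimes>\<^bsub>A\<^esub> (act k a' \<otimes>\<^bsub>A\<^esub> act (l \<otimes>\<^bsub>H\<^esub> p) a'')) (v \<otimes>\<^bsub>U\<^esub> (q \<otimes>\<^bsub>U\<^esub> u''))))))"

lemmas maps_sm = map2_1_sm[OF _ _ _ _ Delta_lin] map2_2_sm[OF _ _ _ _ lam_lin]
  map3_1_sm[OF _ _ _ _ _ Delta_lin] map3_2_sm[OF _ _ _ _ _ Delta_lin] map3_3_sm[OF _ _ _ _ _ lam_lin]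
  unit_right_sm unit_left_tens

text \<open>With Q belonging to the outer product, Q^1 acts on a product in A and is split by
  \<Delta>. The outer coaction is applied to P^3 u_[0] u', whence lam on P and the second coaction
  on u.\<close>

lemma S_assoc_l:
  assumes "a \<in> carrier A" "u \<in> carrier U" "a' \<in> carrier A" "u' \<in> carrier U" "a'' \<in> carrier A"
      "u'' \<in> carrier U"
    and PQ: "P \<in> carrier HHU" "Q \<in> carrier HHU"
  shows "mult_l Q (mult_l P (tens K A U a u) (tens K A U a' u')) (tens K A U a'' u'')
    = ev_assoc_l a u' a' a'' u'' (unit_right K H H H U \<Phi> \<otimes>\<^bsub>A4\<^esub> map3_1 K H H H U \<Delta> Q \<otimes>\<^bsub>A4\<^esub>
        map3_3 K H H H U lam P \<otimes>\<^bsub>A4\<^esub> unit_left K H H H U (map2_2 K H H U lam (lam u)))"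
  using assms(1-6)
  apply (simp add: mult_l_def ev_assoc_l_def)
  apply (rule tensor_ext3[of H H U T _ _ P]; (simp add: PQ)?)
  apply (rule tensor_ext3[of H H U T _ _ Q]; (simp add: PQ maps_sm)?)
  apply (rule tensor_ext3[of H H H T _ _ \<Phi>]; simp?)
  apply (rule tensor_ext[of H U T _ _ "lam u"]; simp?)
  apply (rule tensor_ext[of H U T _ _ "lam u'"]; simp?)
  apply (rule sm_comm; simp)
  done

text \<open>With P belonging to the outer product, P^2 u_[-1] acts on a product in A, so \<Delta>
  splits both P^2 and u_[-1]; nothing has to be rebracketed, and \<Phi> does not occur.\<close>

lemma S_assoc_r:
  assumes "a \<in> carrier A" "u \<in> carrier U" "a' \<in> carrier A" "u' \<in> carrier U" "a'' \<in> carrier A"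
      "u'' \<in> carrier U"
    and PQ: "P \<in> carrier HHU" "Q \<in> carrier HHU"
  shows "mult_l P (tens K A U a u) (mult_l Q (tens K A U a' u') (tens K A U a'' u''))
    = ev_assoc_l a u' a' a'' u'' (map3_2 K H H H U \<Delta> P \<otimes>\<^bsub>A4\<^esub>
        unit_left K H H H U (map2_1 K H H U \<Delta> (lam u)) \<otimes>\<^bsub>A4\<^esub> unit_left K H H H U Q)"
  using assms(1-6)
  apply (simp add: mult_l_def ev_assoc_l_def)
  apply (rule tensor_ext3[of H H U T _ _ P]; (simp add: PQ)?)
  apply (rule tensor_ext3[of H H U T _ _ Q]; (simp add: PQ maps_sm)?)
  apply (rule tensor_ext[of H U T _ _ "lam u"]; simp?)
  apply (rule tensor_ext[of H U T _ _ "lam u'"]; simp?)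
  apply (rule sm_comm; simp)
  done

lemma S_k_algebra: "k_algebra K S"
proof (rule k_algebraI[of _ A U, OF space_S _ _ S_mult_lin], simp_all, goal_cases)
  case (1 v w)
  then show ?case by (simp add: S_mult mult_l_def)
next
  case (2 v w)
  then show ?case by (simp add: S_mult mult_l_def)
next
  case (3 a u a' u' a'' u'')
  interpret A3: monoid "H \<star> H \<star> U" by (rule k_algebra_monoid) simp
  interpret A4: monoid A4 by (rule k_algebra_monoid) simp
  have "unit_right K H H H U \<Phi> \<otimes>\<^bsub>A4\<^esub> map3_1 K H H H U \<Delta> \<phi> \<otimes>\<^bsub>A4\<^esub>
        map3_3 K H H H U lam \<phi> \<otimes>\<^bsub>A4\<^esub> unit_left K H H H U (map2_2 K H H U lam (lam u))
      = map3_2 K H H H U \<Delta> \<phi> \<otimes>\<^bsub>A4\<^esub> (unit_left K H H H U \<phi> \<otimes>\<^bsub>A4\<^esub> unit_left K H H H U (map2_2 K H H U lam (lam u)))"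
    using 3 unfolding lam_pentagon_inv by (intro A4.m_assoc) simp_all
  also have "unit_left K H H H U \<phi> \<otimes>\<^bsub>A4\<^esub> unit_left K H H H U (map2_2 K H H U lam (lam u))
      = unit_left K H H H U (map2_1 K H H U \<Delta> (lam u)) \<otimes>\<^bsub>A4\<^esub> unit_left K H H H U \<phi>"
    using 3 by (simp flip: alg_hom_mult[OF alg_hom_unit_left, simplified] add: lam_quasi_coassoc_inv)
  finally show ?case
    using 3 by (simp add: S_mult S_assoc_l S_assoc_r A4.m_assoc)
qed

end

section \<open>Inverted pentagons for right comodule algebras and bicomodule algebras\<close>

context right_comodule_algebra
begin

lemma Phi_rho_in [simp]:
  "\<Phi>\<rho> \<in> carrier UHH"
  "inv\<^bsub>U \<star> H \<star> H\<^esub> \<Phi>\<rho> \<in> carrier UHH"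
  using Phi_rho_unit monoid.Units_closed[OF k_algebra_monoid[of "tensor3 K U H H"], of \<Phi>\<rho>]
    monoid.Units_inv_closed[OF k_algebra_monoid[of "tensor3 K U H H"], of \<Phi>\<rho>] by simp_all

lemma Phi_rho_counits:
  "counit2 U H \<Phi>\<rho> = \<one>\<^bsub>U \<star> H\<^esub>" "counit3 U H \<Phi>\<rho> = \<one>\<^bsub>U \<star> H\<^esub>"
  using Phi_rho_counit_2 Phi_rho_counit_3 counit2_eq[of U H \<Phi>\<rho>] counit3_eq[of U H \<Phi>\<rho>] by simp_all

lemmas Phi_rho_inv_counits = counit2_inv[OF _ _ Phi_rho_unit Phi_rho_counits(1), simplified tuple_defs]
  counit3_inv[OF _ _ Phi_rho_unit Phi_rho_counits(2), simplified tuple_defs]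

lemmas Phi_rho_counits_apply [simp] =
  counit2_apply[OF _ _ _ _ _ Phi_rho_counits(1)] counit3_apply[OF _ _ _ _ _ Phi_rho_counits(2)]
  counit2_apply[OF _ _ _ _ _ Phi_rho_inv_counits(1)] counit3_apply[OF _ _ _ _ _ Phi_rho_inv_counits(2)]

text \<open>All reassociators are inverted, in contrast to \<open>lam_pentagon_inv\<close>, because
  quasi-associativity of B uses the inverse of \<Phi>.\<close>

lemma rho_pentagon_inv:
  defines "A4 \<equiv> U \<star> H \<star> H \<star> H" and "\<phi> \<equiv> inv\<^bsub>U \<star> H \<star> H\<^esub> \<Phi>\<rho>"
    and "\<psi> \<equiv> inv\<^bsub>H \<star> H \<star> H\<^esub> \<Phi>"
  shows "map3_1 K U H H H \<rho> \<phi> \<otimes>\<^bsub>A4\<^esub> map3_3 K U H H H \<Delta> \<phi>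
    = unit_right K U H H H \<phi> \<otimes>\<^bsub>A4\<^esub> map3_2 K U H H H \<Delta> \<phi> \<otimes>\<^bsub>A4\<^esub> unit_left K U H H H \<psi>"
proof -
  interpret A4: monoid A4 unfolding A4_def by (rule k_algebra_monoid) simp
  note U = alg_hom_Units[OF alg_hom_unit_left[of U H H H] _ _ reassoc_unit]
    alg_hom_Units[OF alg_hom_unit_right[of U H H H] _ _ Phi_rho_unit]
    alg_hom_Units[OF alg_hom_map3_1[of U U H H H, OF _ _ _ _ _ rho_hom] _ _ Phi_rho_unit]
    alg_hom_Units[OF alg_hom_map3_2[of H U H H H, OF _ _ _ _ _ comult_hom] _ _ Phi_rho_unit]
    alg_hom_Units[OF alg_hom_map3_3[of H U H H H, OF _ _ _ _ _ comult_hom] _ _ Phi_rho_unit]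
  show ?thesis
    using A4.pentagon_inverse(2)[OF _ _ _ _ _ rho_pentagon[simplified, folded A4_def]] U
    unfolding A4_def \<phi>_def \<psi>_def by simp
qed

lemma rho_quasi_coassoc_inv:
  assumes "u \<in> carrier U"
  shows "map2_1 K U H H \<rho> (\<rho> u) \<otimes>\<^bsub>U \<star> H \<star> H\<^esub> inv\<^bsub>U \<star> H \<star> H\<^esub> \<Phi>\<rho>
    = inv\<^bsub>U \<star> H \<star> H\<^esub> \<Phi>\<rho> \<otimes>\<^bsub>U \<star> H \<star> H\<^esub> map2_2 K U H H \<Delta> (\<rho> u)"
  by (rule monoid.intertwine_inverse[OF k_algebra_monoid])
    (use rho_quasi_coassoc[OF assms] assms Phi_rho_unit in simp_all)

end

context bicomodule_algebra
begin

abbreviation \<theta> where "\<theta> \<equiv> inv\<^bsub>H \<star> U \<star> H\<^esub> \<Phi>lr"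

lemma Phi_lr_in [simp]:
  "\<Phi>lr \<in> carrier HUH"
  "\<theta> \<in> carrier HUH"
  using Phi_lr_unit monoid.Units_closed[OF k_algebra_monoid[of "tensor3 K H U H"], of \<Phi>lr]
    monoid.Units_inv_closed[OF k_algebra_monoid[of "tensor3 K H U H"], of \<Phi>lr] by simp_all

lemma Phi_lr_counits:
  "counit1 U H \<Phi>lr = \<one>\<^bsub>U \<star> H\<^esub>" "counit3 H U \<Phi>lr = \<one>\<^bsub>H \<star> U\<^esub>"
  by (rule counit_slot1[OF _ Phi_lam_counits(1) Phi_lr_unit Phi_lr_pentagon_lam] Phi_lam_in
    counit_slot3[OF _ Phi_rho_counits(1) Phi_lr_unit Phi_lr_pentagon_rho] Phi_rho_in)+

lemmas Phi_lr_inv_counits = counit1_inv[OF _ _ Phi_lr_unit Phi_lr_counits(1), simplified tuple_defs]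
  counit3_inv[OF _ _ Phi_lr_unit Phi_lr_counits(2), simplified tuple_defs]

lemmas Phi_lr_counits_apply [simp] =
  counit1_apply[OF _ _ _ _ Phi_lr_inv_counits(1)] counit3_apply[OF _ _ _ _ _ Phi_lr_inv_counits(2)]

lemma lam_rho_commute_inv:
  assumes "u \<in> carrier U"
  shows "map2_1 K H U H lam (\<rho> u) \<otimes>\<^bsub>H \<star> U \<star> H\<^esub> \<theta>
    = \<theta> \<otimes>\<^bsub>H \<star> U \<star> H\<^esub> map2_2 K H U H \<rho> (lam u)"
  by (rule monoid.intertwine_inverse[OF k_algebra_monoid])
    (use lam_rho_commute[OF assms] assms Phi_lr_unit in simp_all)

text \<open>The first form governs multiplicativity of the coaction on the left smash product, whose
  multiplication contains the inverse of \<Phi>lam. The second governs quasi-coassociativity on the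
  right smash product, whose reassociator contains \<Phi>lam itself.\<close>

lemma Phi_lr_pentagon_lam_inv:
  defines "A4 \<equiv> H \<star> H \<star> U \<star> H" and "\<phi> \<equiv> inv\<^bsub>H \<star> H \<star> U\<^esub> \<Phi>lam"
  shows "map3_1 K H H U H \<Delta> \<theta> \<otimes>\<^bsub>A4\<^esub> map3_3 K H H U H \<rho> \<phi>
      = unit_right K H H U H \<phi> \<otimes>\<^bsub>A4\<^esub> map3_2 K H H U H lam \<theta> \<otimes>\<^bsub>A4\<^esub> unit_left K H H U H \<theta>" (is ?P)
    "map3_2 K H H U H lam \<theta> \<otimes>\<^bsub>A4\<^esub> unit_left K H H U H \<theta> \<otimes>\<^bsub>A4\<^esub> map3_3 K H H U H \<rho> \<Phi>lam
      = unit_right K H H U H \<Phi>lam \<otimes>\<^bsub>A4\<^esub> map3_1 K H H U H \<Delta> \<theta>" (is ?Q)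
proof -
  interpret A4: monoid A4 unfolding A4_def by (rule k_algebra_monoid) simp
  note U = alg_hom_Units[OF alg_hom_unit_left[of H H U H] _ _ Phi_lr_unit]
    alg_hom_Units[OF alg_hom_unit_right[of H H U H] _ _ Phi_lam_unit]
    alg_hom_Units[OF alg_hom_map3_1[of H H H U H, OF _ _ _ _ _ comult_hom] _ _ Phi_lr_unit]
    alg_hom_Units[OF alg_hom_map3_2[of U H H U H, OF _ _ _ _ _ lam_hom] _ _ Phi_lr_unit]
    alg_hom_Units[OF alg_hom_map3_3[of U H H U H, OF _ _ _ _ _ rho_hom] _ _ Phi_lam_unit]
  show ?P ?Q
    using A4.pentagon_inverse(2,4)[OF _ _ _ _ _ Phi_lr_pentagon_lam[simplified, folded A4_def]] U
    unfolding A4_def \<phi>_def by simp_all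
qed

text \<open>With the sides exchanged: the first form, with the inverse of \<Phi>\<rho>, is for
  multiplicativity on the right smash product, the second, with \<Phi>\<rho> itself, for
  quasi-coassociativity on the left one.\<close>

lemma Phi_lr_pentagon_rho_inv:
  defines "A4 \<equiv> H \<star> U \<star> H \<star> H" and "\<phi> \<equiv> inv\<^bsub>U \<star> H \<star> H\<^esub> \<Phi>\<rho>"
  shows "map3_1 K H U H H lam \<phi> \<otimes>\<^bsub>A4\<^esub> map3_3 K H U H H \<Delta> \<theta>
      = unit_right K H U H H \<theta> \<otimes>\<^bsub>A4\<^esub> map3_2 K H U H H \<rho> \<theta> \<otimes>\<^bsub>A4\<^esub> unit_left K H U H H \<phi>" (is ?P)
    "map3_3 K H U H H \<Delta> \<theta> \<otimes>\<^bsub>A4\<^esub> unit_left K H U H H \<Phi>\<rho>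
      = map3_1 K H U H H lam \<Phi>\<rho> \<otimes>\<^bsub>A4\<^esub> unit_right K H U H H \<theta> \<otimes>\<^bsub>A4\<^esub> map3_2 K H U H H \<rho> \<theta>" (is ?Q)
proof -
  interpret A4: monoid A4 unfolding A4_def by (rule k_algebra_monoid) simp
  note U = alg_hom_Units[OF alg_hom_unit_left[of H U H H] _ _ Phi_rho_unit]
    alg_hom_Units[OF alg_hom_unit_right[of H U H H] _ _ Phi_lr_unit]
    alg_hom_Units[OF alg_hom_map3_1[of U H U H H, OF _ _ _ _ _ lam_hom] _ _ Phi_rho_unit]
    alg_hom_Units[OF alg_hom_map3_2[of U H U H H, OF _ _ _ _ _ rho_hom] _ _ Phi_lr_unit]
    alg_hom_Units[OF alg_hom_map3_3[of H H U H H, OF _ _ _ _ _ comult_hom] _ _ Phi_lr_unit]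
  show ?P ?Q
    using A4.pentagon_inverse(2,3)[OF _ _ _ _ _ Phi_lr_pentagon_rho[simplified, folded A4_def]] U
    unfolding A4_def \<phi>_def by simp_all
qed

end

section \<open>The right comodule algebra structure on the left smash product\<close>

locale left_smash_bicomodule =
  bicomodule_algebra K H \<Delta> \<epsilon> \<Phi> U lam \<rho> \<Phi>lam \<Phi>\<rho> \<Phi>lr + MA: left_module_algebra K H \<Delta> \<epsilon> \<Phi> A act
  for K :: "'k ring" and H :: "('k, 'h) module" and \<Delta> \<epsilon> \<Phi>
    and U :: "('k, 'u) module" and lam \<rho> \<Phi>lam \<Phi>\<rho> \<Phi>lr and A :: "('k, 'a) module" and act
begin

sublocale left_smash_setting K H \<Delta> \<epsilon> \<Phi> U lam \<Phi>lam A act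
  by unfold_locales

declare S_k_algebra [simp] space_S [simp]

abbreviation R where "R \<equiv> left_smash_coact K H A act U lam \<rho> \<Phi>lam \<Phi>lr"
abbreviation TH where "TH \<equiv> T \<boxtimes> H"
abbreviation THH where "THH \<equiv> T \<boxtimes> HH"

text \<open>The tensor P stands for \<theta>. Iterated coactions and products of coactions contain
  \<theta> twice, and the two occurrences must be varied independently.\<close>

definition coact_l where
  "coact_l P = (\<lambda>t. sm K A U TH t (\<lambda>a u. sm K H UH TH P (\<lambda>x s. sm K U H TH s (\<lambda>y z.
    sm K U H TH (\<rho> u) (\<lambda>p q. tens K T H (tens K A U (act x a) (y \<otimes>\<^bsub>U\<^esub> p)) (z \<otimes>\<^bsub>H\<^esub> q))))))"

lemma R_coact_l: "t \<in> carrier T \<Longrightarrow> R t = coact_l \<theta> t"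
  unfolding left_smash_coact_def coact_l_def Let_def tuple_defs S_to_space tensor_to_space
  by (intro sw_eq_sm) simp_all

lemma coact_l_in [simp]: "coact_l P t \<in> carrier TH"
  by (simp add: coact_l_def)

lemma coact_l_lin [simp]: "lin K X T f \<Longrightarrow> lin K X TH (\<lambda>x. coact_l P (f x))"
  by (simp add: coact_l_def)

lemma R_lin [simp]: "lin K T TH R"
  by (rule lin_cong[where g="coact_l \<theta>"]) (simp_all add: R_coact_l)

text \<open>A leg of \<phi> acts on the unit of A through \<epsilon>, so the normalisations of
  \<phi> remove it from the product. The same reason, for the other leg, gives
  \<open>S_one_r\<close>.\<close>

lemma S_one_l:
  assumes "a \<in> carrier A" "u \<in> carrier U" "v \<in> carrier U"
  shows "tens K A U \<one>\<^bsub>A\<^esub> v \<otimes>\<^bsub>S\<^esub> tens K A U a u =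
    sm K H U T (lam v) (\<lambda>p q. tens K A U (act p a) (q \<otimes>\<^bsub>U\<^esub> u))"
  using assms by (simp add: S_mult mult_l_def)

lemma S_one_r:
  assumes "a \<in> carrier A" "u \<in> carrier U" "v \<in> carrier U"
  shows "tens K A U a u \<otimes>\<^bsub>S\<^esub> tens K A U \<one>\<^bsub>A\<^esub> v = tens K A U a (u \<otimes>\<^bsub>U\<^esub> v)"
  using assms by (simp add: S_mult mult_l_def)

text \<open>Again u is absent: the tensor t contains its two coactions, lam and \<rho>, whose
  commutation up to \<theta> is the point of the argument.\<close>

definition ev_mult_l where
  "ev_mult_l a a' u' t = sm K H HUH TH t (\<lambda>h s.
    sm K H UH TH s (\<lambda>k r. sm K U H TH r (\<lambda>v m. sm K U H TH (\<rho> u') (\<lambda>p q.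
      tens K T H (tens K A U (act h a \<otimes>\<^bsub>A\<^esub> act k a') (v \<otimes>\<^bsub>U\<^esub> p)) (m \<otimes>\<^bsub>H\<^esub> q)))))"

abbreviation A5 where "A5 \<equiv> H \<star> H \<star> U \<star> H"

lemmas maps2_sm = map2_1_sm[OF _ _ _ _ lam_lin] map2_2_sm[OF _ _ _ _ rho_lin]
  map2_1_sm[OF _ _ _ _ rho_lin] map2_2_sm[OF _ _ _ _ Delta_lin]
  map3_1_sm[OF _ _ _ _ _ Delta_lin] map3_2_sm[OF _ _ _ _ _ lam_lin] map3_3_sm[OF _ _ _ _ _ rho_lin]
  map3_1_sm[OF _ _ _ _ _ lam_lin] map3_2_sm[OF _ _ _ _ _ rho_lin] map3_3_sm[OF _ _ _ _ _ Delta_lin]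
  unit_right_sm unit_left_tens

text \<open>Q^1 acts on a product in A, whence \<Delta> on Q. The coaction \<rho> meets the product
  P^3 u_[0] u', whence \<rho> on P and on u_[0].\<close>

lemma R_mult_l:
  assumes "a \<in> carrier A" "u \<in> carrier U" "a' \<in> carrier A" "u' \<in> carrier U"
    and PQ: "P \<in> carrier HHU" "Q \<in> carrier HUH"
  shows "coact_l Q (mult_l P (tens K A U a u) (tens K A U a' u'))
    = ev_mult_l a a' u' (map3_1 K H H U H \<Delta> Q \<otimes>\<^bsub>A5\<^esub> map3_3 K H H U H \<rho> P \<otimes>\<^bsub>A5\<^esub>
        unit_left K H H U H (map2_2 K H U H \<rho> (lam u)))"
  using assms(1-4)
  apply (simp add: mult_l_def coact_l_def ev_mult_l_def)
  apply (rule tensor_ext3[of H H U TH _ _ P]; (simp add: PQ)?)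
  apply (rule tensor_ext3[of H U H TH _ _ Q]; (simp add: PQ maps2_sm)?)
  apply (rule tensor_ext[of H U TH _ _ "lam u"]; simp?)
  apply (rule tensor_ext[of U H TH _ _ "\<rho> u'"]; simp?)
  apply (rule sm_comm; simp)
  done

text \<open>Here the product is formed after coacting. Its left coaction lam meets Q^2 u_<0>, whence
  lam on Q and on u_<0>, and \<phi> comes from the multiplication of the left smash product.\<close>

lemma R_mult_r:
  assumes "a \<in> carrier A" "u \<in> carrier U" "a' \<in> carrier A" "u' \<in> carrier U"
    and PQ: "P \<in> carrier HUH" "Q \<in> carrier HUH"
  shows "coact_l Q (tens K A U a u) \<otimes>\<^bsub>S \<star> H\<^esub> coact_l P (tens K A U a' u')
    = ev_mult_l a a' u' (unit_right K H H U H \<phi> \<otimes>\<^bsub>A5\<^esub> map3_2 K H H U H lam Q \<otimes>\<^bsub>A5\<^esub>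
        unit_left K H H U H (map2_1 K H U H lam (\<rho> u)) \<otimes>\<^bsub>A5\<^esub> unit_left K H H U H P)"
  using assms(1-4)
  apply (simp add: mult_l_def coact_l_def ev_mult_l_def S_mult)
  apply (rule tensor_ext3[of H U H TH _ _ P]; (simp add: PQ)?)
  apply (rule tensor_ext3[of H U H TH _ _ Q]; (simp add: PQ maps2_sm)?)
  apply (rule tensor_ext3[of H H U TH _ _ \<phi>]; simp?)
  apply (rule tensor_ext[of U H TH _ _ "\<rho> u"]; simp?)
  apply (rule tensor_ext[of U H TH _ _ "\<rho> u'"]; simp?)
  apply (rule sm_comm; simp)
  done

lemma R_hom: "alg_hom K S (S \<star> H) R"
proof (rule alg_hom_tensorI[of _ _ A U])
  fix a u a' u'
  assume [simp]: "a \<in> carrier A" "u \<in> carrier U" "a' \<in> carrier A" "u' \<in> carrier U"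
  let ?l = "unit_left K H H U H"
  interpret A5: monoid A5 by (rule k_algebra_monoid) simp
  have *: "?l (map2_1 K H U H lam (\<rho> u)) \<otimes>\<^bsub>A5\<^esub> ?l \<theta> = ?l \<theta> \<otimes>\<^bsub>A5\<^esub> ?l (map2_2 K H U H \<rho> (lam u))"
    by (simp flip: alg_hom_mult[OF alg_hom_unit_left, simplified] add: lam_rho_commute_inv)
  have "map3_1 K H H U H \<Delta> \<theta> \<otimes>\<^bsub>A5\<^esub> map3_3 K H H U H \<rho> \<phi> \<otimes>\<^bsub>A5\<^esub> ?l (map2_2 K H U H \<rho> (lam u))
      = unit_right K H H U H \<phi> \<otimes>\<^bsub>A5\<^esub> map3_2 K H H U H lam \<theta> \<otimes>\<^bsub>A5\<^esub>
        (?l (map2_1 K H U H lam (\<rho> u)) \<otimes>\<^bsub>A5\<^esub> ?l \<theta>)"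
    unfolding Phi_lr_pentagon_lam_inv(1) * by (simp add: A5.m_assoc)
  then show "R (tens K A U a u \<otimes>\<^bsub>S\<^esub> tens K A U a' u')
      = R (tens K A U a u) \<otimes>\<^bsub>S \<star> H\<^esub> R (tens K A U a' u')"
    by (simp add: R_coact_l S_mult R_mult_l R_mult_r A5.m_assoc)
qed (simp_all add: R_lin, simp add: R_coact_l coact_l_def)

definition ev_coassoc_l where
  "ev_coassoc_l a t = sm K H UHH THH t (\<lambda>h s.
    sm K U HH THH s (\<lambda>v r.
      tens K T HH (tens K A U (act h a) v) r))"

text \<open>The embedding u \<mapsto> 1 # u tensored with the identity of Z. The factor Z is a
  parameter because the reassociator needs H \<otimes> H and its pentagon needs H \<otimes> H
  \<otimes> H.\<close>

definition J where
  "J Z t = sm K U Z (T \<boxtimes> Z) t (\<lambda>u z. tens K T Z (tens K A U \<one>\<^bsub>A\<^esub> u) z)"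

lemma J_space: "space Z = space Z' \<Longrightarrow> J Z = J Z'"
  using tens_space[of T T Z Z' K] tensor_space_space[of T T Z Z' K] sm_space[of U U Z Z' "T \<boxtimes> Z" "T \<boxtimes> Z'"]
  by (simp add: J_def fun_eq_iff)

lemma J_lin [simp]: "module K Z \<Longrightarrow> lin K X (U \<boxtimes> Z) f \<Longrightarrow> lin K X (T \<boxtimes> Z) (\<lambda>x. J Z (f x))"
  by (simp add: J_def)

lemma J_in [simp]: "module K Z \<Longrightarrow> J Z t \<in> carrier (T \<boxtimes> Z)"
  by (simp add: J_def)

lemma J_tens [simp]: "module K Z \<Longrightarrow> u \<in> carrier U \<Longrightarrow> z \<in> carrier Z
    \<Longrightarrow> J Z (tens K U Z u z) = tens K T Z (tens K A U \<one>\<^bsub>A\<^esub> u) z"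
  by (simp add: J_def)

lemma J_hom: "k_algebra K Z \<Longrightarrow> alg_hom K (U \<star> Z) (S \<star> Z) (J Z)"
  by (rule alg_hom_tensorI[of _ _ U Z]) (simp_all add: S_one_r)

abbreviation PS where "PS \<equiv> left_smash_reassoc K H A act U lam \<Phi>lam \<Phi>\<rho>"

lemma PS_J: "PS = J HH \<Phi>\<rho>"
proof -
  have "PS = sm K U HH THH \<Phi>\<rho> (\<lambda>x s.
    sm K H H THH s (\<lambda>y z.
      tens K T HH (tens K A U \<one>\<^bsub>A\<^esub> x) (tens K H H y z)))"
    unfolding left_smash_reassoc_def Let_def tuple_defs S_to_space tensor_to_space
    by (intro sw_eq_sm) simp_all
  then show ?thesis by (simp add: J_def flip: sm_tens_r)
qed

abbreviation A6 where "A6 \<equiv> H \<star> U \<star> H \<star> H"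
lemmas maps3_sm = map2_2_sm[of H S H H \<Delta>] map3_1_sm[of S S H H H R] map3_2_sm[of H S H H H \<Delta>]
  map3_3_sm[of H S H H H \<Delta>]

text \<open>Multiplying by \<open>J HH X\<close> from the left is where lam enters: by
  \<open>S_one_l\<close> the first leg of X acts on a through its left coaction. The outer coaction
  meets Q^2 u_<0>, which gives \<rho> on Q and the twofold coaction on u.\<close>

lemma R_coassoc_l:
  assumes "a \<in> carrier A" "u \<in> carrier U"
    and PQ: "P \<in> carrier HUH" "X \<in> carrier UHH"
      "Q \<in> carrier HUH"
  shows "J HH X \<otimes>\<^bsub>S \<star> H \<star> H\<^esub> map2_1 K S H H (coact_l P) (coact_l Q (tens K A U a u))
    = ev_coassoc_l a (map3_1 K H U H H lam X \<otimes>\<^bsub>A6\<^esub> unit_right K H U H H P \<otimes>\<^bsub>A6\<^esub>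
        map3_2 K H U H H \<rho> Q \<otimes>\<^bsub>A6\<^esub> unit_left K H U H H (map2_1 K U H H \<rho> (\<rho> u)))"
  using assms(1-2)
  apply (simp add: map2_1_sm[of T S H H "coact_l P"] ev_coassoc_l_def)
  apply (rule tensor_ext3[of U H H THH _ _ X]; (simp add: PQ)?)
  apply (rule tensor_ext3[of H U H THH _ _ P]; (simp add: PQ coact_l_def maps2_sm)?)
  apply (rule tensor_ext3[of H U H THH _ _ Q]; (simp add: PQ S_one_l)?)
  apply (rule tensor_ext[of U H THH _ _ "\<rho> u"]; simp?)
  apply (rule sm_comm; simp)
  done

text \<open>By \<open>S_one_r\<close>, multiplying by 1 # x from the right leaves the factor in A
  untouched, so X occurs without any coaction applied to it.\<close>

lemma R_coassoc_r:
  assumes "a \<in> carrier A" "u \<in> carrier U"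
    and PQ: "P \<in> carrier HUH" "X \<in> carrier UHH"
  shows "map2_2 K S H H \<Delta> (coact_l P (tens K A U a u)) \<otimes>\<^bsub>S \<star> H \<star> H\<^esub> J HH X
    = ev_coassoc_l a (map3_3 K H U H H \<Delta> P \<otimes>\<^bsub>A6\<^esub> unit_left K H U H H (map2_2 K U H H \<Delta> (\<rho> u))
        \<otimes>\<^bsub>A6\<^esub> unit_left K H U H H X)"
  using assms(1-2)
  apply (simp add: maps3_sm ev_coassoc_l_def)
  apply (rule tensor_ext3[of U H H THH _ _ X]; (simp add: PQ)?)
  apply (rule tensor_ext3[of H U H THH _ _ P]; (simp add: PQ coact_l_def maps2_sm)?)
  apply (rule tensor_ext[of U H THH _ _ "\<rho> u"]; (simp add: S_one_r)?)
  apply (rule sm_comm; simp)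
  done

lemma R_quasi_coassoc:
  assumes "s \<in> carrier T"
  shows "PS \<otimes>\<^bsub>S \<star> H \<star> H\<^esub> map2_1 K S H H R (R s)
    = map2_2 K S H H \<Delta> (R s) \<otimes>\<^bsub>S \<star> H \<star> H\<^esub> PS"
proof (rule tensor_ext[of A U THH _ _ s])
  note [simp] = alg_hom_lin_comp[OF alg_hom_map2_1[OF _ _ _ _ R_hom], simplified]
    alg_hom_lin_comp[OF alg_hom_map2_2[of H S H H \<Delta>, OF _ _ _ _ comult_hom], simplified]
    lin_closed[OF R_lin] lin_comp[OF _ R_lin]
  show "lin K T THH (\<lambda>s. PS \<otimes>\<^bsub>S \<star> H \<star> H\<^esub> map2_1 K S H H R (R s))"
    "lin K T THH (\<lambda>s. map2_2 K S H H \<Delta> (R s) \<otimes>\<^bsub>S \<star> H \<star> H\<^esub> PS)"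
    by (simp_all add: PS_J)
  fix a u assume [simp]: "a \<in> carrier A" "u \<in> carrier U"
  interpret A6: monoid A6 by (rule k_algebra_monoid) simp
  let ?l = "unit_left K H U H H"
  have *: "?l \<Phi>\<rho> \<otimes>\<^bsub>A6\<^esub> ?l (map2_1 K U H H \<rho> (\<rho> u)) = ?l (map2_2 K U H H \<Delta> (\<rho> u)) \<otimes>\<^bsub>A6\<^esub> ?l \<Phi>\<rho>"
    by (simp flip: alg_hom_mult[OF alg_hom_unit_left, simplified] add: rho_quasi_coassoc[simplified])
  have "map3_1 K H U H H lam \<Phi>\<rho> \<otimes>\<^bsub>A6\<^esub> unit_right K H U H H \<theta> \<otimes>\<^bsub>A6\<^esub> map3_2 K H U H H \<rho> \<theta> \<otimes>\<^bsub>A6\<^esub>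
        ?l (map2_1 K U H H \<rho> (\<rho> u))
      = map3_3 K H U H H \<Delta> \<theta> \<otimes>\<^bsub>A6\<^esub> (?l (map2_2 K U H H \<Delta> (\<rho> u)) \<otimes>\<^bsub>A6\<^esub> ?l \<Phi>\<rho>)"
    unfolding Phi_lr_pentagon_rho_inv(2)[symmetric] *[symmetric] by (simp add: A6.m_assoc)
  moreover have "map2_1 K S H H R (R (tens K A U a u))
      = map2_1 K S H H (coact_l \<theta>) (coact_l \<theta> (tens K A U a u))"
    by (simp add: map2_1_sm[of T S H H R] map2_1_sm[of T S H H "coact_l \<theta>"] R_coact_l)
  ultimately show "PS \<otimes>\<^bsub>S \<star> H \<star> H\<^esub> map2_1 K S H H R (R (tens K A U a u))
      = map2_2 K S H H \<Delta> (R (tens K A U a u)) \<otimes>\<^bsub>S \<star> H \<star> H\<^esub> PS"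
    by (simp add: PS_J R_coassoc_l R_coact_l R_coassoc_r A6.m_assoc)
qed (use assms in simp_all)

text \<open>The explicit inverse is what the multiplication of the iterated smash product refers
  to.\<close>

lemma PS_Units: "PS \<in> Units (tensor3 K S H H)"
  "inv\<^bsub>tensor3 K S H H\<^esub> PS = J HH (inv\<^bsub>tensor3 K U H H\<^esub> \<Phi>\<rho>)"
  using alg_hom_Units[OF J_hom[of "H \<star> H"] _ _ Phi_rho_unit[simplified]]
    J_space[of "H \<star> H" "H \<boxtimes> H"]
  by (simp_all add: PS_J)

lemma J_maps:
  "t \<in> carrier HHH \<Longrightarrow> unit_left K S H H H t = J HHH (unit_left K U H H H t)" (is "PROP ?l")
  "s \<in> carrier UHH \<Longrightarrow>
    map3_2 K S H H H \<Delta> (J HH s) = J HHH (map3_2 K U H H H \<Delta> s)" (is "PROP ?m2")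
  "s \<in> carrier UHH \<Longrightarrow>
    map3_3 K S H H H \<Delta> (J HH s) = J HHH (map3_3 K U H H H \<Delta> s)" (is "PROP ?m3")
  "s \<in> carrier UHH \<Longrightarrow>
    map3_1 K S H H H R (J HH s) = J HHH (map3_1 K U H H H \<rho> s)" (is "PROP ?m1")
  "s \<in> carrier UHH \<Longrightarrow>
    unit_right K S H H H (J HH s) = J HHH (unit_right K U H H H s)" (is "PROP ?r")
proof -
  \<comment> \<open>On 1 # u the leg \<theta>^1 acts on the unit of A through \<epsilon>, and
    (\<epsilon> \<otimes> id \<otimes> id) \<theta> = 1 deletes \<theta>. Hence \<open>J\<close>
    intertwines \<rho> with the new coaction.\<close>
  have R1: "R (tens K A U \<one>\<^bsub>A\<^esub> u) = sm K U H TH (\<rho> u) (\<lambda>p q. tens K T H (tens K A U \<one>\<^bsub>A\<^esub> p) q)"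
    if "u \<in> carrier U" for u
    using that by (simp add: R_coact_l coact_l_def)
  note [simp] = maps3_sm maps2_sm R1 map3_2_sm[of H U H H H \<Delta>] map3_1_sm[of U U H H H \<rho>]
      map3_3_sm[of H U H H H \<Delta>]
  show "PROP ?l" by simp
  note ext = tensor_ext3[of U H H "T \<boxtimes> HHH" _ _ s]
  show "PROP ?m2" by (rule ext) (simp_all add: J_def)
  show "PROP ?m3" by (rule ext) (simp_all add: J_def)
  show "PROP ?m1" by (rule ext) (simp_all add: J_def)
  show "PROP ?r" by (rule ext) (simp_all add: J_def)
qed

theorem left_smash_right_comodule_algebra: "right_comodule_algebra K H \<Delta> \<epsilon> \<Phi> S R PS"
proof (intro right_comodule_algebra.intro right_comodule_algebra_axioms.intro)
  show "quasi_bialgebra K H \<Delta> \<epsilon> \<Phi>" by (rule quasi_bialgebra_axioms)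
  show "k_algebra K S" by simp
  show "alg_hom K S (S \<star> H) R" by (rule R_hom)
  show "PS \<in> Units (tensor3 K S H H)" by (rule PS_Units)
  show "PS \<otimes>\<^bsub>tensor3 K S H H\<^esub> map2_1 K S H H R (R u) = map2_2 K S H H \<Delta> (R u) \<otimes>\<^bsub>tensor3 K S H H\<^esub> PS"
    if "u \<in> carrier S" for u
    using R_quasi_coassoc[of u] that by simp
  note J4 = alg_hom_mult[OF J_hom[of "H \<star> H \<star> H"], simplified]
  have JJ: "J (H \<star> H \<star> H) = J HHH"
    by (rule J_space) simp
  show "unit_left K S H H H \<Phi> \<otimes>\<^bsub>tensor4 K S H H H\<^esub> map3_2 K S H H H \<Delta> PS
      \<otimes>\<^bsub>tensor4 K S H H H\<^esub> unit_right K S H H H PS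
      = map3_3 K S H H H \<Delta> PS \<otimes>\<^bsub>tensor4 K S H H H\<^esub> map3_1 K S H H H R PS"
    using rho_pentagon by (simp add: PS_J J_maps flip: J4[unfolded JJ])
  show "sw K S (R s) (\<lambda>u\<^sub>0 u\<^sub>1. \<epsilon> u\<^sub>1 \<odot>\<^bsub>S\<^esub> u\<^sub>0) = s" if "s \<in> carrier S" for s
  proof -
    have s: "s \<in> carrier T" using that by simp
    have "sw K T (coact_l \<theta> s) (\<lambda>u\<^sub>0 u\<^sub>1. \<epsilon> u\<^sub>1 \<odot>\<^bsub>T\<^esub> u\<^sub>0) = sm K T H T (coact_l \<theta> s) (\<lambda>u\<^sub>0 u\<^sub>1. \<epsilon> u\<^sub>1 \<odot>\<^bsub>T\<^esub> u\<^sub>0)"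
      using s by (intro sw_eq_sm) simp_all
    also have "\<dots> = s"
      \<comment> \<open>The last leg becomes \<epsilon>(\<theta>^3) \<epsilon>(u_<1>). The first
        scalar is removed by (id \<otimes> id \<otimes> \<epsilon>) \<theta> = 1, the second by the
        counit law of \<rho>.\<close>
      by (rule tensor_ext[of A U T _ _ s]) (use s in \<open>simp_all, simp add: coact_l_def\<close>)
    finally show ?thesis using s by (simp add: R_coact_l)
  qed
  have counits: "counit2 S H PS = \<one>\<^bsub>S \<star> H\<^esub>" "counit3 S H PS = \<one>\<^bsub>S \<star> H\<^esub>"
    by (simp_all add: PS_J counit2_def counit3_def J_def)
  show "sw3 K (S \<star> H) PS (\<lambda>x y z. \<epsilon> y \<odot>\<^bsub>S \<star> H\<^esub> tens K S H x z) = \<one>\<^bsub>S \<star> H\<^esub>"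
    by (subst counit2_eq) (simp_all add: PS_J[symmetric] counits, simp add: PS_J)
  show "sw3 K (S \<star> H) PS (\<lambda>x y z. \<epsilon> z \<odot>\<^bsub>S \<star> H\<^esub> tens K S H x y) = \<one>\<^bsub>S \<star> H\<^esub>"
    by (subst counit3_eq) (simp_all add: PS_J[symmetric] counits, simp add: PS_J)
qed

end

section \<open>Right smash products\<close>

context right_module_algebra
begin

lemma act_in [simp]: "b \<in> carrier B \<Longrightarrow> h \<in> carrier H \<Longrightarrow> act b h \<in> carrier B"
  by (rule act_closed)

lemma act_lin_l [simp]: "lin K X B f \<Longrightarrow> h \<in> carrier H \<Longrightarrow> lin K X B (\<lambda>x. act (f x) h)"
  by (rule lin_comp[where g="\<lambda>b. act b h"]) (auto intro!: linI simp: act_add_l act_smult_l)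

lemma act_lin_r [simp]: "lin K X H f \<Longrightarrow> b \<in> carrier B \<Longrightarrow> lin K X B (\<lambda>x. act b (f x))"
  by (rule lin_comp[where g="\<lambda>h. act b h"]) (auto intro!: linI simp: act_add_r act_smult_r)

declare act_smult_l [simp] act_smult_r [simp] act_one [simp] act_unit [simp]

lemma act_act [simp]:
  "b \<in> carrier B \<Longrightarrow> h \<in> carrier H \<Longrightarrow> h' \<in> carrier H \<Longrightarrow> act (act b h) h' = act b (h \<otimes>\<^bsub>H\<^esub> h')"
  by (simp add: act_mult)

lemma act_prod_sm [simp]:
  assumes "b \<in> carrier B" "b' \<in> carrier B" "h \<in> carrier H"
  shows "act (b \<otimes>\<^bsub>B\<^esub> b') h = sm K H H B (\<Delta> h) (\<lambda>h\<^sub>1 h\<^sub>2. act b h\<^sub>1 \<otimes>\<^bsub>B\<^esub> act b' h\<^sub>2)"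
  unfolding act_prod[OF assms] using assms by (intro sw_eq_sm) simp_all

lemma quasi_assoc_sm [simp]:
  assumes "b \<in> carrier B" "b' \<in> carrier B" "b'' \<in> carrier B"
  shows "b \<otimes>\<^bsub>B\<^esub> b' \<otimes>\<^bsub>B\<^esub> b'' = sm K H HH B (inv\<^bsub>H \<star> H \<star> H\<^esub> \<Phi>)
    (\<lambda>x s. sm K H H B s (\<lambda>y z. act b x \<otimes>\<^bsub>B\<^esub> (act b' y \<otimes>\<^bsub>B\<^esub> act b'' z)))"
  unfolding quasi_assoc[OF assms] tuple_defs using assms by (intro sw_eq_sm) simp_all

end

locale right_smash_setting = right_comodule_algebra K H \<Delta> \<epsilon> \<Phi> U \<rho> \<Phi>\<rho>
    + MB: right_module_algebra K H \<Delta> \<epsilon> \<Phi> B actB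
  for K :: "'k ring" and H :: "('k, 'h) module" and \<Delta> \<epsilon> \<Phi>
    and U :: "('k, 'u) module" and \<rho> \<Phi>\<rho> and B :: "('k, 'b) module" and actB
begin

abbreviation SB where "SB \<equiv> right_smash K H U \<rho> \<Phi>\<rho> B actB"
abbreviation TB where "TB \<equiv> U \<boxtimes> B"
abbreviation \<psi> where "\<psi> \<equiv> inv\<^bsub>U \<star> H \<star> H\<^esub> \<Phi>\<rho>"
abbreviation \<Psi> where "\<Psi> \<equiv> inv\<^bsub>H \<star> H \<star> H\<^esub> \<Phi>"

lemma space_SB [simp]: "space SB = TB"
  by (simp add: right_smash_def Let_def)

lemma space_SB_eq: "space SB = space TB"
  by simp

lemmas SB_to_space [simp] = space_rules[OF space_SB_eq]

lemma one_SB [simp]: "\<one>\<^bsub>SB\<^esub> = tens K U B \<one>\<^bsub>U\<^esub> \<one>\<^bsub>B\<^esub>"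
  by (simp add: right_smash_def Let_def)

lemma assoc_UH [simp]:
  "x \<in> carrier H \<Longrightarrow> y \<in> carrier H \<Longrightarrow> z \<in> carrier H \<Longrightarrow> x \<otimes>\<^bsub>H\<^esub> y \<otimes>\<^bsub>H\<^esub> z = x \<otimes>\<^bsub>H\<^esub> (y \<otimes>\<^bsub>H\<^esub> z)"
  "x' \<in> carrier U \<Longrightarrow> y' \<in> carrier U \<Longrightarrow> z' \<in> carrier U \<Longrightarrow> x' \<otimes>\<^bsub>U\<^esub> y' \<otimes>\<^bsub>U\<^esub> z' = x' \<otimes>\<^bsub>U\<^esub> (y' \<otimes>\<^bsub>U\<^esub> z')"
  by (rule A_assoc U.A_assoc; assumption)+

definition mult_r where
  "mult_r P s t = sm K U B TB s (\<lambda>u b. sm K U B TB t (\<lambda>u' b'. sm K U H TB (\<rho> u') (\<lambda>p q.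
    sm K U HH TB P (\<lambda>x s. sm K H H TB s (\<lambda>y z.
      tens K U B (u \<otimes>\<^bsub>U\<^esub> (p \<otimes>\<^bsub>U\<^esub> x)) (actB b (q \<otimes>\<^bsub>H\<^esub> y) \<otimes>\<^bsub>B\<^esub> actB b' z))))))"

lemma SB_mult:
  assumes "s \<in> carrier TB" "t \<in> carrier TB"
  shows "s \<otimes>\<^bsub>SB\<^esub> t = mult_r \<psi> s t"
proof -
  have "s \<otimes>\<^bsub>SB\<^esub> t = sw K TB s (\<lambda>u b. sw K TB t (\<lambda>u' b'. sw K TB (\<rho> u') (\<lambda>p q.
    sw K TB \<psi> (\<lambda>x s. sw K TB s (\<lambda>y z.
      tens K U B (u \<otimes>\<^bsub>U\<^esub> p \<otimes>\<^bsub>U\<^esub> x) (actB b (q \<otimes>\<^bsub>H\<^esub> y) \<otimes>\<^bsub>B\<^esub> actB b' z))))))"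
    by (simp add: right_smash_def Let_def)
  also have "\<dots> = mult_r \<psi> s t"
    unfolding mult_r_def using assms by (intro sw_eq_sm) simp_all
  finally show ?thesis .
qed

lemma mult_r_in [simp]: "s \<in> carrier TB \<Longrightarrow> t \<in> carrier TB \<Longrightarrow> mult_r P s t \<in> carrier TB"
  by (simp add: mult_r_def)

lemma SB_mult_lin:
  "t \<in> carrier TB \<Longrightarrow> lin K TB TB (\<lambda>s. s \<otimes>\<^bsub>SB\<^esub> t)"
  "s \<in> carrier TB \<Longrightarrow> lin K TB TB (\<lambda>t. s \<otimes>\<^bsub>SB\<^esub> t)"
  by (rule lin_cong, simp, rule SB_mult, assumption+, simp add: mult_r_def)
     (rule lin_cong, simp, rule SB_mult, assumption+, simp add: mult_r_def)

abbreviation B4 where "B4 \<equiv> U \<star> H \<star> H \<star> H"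

text \<open>Here it is the last factor u'' that is absent: it coacts on everything to its left, and
  its iterated coaction is part of t.\<close>

definition ev_assoc_r where
  "ev_assoc_r u b u' b' b'' t = sm K U HHH TB t (\<lambda>v s.
    sm K H HH TB s (\<lambda>h r. sm K H H TB r (\<lambda>k l. sm K U H TB (\<rho> u') (\<lambda>p q.
      tens K U B (u \<otimes>\<^bsub>U\<^esub> (p \<otimes>\<^bsub>U\<^esub> v)) (actB b (q \<otimes>\<^bsub>H\<^esub> h) \<otimes>\<^bsub>B\<^esub> (actB b' k \<otimes>\<^bsub>B\<^esub> actB b'' l))))))"

lemmas rmaps_sm = map2_1_sm[OF _ _ _ _ rho_lin] map2_2_sm[OF _ _ _ _ Delta_lin]
  map3_1_sm[OF _ _ _ _ _ rho_lin] map3_2_sm[OF _ _ _ _ _ Delta_lin] map3_3_sm[OF _ _ _ _ _ Delta_lin]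
  unit_right_sm unit_left_tens

text \<open>The outer product makes u''_<1> Q^2 act on a product in B, so \<Delta> splits both, and
  rebracketing in B contributes \<Psi> as the last factor.\<close>

lemma SB_assoc_l:
  assumes "u \<in> carrier U" "b \<in> carrier B" "u' \<in> carrier U" "b' \<in> carrier B" "u'' \<in> carrier U"
      "b'' \<in> carrier B"
    and PQ: "P \<in> carrier UHH" "Q \<in> carrier UHH"
  shows "mult_r Q (mult_r P (tens K U B u b) (tens K U B u' b')) (tens K U B u'' b'')
    = ev_assoc_r u b u' b' b'' (unit_right K U H H H P \<otimes>\<^bsub>B4\<^esub> unit_right K U H H H (map2_2 K U H H \<Delta> (\<rho> u'')) \<otimes>\<^bsub>B4\<^esub>
        map3_2 K U H H H \<Delta> Q \<otimes>\<^bsub>B4\<^esub> unit_left K U H H H \<Psi>)"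
  using assms(1-6)
  apply (simp add: mult_r_def ev_assoc_r_def)
  apply (rule tensor_ext3[of U H H TB _ _ P]; (simp add: PQ)?)
  apply (rule tensor_ext3[of U H H TB _ _ Q]; (simp add: PQ rmaps_sm)?)
  apply (rule tensor_ext3[of H H H TB _ _ \<Psi>]; simp?)
  apply (rule tensor_ext[of U H TB _ _ "\<rho> u''"]; simp?)
  apply (rule tensor_ext[of U H TB _ _ "\<rho> u'"]; simp?)
  apply (rule sm_comm; simp)
  done

text \<open>The outer coaction meets u' u''_<0> Q^1, whence \<rho> on Q and the twofold coaction on
  u''; \<Delta> on P comes from P^3 acting on a product in B.\<close>

lemma SB_assoc_r:
  assumes "u \<in> carrier U" "b \<in> carrier B" "u' \<in> carrier U" "b' \<in> carrier B" "u'' \<in> carrier U"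
      "b'' \<in> carrier B"
    and PQ: "P \<in> carrier UHH" "Q \<in> carrier UHH"
  shows "mult_r P (tens K U B u b) (mult_r Q (tens K U B u' b') (tens K U B u'' b''))
    = ev_assoc_r u b u' b' b'' (unit_right K U H H H (map2_1 K U H H \<rho> (\<rho> u'')) \<otimes>\<^bsub>B4\<^esub>
        map3_1 K U H H H \<rho> Q \<otimes>\<^bsub>B4\<^esub> map3_3 K U H H H \<Delta> P)"
  using assms(1-6)
  apply (simp add: mult_r_def ev_assoc_r_def)
  apply (rule tensor_ext3[of U H H TB _ _ P]; (simp add: PQ)?)
  apply (rule tensor_ext3[of U H H TB _ _ Q]; (simp add: PQ rmaps_sm)?)
  apply (rule tensor_ext[of U H TB _ _ "\<rho> u''"]; simp?)
  apply (rule tensor_ext[of U H TB _ _ "\<rho> u'"]; simp?)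
  \<comment> \<open>Besides the two sums to be exchanged there is one over \<Delta> of the third leg
    of P. It is made pure as well, since the exchange rule moves only two adjacent sums.\<close>
  subgoal for y\<^sub>1 y\<^sub>2 y\<^sub>3
    by (rule tensor_ext[of H H TB _ _ "\<Delta> y\<^sub>3"]; simp?) (rule sm_comm; simp)
  done

lemma SB_k_algebra [simp]: "k_algebra K SB"
proof (rule k_algebraI[of _ U B, OF space_SB _ _ SB_mult_lin], simp_all, goal_cases)
  case (1 v w)
  then show ?case by (simp add: SB_mult mult_r_def)
next
  case (2 v w)
  then show ?case by (simp add: SB_mult mult_r_def)
next
  case (3 u b u' b' u'' b'')
  interpret B4: monoid B4 by (rule k_algebra_monoid) simp
  let ?r = "unit_right K U H H H"
  have *: "?r \<psi> \<otimes>\<^bsub>B4\<^esub> ?r (map2_2 K U H H \<Delta> (\<rho> u'')) = ?r (map2_1 K U H H \<rho> (\<rho> u'')) \<otimes>\<^bsub>B4\<^esub> ?r \<psi>"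
    using 3 by (simp flip: alg_hom_mult[OF alg_hom_unit_right, simplified] add: rho_quasi_coassoc_inv)
  have "?r \<psi> \<otimes>\<^bsub>B4\<^esub> ?r (map2_2 K U H H \<Delta> (\<rho> u'')) \<otimes>\<^bsub>B4\<^esub> map3_2 K U H H H \<Delta> \<psi> \<otimes>\<^bsub>B4\<^esub> unit_left K U H H H \<Psi>
      = ?r (map2_1 K U H H \<rho> (\<rho> u'')) \<otimes>\<^bsub>B4\<^esub> (map3_1 K U H H H \<rho> \<psi> \<otimes>\<^bsub>B4\<^esub> map3_3 K U H H H \<Delta> \<psi>)"
    unfolding rho_pentagon_inv * using 3 by (simp add: B4.m_assoc)
  then show ?case
    using 3 by (simp add: SB_mult SB_assoc_l SB_assoc_r B4.m_assoc)
qed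

lemma SB_one_l:
  assumes "u \<in> carrier U" "b \<in> carrier B" "v \<in> carrier U"
  shows "tens K U B v \<one>\<^bsub>B\<^esub> \<otimes>\<^bsub>SB\<^esub> tens K U B u b = tens K U B (v \<otimes>\<^bsub>U\<^esub> u) b"
  using assms by (simp add: SB_mult mult_r_def)

lemma SB_one_r:
  assumes "u \<in> carrier U" "b \<in> carrier B" "v \<in> carrier U"
  shows "tens K U B u b \<otimes>\<^bsub>SB\<^esub> tens K U B v \<one>\<^bsub>B\<^esub> =
    sm K U H TB (\<rho> v) (\<lambda>p q. tens K U B (u \<otimes>\<^bsub>U\<^esub> p) (actB b q))"
  using assms by (simp add: SB_mult mult_r_def)

end

lemma (in ground_field) alg_hom_tensor_id:
  assumes "k_algebra K V" "k_algebra K X" "k_algebra K Y" and g: "alg_hom K X Y g"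
  shows "alg_hom K (V \<star> X) (V \<star> Y) (\<lambda>t. sm K V X (V \<boxtimes> Y) t (\<lambda>v x. tens K V Y v (g x)))"
proof -
  note [simp] = assms alg_hom_lin[OF g] lin_closed[OF alg_hom_lin[OF g]] alg_hom_mult[OF g] alg_hom_one[OF g]
    lin_comp[OF _ alg_hom_lin[OF g]]
  show ?thesis by (rule alg_hom_tensorI[of _ _ V X]) simp_all
qed

section \<open>The left comodule algebra structure on the right smash product\<close>

locale right_smash_bicomodule =
  bicomodule_algebra K H \<Delta> \<epsilon> \<Phi> U lam \<rho> \<Phi>lam \<Phi>\<rho> \<Phi>lr + MB: right_module_algebra K H \<Delta> \<epsilon> \<Phi> B actB
  for K :: "'k ring" and H :: "('k, 'h) module" and \<Delta> \<epsilon> \<Phi>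
    and U :: "('k, 'u) module" and lam \<rho> \<Phi>lam \<Phi>\<rho> \<Phi>lr and B :: "('k, 'b) module" and actB
begin

sublocale right_smash_setting K H \<Delta> \<epsilon> \<Phi> U \<rho> \<Phi>\<rho> B actB
  by unfold_locales

abbreviation L where "L \<equiv> right_smash_coact K H U lam \<rho> \<Phi>\<rho> \<Phi>lr B actB"
abbreviation HT where "HT \<equiv> H \<boxtimes> TB"
abbreviation HHT where "HHT \<equiv> H \<boxtimes> HT"

definition coact_r where
  "coact_r P = (\<lambda>t. sm K U B HT t (\<lambda>u b. sm K H U HT (lam u) (\<lambda>p q.
    sm K H UH HT P (\<lambda>x s. sm K U H HT s (\<lambda>y z.
      tens K H TB (p \<otimes>\<^bsub>H\<^esub> x) (tens K U B (q \<otimes>\<^bsub>U\<^esub> y) (actB b z)))))))"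

lemma L_coact_r: "t \<in> carrier TB \<Longrightarrow> L t = coact_r \<theta> t"
  unfolding right_smash_coact_def coact_r_def Let_def tuple_defs SB_to_space tensor_to_space
  by (intro sw_eq_sm) simp_all

lemma coact_r_in [simp]: "coact_r P t \<in> carrier HT"
  by (simp add: coact_r_def)

lemma coact_r_lin [simp]: "lin K X TB f \<Longrightarrow> lin K X HT (\<lambda>x. coact_r P (f x))"
  by (simp add: coact_r_def)

lemma L_lin [simp]: "lin K TB HT L"
  by (rule lin_cong[where g="coact_r \<theta>"]) (simp_all add: L_coact_r)

text \<open>Of the two factors in U, the second one enters through t with both of its coactions; the
  first one needs only lam and stays outside.\<close>

definition ev_mult_r where
  "ev_mult_r u b b' t = sm K H UHH HT t (\<lambda>h s.
    sm K U HH HT s (\<lambda>v r. sm K H H HT r (\<lambda>k l. sm K H U HT (lam u) (\<lambda>p q.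
      tens K H TB (p \<otimes>\<^bsub>H\<^esub> h) (tens K U B (q \<otimes>\<^bsub>U\<^esub> v) (actB b k \<otimes>\<^bsub>B\<^esub> actB b' l))))))"

abbreviation B5 where "B5 \<equiv> H \<star> U \<star> H \<star> H"

lemmas rmaps2_sm = map2_1_sm[OF _ _ _ _ lam_lin] map2_2_sm[OF _ _ _ _ rho_lin]
  map2_1_sm[OF _ _ _ _ Delta_lin] map2_2_sm[OF _ _ _ _ lam_lin]
  map3_1_sm[OF _ _ _ _ _ Delta_lin] map3_2_sm[OF _ _ _ _ _ lam_lin] map3_3_sm[OF _ _ _ _ _ rho_lin]
  map3_1_sm[OF _ _ _ _ _ lam_lin] map3_2_sm[OF _ _ _ _ _ rho_lin] map3_3_sm[OF _ _ _ _ _ Delta_lin]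
  unit_right_sm unit_left_tens

lemma L_mult_l:
  assumes "u \<in> carrier U" "b \<in> carrier B" "u' \<in> carrier U" "b' \<in> carrier B"
    and PQ: "P \<in> carrier UHH" "Q \<in> carrier HUH"
  shows "coact_r Q (mult_r P (tens K U B u b) (tens K U B u' b'))
    = ev_mult_r u b b' (unit_right K H U H H (map2_1 K H U H lam (\<rho> u')) \<otimes>\<^bsub>B5\<^esub> map3_1 K H U H H lam P \<otimes>\<^bsub>B5\<^esub>
        map3_3 K H U H H \<Delta> Q)"
  using assms(1-4)
  apply (simp add: mult_r_def coact_r_def ev_mult_r_def)
  apply (rule tensor_ext3[of U H H HT _ _ P]; (simp add: PQ)?)
  apply (rule tensor_ext3[of H U H HT _ _ Q]; (simp add: PQ rmaps2_sm)?)
  apply (rule tensor_ext[of U H HT _ _ "\<rho> u'"]; simp?)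
  apply (rule tensor_ext[of H U HT _ _ "lam u"]; simp?)
  subgoal for y\<^sub>1 y\<^sub>2 y\<^sub>3 x\<^sub>1 x\<^sub>2 x\<^sub>3
    by (rule tensor_ext[of H H HT _ _ "\<Delta> x\<^sub>3"]; simp?) (rule sm_comm; simp)
  done

lemma L_mult_r:
  assumes "u \<in> carrier U" "b \<in> carrier B" "u' \<in> carrier U" "b' \<in> carrier B"
    and PQ: "P \<in> carrier HUH" "Q \<in> carrier HUH"
  shows "coact_r Q (tens K U B u b) \<otimes>\<^bsub>H \<star> SB\<^esub> coact_r P (tens K U B u' b')
    = ev_mult_r u b b' (unit_right K H U H H Q \<otimes>\<^bsub>B5\<^esub> unit_right K H U H H (map2_2 K H U H \<rho> (lam u')) \<otimes>\<^bsub>B5\<^esub>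
        map3_2 K H U H H \<rho> P \<otimes>\<^bsub>B5\<^esub> unit_left K H U H H \<psi>)"
  using assms(1-4)
  apply (simp add: mult_r_def coact_r_def ev_mult_r_def SB_mult)
  apply (rule tensor_ext3[of H U H HT _ _ P]; (simp add: PQ)?)
  apply (rule tensor_ext3[of H U H HT _ _ Q]; (simp add: PQ rmaps2_sm)?)
  apply (rule tensor_ext3[of U H H HT _ _ \<psi>]; simp?)
  apply (rule tensor_ext[of H U HT _ _ "lam u'"]; simp?)
  apply (rule tensor_ext[of H U HT _ _ "lam u"]; simp?)
  apply (rule sm_comm; simp)
  done

lemma L_hom: "alg_hom K SB (H \<star> SB) L"
proof (rule alg_hom_tensorI[of _ _ U B])
  fix u b u' b'
  assume [simp]: "u \<in> carrier U" "b \<in> carrier B" "u' \<in> carrier U" "b' \<in> carrier B"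
  let ?r = "unit_right K H U H H"
  interpret B5: monoid B5 by (rule k_algebra_monoid) simp
  have *: "?r \<theta> \<otimes>\<^bsub>B5\<^esub> ?r (map2_2 K H U H \<rho> (lam u')) = ?r (map2_1 K H U H lam (\<rho> u')) \<otimes>\<^bsub>B5\<^esub> ?r \<theta>"
    by (simp flip: alg_hom_mult[OF alg_hom_unit_right, simplified] add: lam_rho_commute_inv)
  have "?r \<theta> \<otimes>\<^bsub>B5\<^esub> ?r (map2_2 K H U H \<rho> (lam u')) \<otimes>\<^bsub>B5\<^esub> map3_2 K H U H H \<rho> \<theta> \<otimes>\<^bsub>B5\<^esub> unit_left K H U H H \<psi>
      = ?r (map2_1 K H U H lam (\<rho> u')) \<otimes>\<^bsub>B5\<^esub> (map3_1 K H U H H lam \<psi> \<otimes>\<^bsub>B5\<^esub> map3_3 K H U H H \<Delta> \<theta>)"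
    unfolding Phi_lr_pentagon_rho_inv(1) * by (simp add: B5.m_assoc)
  then show "L (tens K U B u b \<otimes>\<^bsub>SB\<^esub> tens K U B u' b')
      = L (tens K U B u b) \<otimes>\<^bsub>H \<star> SB\<^esub> L (tens K U B u' b')"
    by (simp add: L_coact_r SB_mult L_mult_l L_mult_r B5.m_assoc)
qed (simp_all, simp add: L_coact_r coact_r_def)

definition ev_coassoc_r where
  "ev_coassoc_r b t = sm K H HUH HHT t (\<lambda>h s.
    sm K H UH HHT s (\<lambda>k r. sm K U H HHT r (\<lambda>v l.
      tens K H HT h (tens K H TB k (tens K U B v (actB b l))))))"

text \<open>The embedding u \<mapsto> u # 1 and its tensor products with one, two and three
  identities of H on the left. As tensors nest to the right, the embedded factor is the innermost
  one, so these maps are built by iteration, in contrast to the single \<open>J\<close>.\<close>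

definition I1 where "I1 u = tens K U B u \<one>\<^bsub>B\<^esub>"
definition I2 where "I2 t = sm K H U HT t (\<lambda>h u. tens K H TB h (I1 u))"
definition I3 where
  "I3 t = sm K H HU HHT t (\<lambda>h s. tens K H HT h (I2 s))"
definition I4 where
  "I4 t = sm K H HHU (H \<boxtimes> HHT) t
    (\<lambda>h s. tens K H HHT h (I3 s))"

lemma I_lin [simp]:
  "lin K U TB I1" "lin K HU HT I2"
  "lin K HHU HHT I3"
  "lin K (H \<boxtimes> HHU) (H \<boxtimes> HHT) I4"
proof -
  show I1: "lin K U TB I1" by (simp add: I1_def[abs_def])
  note [simp] = lin_comp[OF _ I1] lin_closed[OF I1] I1
  show I2: "lin K HU HT I2" by (simp add: I2_def[abs_def])
  note [simp] = lin_comp[OF _ I2] lin_closed[OF I2] I2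
  show I3: "lin K HHU HHT I3"
    by (simp add: I3_def[abs_def])
  note [simp] = lin_comp[OF _ I3] lin_closed[OF I3] I3
  show "lin K (H \<boxtimes> HHU) (H \<boxtimes> HHT) I4"
    by (simp add: I4_def[abs_def])
qed

lemmas I_lin_comp [simp] = I_lin[THEN lin_comp[rotated]]
lemmas I_in [simp] = I_lin[THEN lin_closed]

lemma I_tens [simp]:
  "h \<in> carrier H \<Longrightarrow> u \<in> carrier U \<Longrightarrow> I2 (tens K H U h u) = tens K H TB h (I1 u)"
  "h \<in> carrier H \<Longrightarrow> s \<in> carrier HU \<Longrightarrow>
    I3 (tens K H HU h s) = tens K H HT h (I2 s)"
  "h \<in> carrier H \<Longrightarrow> r \<in> carrier HHU \<Longrightarrow>
    I4 (tens K H HHU h r) = tens K H HHT h (I3 r)"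
  by (simp_all add: I2_def I3_def I4_def)

lemma I_hom:
  "alg_hom K U SB I1" "alg_hom K (H \<star> U) (H \<star> SB) I2"
  "alg_hom K (H \<star> H \<star> U) (H \<star> H \<star> SB) I3"
  "alg_hom K (H \<star> H \<star> H \<star> U) (H \<star> H \<star> H \<star> SB) I4"
proof -
  show 1: "alg_hom K U SB I1"
    by (rule alg_homI) (simp_all, simp_all add: I1_def SB_one_l)
  show 2: "alg_hom K (H \<star> U) (H \<star> SB) I2"
    using alg_hom_tensor_id[OF _ _ _ 1, of H] by (simp add: I2_def[abs_def])
  show 3: "alg_hom K (H \<star> H \<star> U) (H \<star> H \<star> SB) I3"
    using alg_hom_tensor_id[OF _ _ _ 2, of H] by (simp add: I3_def[abs_def])
  show "alg_hom K (H \<star> H \<star> H \<star> U) (H \<star> H \<star> H \<star> SB) I4"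
    using alg_hom_tensor_id[OF _ _ _ 3, of H] by (simp add: I4_def[abs_def])
qed

abbreviation PB where "PB \<equiv> right_smash_reassoc K H U \<rho> \<Phi>lam \<Phi>\<rho> B actB"

lemma PB_I: "PB = I3 \<Phi>lam"
proof -
  have "PB = sm K H HU HHT \<Phi>lam (\<lambda>x s.
    sm K H U HHT s (\<lambda>y z. tens K H HT x (tens K H TB y (tens K U B z \<one>\<^bsub>B\<^esub>))))"
    unfolding right_smash_reassoc_def Let_def tuple_defs SB_to_space tensor_to_space
    by (intro sw_eq_sm) simp_all
  then show ?thesis by (simp add: I3_def I2_def I1_def)
qed

abbreviation B6 where "B6 \<equiv> H \<star> H \<star> U \<star> H"
text \<open>Multiplying by \<open>I3 X\<close> from the right is where \<rho> enters: by
  \<open>SB_one_r\<close> the third leg of X acts on b through its right coaction.\<close>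

lemma L_coassoc_l:
  assumes "u \<in> carrier U" "b \<in> carrier B"
    and PQ: "P \<in> carrier HUH" "X \<in> carrier HHU"
      "Q \<in> carrier HUH"
  shows "map2_2 K H H SB (coact_r P) (coact_r Q (tens K U B u b)) \<otimes>\<^bsub>H \<star> H \<star> SB\<^esub> I3 X
    = ev_coassoc_r b (unit_right K H H U H (map2_2 K H H U lam (lam u)) \<otimes>\<^bsub>B6\<^esub> map3_2 K H H U H lam Q \<otimes>\<^bsub>B6\<^esub>
        unit_left K H H U H P \<otimes>\<^bsub>B6\<^esub> map3_3 K H H U H \<rho> X)"
  using assms(1-2)
  apply (simp add: map2_2_sm[of TB H H SB "coact_r P"] ev_coassoc_r_def)
  apply (rule tensor_ext3[of H H U HHT _ _ X]; (simp add: PQ)?)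
  apply (rule tensor_ext3[of H U H HHT _ _ P]; (simp add: PQ coact_r_def rmaps2_sm I1_def)?)
  apply (rule tensor_ext3[of H U H HHT _ _ Q]; (simp add: PQ SB_one_r)?)
  apply (rule tensor_ext[of H U HHT _ _ "lam u"]; simp?)
  subgoal for x\<^sub>1 x\<^sub>2 x\<^sub>3
    by (rule tensor_ext[of U H HHT _ _ "\<rho> x\<^sub>3"]; simp?) (rule sm_comm; simp)
  done

lemma L_coassoc_r:
  assumes "u \<in> carrier U" "b \<in> carrier B"
    and PQ: "P \<in> carrier HUH" "X \<in> carrier HHU"
  shows "I3 X \<otimes>\<^bsub>H \<star> H \<star> SB\<^esub> map2_1 K H H SB \<Delta> (coact_r P (tens K U B u b))
    = ev_coassoc_r b (unit_right K H H U H X \<otimes>\<^bsub>B6\<^esub> unit_right K H H U H (map2_1 K H H U \<Delta> (lam u))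
        \<otimes>\<^bsub>B6\<^esub> map3_1 K H H U H \<Delta> P)"
  using assms(1-2)
  apply (simp add: map2_1_sm[of H H H SB \<Delta>] ev_coassoc_r_def)
  apply (rule tensor_ext3[of H H U HHT _ _ X]; (simp add: PQ)?)
  apply (rule tensor_ext3[of H U H HHT _ _ P]; (simp add: PQ coact_r_def rmaps2_sm I1_def)?)
  apply (rule tensor_ext[of H U HHT _ _ "lam u"]; (simp add: SB_one_l)?)
  apply (rule sm_comm; simp)
  done

lemma L_quasi_coassoc:
  assumes "s \<in> carrier TB"
  shows "map2_2 K H H SB L (L s) \<otimes>\<^bsub>H \<star> H \<star> SB\<^esub> PB
    = PB \<otimes>\<^bsub>H \<star> H \<star> SB\<^esub> map2_1 K H H SB \<Delta> (L s)"
proof (rule tensor_ext[of U B HHT _ _ s])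
  note [simp] = alg_hom_lin_comp[OF alg_hom_map2_2[OF _ _ _ _ L_hom], simplified]
    alg_hom_lin_comp[OF alg_hom_map2_1[of H H H SB \<Delta>, OF _ _ _ _ comult_hom], simplified]
    lin_closed[OF L_lin] lin_comp[OF _ L_lin]
  show "lin K TB HHT (\<lambda>s. map2_2 K H H SB L (L s) \<otimes>\<^bsub>H \<star> H \<star> SB\<^esub> PB)"
    "lin K TB HHT (\<lambda>s. PB \<otimes>\<^bsub>H \<star> H \<star> SB\<^esub> map2_1 K H H SB \<Delta> (L s))"
    by (simp_all add: PB_I)
  fix u b assume [simp]: "u \<in> carrier U" "b \<in> carrier B"
  interpret B6: monoid B6 by (rule k_algebra_monoid) simp
  let ?r = "unit_right K H H U H"
  have *: "?r (map2_2 K H H U lam (lam u)) \<otimes>\<^bsub>B6\<^esub> ?r \<Phi>lam = ?r \<Phi>lam \<otimes>\<^bsub>B6\<^esub> ?r (map2_1 K H H U \<Delta> (lam u))"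
    by (simp flip: alg_hom_mult[OF alg_hom_unit_right, simplified] add: lam_quasi_coassoc[simplified])
  have "?r (map2_2 K H H U lam (lam u)) \<otimes>\<^bsub>B6\<^esub> (map3_2 K H H U H lam \<theta> \<otimes>\<^bsub>B6\<^esub>
        unit_left K H H U H \<theta> \<otimes>\<^bsub>B6\<^esub> map3_3 K H H U H \<rho> \<Phi>lam)
      = ?r \<Phi>lam \<otimes>\<^bsub>B6\<^esub> ?r (map2_1 K H H U \<Delta> (lam u)) \<otimes>\<^bsub>B6\<^esub> map3_1 K H H U H \<Delta> \<theta>"
    unfolding Phi_lr_pentagon_lam_inv(2) *[symmetric] by (simp add: B6.m_assoc)
  moreover have "map2_2 K H H SB L (L (tens K U B u b))
      = map2_2 K H H SB (coact_r \<theta>) (coact_r \<theta> (tens K U B u b))"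
    by (simp add: map2_2_sm[of TB H H SB L] map2_2_sm[of TB H H SB "coact_r \<theta>"] L_coact_r)
  ultimately show "map2_2 K H H SB L (L (tens K U B u b)) \<otimes>\<^bsub>H \<star> H \<star> SB\<^esub> PB
      = PB \<otimes>\<^bsub>H \<star> H \<star> SB\<^esub> map2_1 K H H SB \<Delta> (L (tens K U B u b))"
    by (simp add: PB_I L_coassoc_l L_coact_r L_coassoc_r B6.m_assoc)
qed (use assms in simp_all)

lemma PB_Units: "PB \<in> Units (tensor3 K H H SB)"
  "inv\<^bsub>tensor3 K H H SB\<^esub> PB = I3 (inv\<^bsub>tensor3 K H H U\<^esub> \<Phi>lam)"
  using alg_hom_Units[OF I_hom(3) _ _ Phi_lam_unit[simplified]] by (simp_all add: PB_I)

lemma I_maps: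
  "s \<in> carrier HHU \<Longrightarrow> unit_left K H H H SB (I3 s) = I4 (unit_left K H H H U s)" (is "PROP ?l")
  "s \<in> carrier HHU \<Longrightarrow> map3_2 K H H H SB \<Delta> (I3 s) = I4 (map3_2 K H H H U \<Delta> s)" (is "PROP ?m2")
  "s \<in> carrier HHU \<Longrightarrow> map3_3 K H H H SB L (I3 s) = I4 (map3_3 K H H H U lam s)" (is "PROP ?m3")
  "s \<in> carrier HHU \<Longrightarrow> map3_1 K H H H SB \<Delta> (I3 s) = I4 (map3_1 K H H H U \<Delta> s)" (is "PROP ?m1")
  "t \<in> carrier HHH \<Longrightarrow> unit_right K H H H SB t = I4 (unit_right K H H H U t)" (is "PROP ?r")
proof -
  \<comment> \<open>On u # 1 the leg \<theta>^3 acts on the unit of B through \<epsilon>, and (id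
    \<otimes> id \<otimes> \<epsilon>) \<theta> = 1 deletes \<theta>.\<close>
  have L1: "L (I1 u) = sm K H U HT (lam u) (\<lambda>p q. tens K H TB p (I1 q))"
    if "u \<in> carrier U" for u
    using that by (simp add: L_coact_r, simp add: coact_r_def I1_def)
  note [simp] = map3_2_sm[of H H H H SB \<Delta>] map3_1_sm[of H H H H SB \<Delta>] map3_3_sm[of SB H H H SB L]
    rmaps2_sm map3_2_sm[of H H H H U \<Delta>] map3_1_sm[of H H H H U \<Delta>] map3_3_sm[of U H H H U lam] L1
    alg_hom_lin_comp[OF alg_hom_unit_right[of H H H SB], unfolded tuple_defs, unfolded tensor_to_space
        SB_to_space]
    alg_hom_lin_comp[OF alg_hom_map3_2[of H H H H SB \<Delta>, OF _ _ _ _ _ comult_hom],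
      unfolded tuple_defs, unfolded tensor_to_space SB_to_space]
    alg_hom_lin_comp[OF alg_hom_map3_1[of H H H H SB \<Delta>, OF _ _ _ _ _ comult_hom],
      unfolded tuple_defs, unfolded tensor_to_space SB_to_space]
    alg_hom_lin_comp[OF alg_hom_map3_3[of SB H H H SB L, OF _ _ _ _ _ L_hom],
      unfolded tuple_defs, unfolded tensor_to_space SB_to_space]
  have I1_one [simp]: "I1 \<one>\<^bsub>U\<^esub> = tens K U B \<one>\<^bsub>U\<^esub> \<one>\<^bsub>B\<^esub>"
    by (simp add: I1_def)
  have I_sm [simp]: "I4 (sm K X Y (H \<boxtimes> HHU) t f)
      = sm K X Y (H \<boxtimes> HHT) t (\<lambda>x y. I4 (f x y))"
    if "module K X" "module K Y" "\<And>x y. x \<in> carrier X \<Longrightarrow> y \<in> carrier Y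
      \<Longrightarrow> f x y \<in> carrier (H \<boxtimes> HHU)"
    for X :: "('k, 'x) module" and Y :: "('k, 'y) module" and t f
    using that by (intro sm_apply) simp_all
  show "PROP ?l" by simp
  note ext = tensor_ext3[of H H U "H \<boxtimes> HHT" _ _ s]
  show "PROP ?m2" by (rule ext) simp_all
  show "PROP ?m3" by (rule ext) simp_all
  show "PROP ?m1" by (rule ext) simp_all
  show "PROP ?r" by (rule tensor_ext3[of H H H "H \<boxtimes> HHT" _ _ t]) simp_all
qed

theorem right_smash_left_comodule_algebra: "left_comodule_algebra K H \<Delta> \<epsilon> \<Phi> SB L PB"
proof (intro left_comodule_algebra.intro left_comodule_algebra_axioms.intro)
  show "quasi_bialgebra K H \<Delta> \<epsilon> \<Phi>" by (rule quasi_bialgebra_axioms)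
  show "k_algebra K SB" by simp
  show "alg_hom K SB (H \<star> SB) L" by (rule L_hom)
  show "PB \<in> Units (tensor3 K H H SB)" by (rule PB_Units)
  show "map2_2 K H H SB L (L s) \<otimes>\<^bsub>tensor3 K H H SB\<^esub> PB = PB \<otimes>\<^bsub>tensor3 K H H SB\<^esub> map2_1 K H H SB \<Delta> (L s)"
    if "s \<in> carrier SB" for s
    using L_quasi_coassoc[of s] that by simp
  show "unit_left K H H H SB PB \<otimes>\<^bsub>tensor4 K H H H SB\<^esub> map3_2 K H H H SB \<Delta> PB
      \<otimes>\<^bsub>tensor4 K H H H SB\<^esub> unit_right K H H H SB \<Phi>
      = map3_3 K H H H SB L PB \<otimes>\<^bsub>tensor4 K H H H SB\<^esub> map3_1 K H H H SB \<Delta> PB"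
    using lam_pentagon by (simp add: PB_I I_maps flip: alg_hom_mult[OF I_hom(4), simplified])
  show "sw K SB (L s) (\<lambda>u\<^sub>1 u\<^sub>0. \<epsilon> u\<^sub>1 \<odot>\<^bsub>SB\<^esub> u\<^sub>0) = s" if "s \<in> carrier SB" for s
  proof -
    have s: "s \<in> carrier TB" using that by simp
    have "sw K TB (coact_r \<theta> s) (\<lambda>u\<^sub>1 u\<^sub>0. \<epsilon> u\<^sub>1 \<odot>\<^bsub>TB\<^esub> u\<^sub>0) = sm K H TB TB (coact_r \<theta> s) (\<lambda>u\<^sub>1 u\<^sub>0. \<epsilon> u\<^sub>1 \<odot>\<^bsub>TB\<^esub> u\<^sub>0)"
      using s by (intro sw_eq_sm) simp_all
    also have "\<dots> = s"
      \<comment> \<open>Now the first leg u_[-1] \<theta>^1 goes to a scalar, so (\<epsilon>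
        \<otimes> id \<otimes> id) \<theta> = 1 and the counit law of lam are used.\<close>
      by (rule tensor_ext[of U B TB _ _ s]) (use s in \<open>simp_all, simp add: coact_r_def\<close>)
    finally show ?thesis using s by (simp add: L_coact_r)
  qed
  have counits: "counit2 H SB PB = \<one>\<^bsub>H \<star> SB\<^esub>" "counit1 H SB PB = \<one>\<^bsub>H \<star> SB\<^esub>"
    by (simp_all add: PB_I counit2_def counit1_def I3_def I2_def, simp_all add: I1_def)
  show "sw3 K (H \<star> SB) PB (\<lambda>x y z. \<epsilon> y \<odot>\<^bsub>H \<star> SB\<^esub> tens K H SB x z) = \<one>\<^bsub>H \<star> SB\<^esub>"
    by (subst counit2_eq) (simp_all add: PB_I[symmetric] counits, simp add: PB_I)
  show "sw3 K (H \<star> SB) PB (\<lambda>x y z. \<epsilon> x \<odot>\<^bsub>H \<star> SB\<^esub> tens K H SB y z) = \<one>\<^bsub>H \<star> SB\<^esub>"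
    by (subst counit1_eq) (simp_all add: PB_I[symmetric] counits, simp add: PB_I)
qed

end

section \<open>Iterated smash products\<close>

context ground_field
begin

text \<open>The records may differ as functions outside the carrier; agreement of the products on it
  is enough. This is how the two-sided smash product acquires its algebra axioms.\<close>

lemma k_algebra_transfer:
  assumes S: "k_algebra K S" and space: "space S' = space S" and one: "\<one>\<^bsub>S'\<^esub> = \<one>\<^bsub>S\<^esub>"
    and mult: "\<And>s t. s \<in> carrier S \<Longrightarrow> t \<in> carrier S \<Longrightarrow> s \<otimes>\<^bsub>S'\<^esub> t = s \<otimes>\<^bsub>S\<^esub> t"
  shows "k_algebra K S'" "alg_iso K S' S id"
proof -
  have sel: "carrier S' = carrier S" "add S' = add S" "smult S' = smult S"
    using space by (simp_all add: space_eq_iff)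
  have S': "module K S'"
    using module_space[OF space, of K] k_algebra_module[OF S] by simp
  interpret S: k_algebra K S by (rule S)
  show "k_algebra K S'"
    by (intro k_algebra.intro nonassoc_algebra.intro nonassoc_algebra_axioms.intro
        k_algebra_axioms.intro field_axioms S'; unfold sel one)
      (simp_all add: mult S.A_l_distr S.A_r_distr S.A_assoc)
  then show "alg_iso K S' S id"
    using S by (simp add: alg_iso_def alg_hom_def ring_hom_def sel one mult)
qed

lemma alg_hom_cong:
  assumes f: "alg_hom K S M f" and S: "k_algebra K S" and "\<And>x. x \<in> carrier S \<Longrightarrow> g x = f x"
  shows "alg_hom K S M g"
proof -
  interpret S: k_algebra K S by (rule S)
  show ?thesis
    by (intro alg_homI lin_cong[OF S.module_axioms _ alg_hom_lin[OF f S]])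
      (simp_all add: assms(3) S.A_mult_closed alg_hom_mult[OF f] alg_hom_one[OF f])
qed

end

section \<open>The quasi-bialgebra as a bicomodule algebra over itself\<close>

context quasi_bialgebra
begin

text \<open>Only the middle normalisation of \<Phi> is an axiom of a quasi-bialgebra. The two outer
  ones, which comodule algebras demand, are \<open>counit_slot1\<close> and
  \<open>counit_slot3\<close> with all reassociators equal to \<Phi>.\<close>

lemma H_bicomodule: "bicomodule_algebra K H \<Delta> \<epsilon> \<Phi> H \<Delta> \<Delta> \<Phi> \<Phi> \<Phi>"
proof -
  interpret bicoaction K H \<Delta> \<epsilon> \<Phi> H \<Delta> \<Delta>
    by unfold_locales (rule comult_hom counit_left counit_right; assumption?)+
  interpret H3: monoid "H \<star> H \<star> H" by (rule k_algebra_monoid) simp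
  \<comment> \<open>The axiom is a conjugation by \<Phi>; multiplying by \<Phi> on the right gives
    the intertwining form used for comodule algebras.\<close>
  have coassoc: "map2_2 K H H H \<Delta> (\<Delta> h) \<otimes>\<^bsub>tensor3 K H H H\<^esub> \<Phi> = \<Phi> \<otimes>\<^bsub>tensor3 K H H H\<^esub> map2_1 K H H H \<Delta> (\<Delta> h)"
    if "h \<in> carrier H" for h
    using that reassoc_unit H3.Units_l_inv[of \<Phi>] unfolding quasi_coassoc[OF that]
    by (simp add: H3.m_assoc del: one_tensor)
  have counit1: "counit1 H H \<Phi> = \<one>\<^bsub>H \<star> H\<^esub>"
    by (rule counit_slot1[OF _ counit2_Phi reassoc_unit pentagon]) simp
  have counit3: "counit3 H H \<Phi> = \<one>\<^bsub>H \<star> H\<^esub>"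
    by (rule counit_slot3[OF _ counit2_Phi reassoc_unit pentagon]) simp
  have "left_comodule_algebra K H \<Delta> \<epsilon> \<Phi> H \<Delta> \<Phi>"
    by unfold_locales
      (use lam_hom lam_counit coassoc reassoc_unit pentagon reassoc_counit counit1 counit1_eq[of H H \<Phi>]
          in simp_all)
  moreover have "right_comodule_algebra K H \<Delta> \<epsilon> \<Phi> H \<Delta> \<Phi>"
    by unfold_locales
      (use rho_hom rho_counit coassoc reassoc_unit pentagon reassoc_counit counit3 counit3_eq[of H H \<Phi>]
          in simp_all)
  ultimately show ?thesis
    by (intro bicomodule_algebra.intro bicomodule_algebra_axioms.intro)
      (use coassoc reassoc_unit pentagon in simp_all)
qed

end

section \<open>Comparison of the two-sided smash product with the iterated ones\<close>

locale two_sided_setting =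
  left_smash_bicomodule K H \<Delta> \<epsilon> \<Phi> U lam \<rho> \<Phi>lam \<Phi>\<rho> \<Phi>lr A act
      + right_smash_bicomodule K H \<Delta> \<epsilon> \<Phi> U lam \<rho> \<Phi>lam \<Phi>\<rho> \<Phi>lr B actB
  for K :: "'k ring" and H :: "('k, 'h) module" and \<Delta> \<epsilon> \<Phi>
    and U :: "('k, 'u) module" and lam \<rho> \<Phi>lam \<Phi>\<rho> \<Phi>lr and A :: "('k, 'a) module" and act
    and B :: "('k, 'b) module" and actB
begin

abbreviation TS where "TS \<equiv> two_sided_smash K H A act U lam \<rho> \<Phi>lam \<Phi>\<rho> \<Phi>lr B actB"
abbreviation RL where "RL \<equiv> right_then_left_smash K H A act U lam \<rho> \<Phi>lam \<Phi>\<rho> \<Phi>lr B actB"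
abbreviation LR where "LR \<equiv> left_then_right_smash K H A act U lam \<rho> \<Phi>lam \<Phi>\<rho> \<Phi>lr B actB"
abbreviation AUB where "AUB \<equiv> A \<boxtimes> TB"
abbreviation AU_B where "AU_B \<equiv> T \<boxtimes> B"

lemma space_TS [simp]: "space TS = AUB"
  by (simp add: two_sided_smash_def Let_def)

lemma space_TS_eq: "space TS = space AUB"
  by simp

lemmas TS_to_space [simp] = space_rules[OF space_TS_eq]

lemma one_TS [simp]: "\<one>\<^bsub>TS\<^esub> = tens K A TB \<one>\<^bsub>A\<^esub> (tens K U B \<one>\<^bsub>U\<^esub> \<one>\<^bsub>B\<^esub>)"
  by (simp add: two_sided_smash_def Let_def)

definition mult_ts where
  "mult_ts s t = sm K A TB AUB s (\<lambda>a r. sm K U B AUB r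
      (\<lambda>u b. sm K A TB AUB t (\<lambda>a' r'. sm K U B AUB r' (\<lambda>u' b'.
    sm K H HU AUB \<phi> (\<lambda>x\<^sub>1 x. sm K H U AUB x (\<lambda>x\<^sub>2 x\<^sub>3. sm K H U AUB (lam u) (\<lambda>u\<^sub>1 u\<^sub>0.
    sm K H UH AUB \<theta> (\<lambda>z\<^sub>1 z. sm K U H AUB z (\<lambda>z\<^sub>2 z\<^sub>3. sm K U H AUB (\<rho> u') (\<lambda>v\<^sub>0 v\<^sub>1.
    sm K U HH AUB \<psi> (\<lambda>y\<^sub>1 y. sm K H H AUB y (\<lambda>y\<^sub>2 y\<^sub>3.
      tens K A TB (act x\<^sub>1 a \<otimes>\<^bsub>A\<^esub> act (x\<^sub>2 \<otimes>\<^bsub>H\<^esub> (u\<^sub>1 \<otimes>\<^bsub>H\<^esub> z\<^sub>1)) a')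
        (tens K U B (x\<^sub>3 \<otimes>\<^bsub>U\<^esub> (u\<^sub>0 \<otimes>\<^bsub>U\<^esub> (z\<^sub>2 \<otimes>\<^bsub>U\<^esub> (v\<^sub>0 \<otimes>\<^bsub>U\<^esub> y\<^sub>1))))
          (actB b (z\<^sub>3 \<otimes>\<^bsub>H\<^esub> (v\<^sub>1 \<otimes>\<^bsub>H\<^esub> y\<^sub>2)) \<otimes>\<^bsub>B\<^esub> actB b' y\<^sub>3))))))))))))))"

lemma TS_mult:
  assumes "s \<in> carrier AUB" "t \<in> carrier AUB"
  shows "s \<otimes>\<^bsub>TS\<^esub> t = mult_ts s t"
  unfolding mult_ts_def two_sided_smash_def Let_def tuple_defs using assms
  by simp (intro sw_eq_sm, simp_all)

text \<open>The right smash product is itself a left comodule algebra, so the iterated product is an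
  ordinary left smash product and its associativity is already known.\<close>

lemma RL_setting: "left_smash_setting K H \<Delta> \<epsilon> \<Phi> SB L PB A act"
  by (intro left_smash_setting.intro right_smash_left_comodule_algebra MA.left_module_algebra_axioms)

lemma LR_setting: "right_smash_setting K H \<Delta> \<epsilon> \<Phi> S R PS B actB"
  by (intro right_smash_setting.intro left_smash_right_comodule_algebra MB.right_module_algebra_axioms)

text \<open>As tensors nest to the right, both algebras live on the same space, and their
  multiplications coincide. The identity is therefore an isomorphism, and the two-sided product
  inherits the algebra axioms.\<close>

lemma RL_iso: "k_algebra K TS" "alg_iso K TS RL id"
proof -
  interpret RL: left_smash_setting K H \<Delta> \<epsilon> \<Phi> SB L PB A act
    by (rule RL_setting)
  have RL: "RL = RL.S"
    by (simp add: right_then_left_smash_def)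
  \<comment> \<open>\<open>I3 \<phi>\<close> is the inverse of the reassociator \<open>PB\<close>,
    and is therefore the tensor in the multiplication of the iterated product.\<close>
  have mult_eq: "RL.mult_l (I3 \<phi>) s t = mult_ts s t" if s: "s \<in> carrier AUB" and t: "t \<in> carrier AUB" for s t
  proof (rule tensor_ext3[of A U B AUB _ _ s])
    fix a u b assume [simp]: "a \<in> carrier A" "u \<in> carrier U" "b \<in> carrier B"
    show "RL.mult_l (I3 \<phi>) (tens K A TB a (tens K U B u b)) t = mult_ts (tens K A TB a (tens K U B u b)) t"
    proof (rule tensor_ext3[of A U B AUB _ _ t])
      fix a' u' b' assume [simp]: "a' \<in> carrier A" "u' \<in> carrier U" "b' \<in> carrier B"
      show "RL.mult_l (I3 \<phi>) (tens K A TB a (tens K U B u b)) (tens K A TB a' (tens K U B u' b'))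
          = mult_ts (tens K A TB a (tens K U B u b)) (tens K A TB a' (tens K U B u' b'))"
        by (simp add: RL.mult_l_def mult_ts_def I3_def I2_def I1_def L_coact_r coact_r_def SB_one_l
            SB_mult mult_r_def)
    qed (use t in \<open>simp_all add: RL.mult_l_def mult_ts_def\<close>)
  qed (use s t in \<open>simp_all add: RL.mult_l_def mult_ts_def\<close>)
  have "s \<otimes>\<^bsub>TS\<^esub> t = s \<otimes>\<^bsub>RL.S\<^esub> t" if "s \<in> carrier RL.S" "t \<in> carrier RL.S" for s t
    using that PB_Units(2) by (simp add: TS_mult RL.S_mult mult_eq)
  then show "k_algebra K TS" "alg_iso K TS RL id"
    unfolding RL by (intro k_algebra_transfer[OF RL.S_k_algebra]; simp add: RL.space_S)+
qed

text \<open>Now the spaces differ by a rebracketing, so multiplicativity is compared along that map.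
  That the source is an algebra is taken from \<open>RL_iso\<close>.\<close>

lemma LR_iso: "alg_iso K TS LR (tensor_assoc K A U B)"
proof -
  interpret LR: right_smash_setting K H \<Delta> \<epsilon> \<Phi> S R PS B actB
    by (rule LR_setting)
  have LR: "LR = LR.SB"
    by (simp add: left_then_right_smash_def)
  \<comment> \<open>On the carrier this is \<open>tensor_assoc\<close>, rewritten with
    \<open>sm\<close> so that the simp rules apply; \<open>g\<close> is the rebracketing in the
    opposite direction.\<close>
  define f where "f = (\<lambda>t. sm K A TB AU_B t (\<lambda>a r. sm K U B AU_B r (\<lambda>u b. tens K T B (tens K A U a u) b)))"
  define g where "g = (\<lambda>t. sm K T B AUB t (\<lambda>s b. sm K A U AUB s (\<lambda>a u. tens K A TB a (tens K U B u b))))"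
  have f_lin: "lin K AUB AU_B f" and g_lin: "lin K AU_B AUB g"
    by (simp_all add: f_def g_def)
  have f: "tensor_assoc K A U B t = f t" if "t \<in> carrier AUB" for t
    unfolding tensor_assoc_def f_def tuple_defs using that by (intro sw_eq_sm) simp_all
  have f_pure: "f (tens K A TB a (tens K U B u b)) = tens K T B (tens K A U a u) b"
    if "a \<in> carrier A" "u \<in> carrier U" "b \<in> carrier B" for a u b
    using that by (simp add: f_def)
  have g_pure: "g (tens K T B (tens K A U a u) b) = tens K A TB a (tens K U B u b)"
    if "a \<in> carrier A" "u \<in> carrier U" "b \<in> carrier B" for a u b
    using that by (simp add: g_def)
  have gf: "g (f t) = t" if "t \<in> carrier AUB" for t
  proof (rule tensor_ext3[of A U B AUB _ _ t])
    show "lin K AUB AUB (\<lambda>t. g (f t))"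
      by (rule lin_comp[OF f_lin g_lin])
  qed (use that in \<open>simp_all add: f_pure g_pure\<close>)
  have fg: "f (g s) = s" if "s \<in> carrier AU_B" for s
  proof (rule tensor_ext[of T B AU_B _ _ s])
    show "lin K AU_B AU_B (\<lambda>s. f (g s))"
      by (rule lin_comp[OF g_lin f_lin])
    fix r b assume r: "r \<in> carrier T" and b: "b \<in> carrier B"
    have tb: "lin K T AU_B (\<lambda>r. tens K T B r b)"
      using b by simp
    show "f (g (tens K T B r b)) = tens K T B r b"
    proof (rule tensor_ext[of A U AU_B _ _ r])
      show "lin K T AU_B (\<lambda>r. f (g (tens K T B r b)))"
        by (rule lin_comp[OF lin_comp[OF tb g_lin] f_lin])
    qed (use r b in \<open>simp_all add: f_pure g_pure\<close>)
  qed (use that in simp_all)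
  have bij: "bij_betw f (carrier AUB) (carrier AU_B)"
    by (rule bij_betwI[of f _ _ g]) (auto simp: gf fg lin_closed[OF f_lin] lin_closed[OF g_lin])
  have pure: "f (mult_ts (tens K A TB a (tens K U B u b)) (tens K A TB a' (tens K U B u' b')))
      = LR.mult_r (J HH \<psi>) (tens K T B (tens K A U a u) b) (tens K T B (tens K A U a' u') b')"
    if [simp]: "a \<in> carrier A" "u \<in> carrier U" "b \<in> carrier B" "a' \<in> carrier A" "u' \<in> carrier U"
        "b' \<in> carrier B"
    for a u b a' u' b'
    apply (simp add: LR.mult_r_def mult_ts_def f_def J_def R_coact_l coact_l_def S_one_r)
    apply (rule tensor_ext3[of U H H AU_B _ _ \<psi>]; simp?)
    apply (rule tensor_ext3[of H U H AU_B _ _ \<theta>]; simp?)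
    \<comment> \<open>The product still to be evaluated in the left smash product is the one in
      which \<theta>^1 already acts on a'. Unfolding it brings in \<phi> and the coaction of
      u.\<close>
    apply (simp add: S_mult mult_l_def)
    apply (rule tensor_ext3[of H H U AU_B _ _ \<phi>]; simp?)
    apply (rule tensor_ext[of H U AU_B _ _ "lam u"]; simp?)
    done
  have hom: "alg_hom K TS LR.SB f"
    by (rule alg_hom_tensor3I[of _ _ A U B])
      (use RL_iso(1) LR.SB_k_algebra f_lin PS_Units(2) in \<open>simp_all add: f_pure TS_mult LR.SB_mult pure\<close>)
  have "alg_hom K TS LR.SB (tensor_assoc K A U B)"
    using RL_iso(1) f by (intro alg_hom_cong[OF hom]) simp_all
  moreover have "bij_betw (tensor_assoc K A U B) (carrier TS) (carrier LR.SB)"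
    using bij by (simp add: bij_betw_cong[of _ "tensor_assoc K A U B" f] f)
  ultimately show ?thesis
    unfolding LR alg_iso_def using RL_iso(1) LR.SB_k_algebra by simp
qed

end

theorem proposition8p1:
  fixes K :: "'k ring" and H :: "('k, 'h) module"
    and A :: "('k, 'a) module" and B :: "('k, 'b) module" and U :: "('k, 'u) module"
  assumes "quasi_bialgebra K H \<Delta> \<epsilon> \<Phi>"
    and "left_module_algebra K H \<Delta> \<epsilon> \<Phi> A act\<^sub>A"
    and "right_module_algebra K H \<Delta> \<epsilon> \<Phi> B act\<^sub>B"
    and "bicomodule_algebra K H \<Delta> \<epsilon> \<Phi> U lam \<rho> \<Phi>lam \<Phi>\<rho> \<Phi>lr"
  shows
    "right_comodule_algebra K H \<Delta> \<epsilon> \<Phi> (left_smash K H A act\<^sub>A U lam \<Phi>lam)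
       (left_smash_coact K H A act\<^sub>A U lam \<rho> \<Phi>lam \<Phi>lr)
       (left_smash_reassoc K H A act\<^sub>A U lam \<Phi>lam \<Phi>\<rho>)
     \<and> left_comodule_algebra K H \<Delta> \<epsilon> \<Phi> (right_smash K H U \<rho> \<Phi>\<rho> B act\<^sub>B)
       (right_smash_coact K H U lam \<rho> \<Phi>\<rho> \<Phi>lr B act\<^sub>B)
       (right_smash_reassoc K H U \<rho> \<Phi>lam \<Phi>\<rho> B act\<^sub>B)
     \<and> alg_iso K
       (two_sided_smash K H A act\<^sub>A U lam \<rho> \<Phi>lam \<Phi>\<rho> \<Phi>lr B act\<^sub>B)
       (left_then_right_smash K H A act\<^sub>A U lam \<rho> \<Phi>lam \<Phi>\<rho> \<Phi>lr B act\<^sub>B)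
       (tensor_assoc K A U B)
     \<and> alg_iso K
       (two_sided_smash K H A act\<^sub>A U lam \<rho> \<Phi>lam \<Phi>\<rho> \<Phi>lr B act\<^sub>B)
       (right_then_left_smash K H A act\<^sub>A U lam \<rho> \<Phi>lam \<Phi>\<rho> \<Phi>lr B act\<^sub>B)
       id
     \<and> bicomodule_algebra K H \<Delta> \<epsilon> \<Phi> H \<Delta> \<Delta> \<Phi> \<Phi> \<Phi>
     \<and> alg_iso K
       (two_sided_smash K H A act\<^sub>A H \<Delta> \<Delta> \<Phi> \<Phi> \<Phi> B act\<^sub>B)
       (left_then_right_smash K H A act\<^sub>A H \<Delta> \<Delta> \<Phi> \<Phi> \<Phi> B act\<^sub>B)
       (tensor_assoc K A H B)
     \<and> alg_iso K
       (two_sided_smash K H A act\<^sub>A H \<Delta> \<Delta> \<Phi> \<Phi> \<Phi> B act\<^sub>B)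
       (right_then_left_smash K H A act\<^sub>A H \<Delta> \<Delta> \<Phi> \<Phi> \<Phi> B act\<^sub>B)
       id"
proof -
  \<comment> \<open>Kept general in the bicomodule algebra, since it is used for the given one and
    for H itself.\<close>
  have setting: "two_sided_setting K H \<Delta> \<epsilon> \<Phi> V l r \<Phi>l \<Phi>r \<Phi>b A act\<^sub>A B act\<^sub>B"
    if "bicomodule_algebra K H \<Delta> \<epsilon> \<Phi> V l r \<Phi>l \<Phi>r \<Phi>b" for V :: "('k, 'v) module" and l r \<Phi>l \<Phi>r \<Phi>b
    by (intro two_sided_setting.intro left_smash_bicomodule.intro right_smash_bicomodule.intro that
        assms(2,3))
  interpret two_sided_setting K H \<Delta> \<epsilon> \<Phi> U lam \<rho> \<Phi>lam \<Phi>\<rho> \<Phi>lr A act\<^sub>A B act\<^sub>B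
    by (rule setting[OF assms(4)])
  note H_setting = setting[OF H_bicomodule]
  show ?thesis
    by (intro conjI left_smash_right_comodule_algebra right_smash_left_comodule_algebra LR_iso RL_iso(2)
        H_bicomodule two_sided_setting.LR_iso[OF H_setting] two_sided_setting.RL_iso(2)[OF H_setting])
qed

end
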